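(* There is an algorithm that, given any strings $A$ and $B$ of length $n$ and a string $P$ of length $r$, solves the STR-IC-LCS problem (that is, computes an STR-IC-LCS of $A$, $B$ and $P$) in $O(nr/\log r+n(n-\ell+1))$ time and $O((\ell+1)(n-\ell+1))$ space, where $\ell=\mathrm{lcs}(A,B)$ is the length of a longest common subsequence of $A$ and $B$.
   Context: Strings are over an alphabet $\Sigma$. A subsequence of a string is obtained by deleting zero or more characters; a substring is a contiguous block; a common subsequence of $A$ and $B$ is a string that is a subsequence of both. $\mathrm{lcs}(A,B)$ denotes the length of a longest common subsequence of $A$ and $B$. A string $Z$ is an STR-IC-LCS of $A$ and $B$ including $P$ (an STR-IC-LCS of $A$, $B$ and $P$) if $Z$ is a longest string such that (1) $P$ is a substring of $Z$ and (2) $Z$ is a common subsequence of $A$ and $B$. If no such string exists, the solution is by convention $Z=\bot$ with $|\bot|=-1$. The STR-IC-LCS problem is: given $A,B$ of length $n$ and $P$, compute an STR-IC-LCS of $A$, $B$ and $P$. It is assumed that $r=|P|\le n$ (otherwise there is no solution). Time and working space are measured in the usual word RAM model (word size $\log_2 n$, space counted in words). *)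

theory Defs
  imports Complex_Main "HOL-Library.Sublist"
begin

section \<open>Common subsequences with a substring-inclusion constraint\<close>

definition common_subseq :: "'a list \<Rightarrow> 'a list \<Rightarrow> 'a list \<Rightarrow> bool" where
  "common_subseq A B Z \<longleftrightarrow> subseq Z A \<and> subseq Z B"

definition lcs :: "'a list \<Rightarrow> 'a list \<Rightarrow> nat" where
  "lcs A B = Max (length ` {Z. common_subseq A B Z})"

text \<open>In the library theory of sublists, \<open>sublist P Z\<close> means that \<open>P\<close> is a
  \<^emph>\<open>contiguous\<close> block of \<open>Z\<close>, whereas \<open>subseq\<close> allows gaps.\<close>

definition ic_candidate :: "'a list \<Rightarrow> 'a list \<Rightarrow> 'a list \<Rightarrow> 'a list \<Rightarrow> bool" where
  "ic_candidate A B P Z \<longleftrightarrow> sublist P Z \<and> common_subseq A B Z"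

text \<open>\<open>None\<close> plays the role of the undefined solution \<open>\<bottom>\<close>.\<close>

definition is_STR_IC_LCS :: "'a list \<Rightarrow> 'a list \<Rightarrow> 'a list \<Rightarrow> 'a list option \<Rightarrow> bool" where
  "is_STR_IC_LCS A B P res \<longleftrightarrow>
     (case res of
        Some Z \<Rightarrow> ic_candidate A B P Z \<and>
                  (\<forall>Z'. ic_candidate A B P Z' \<longrightarrow> length Z' \<le> length Z)
      | None \<Rightarrow> \<not> (\<exists>Z. ic_candidate A B P Z))"


section \<open>The word RAM\<close>

text \<open>A machine word of \<open>w\<close> bits is a natural number below \<open>2 ^ w\<close>; the word size is a run-time
  parameter, so that one program serves all word sizes. A program is a fixed instruction list
  working on registers (named statically, hence constantly many per program) and on a memory
  addressed by words. Every instruction takes unit time. The machine halts when the program counter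
  leaves the program.\<close>

datatype binop = Add | Sub | Mul | Div | Mod | And | Or | Xor | Shl | Shr

datatype instr =
    Const nat nat
  | Op binop nat nat nat
  | Load nat nat
  | Store nat nat
  | Jump nat
  | JumpEq nat nat nat
  | JumpLess nat nat nat

record config =
  pc :: nat
  regs :: "nat \<Rightarrow> nat"
  mem :: "nat \<Rightarrow> nat"

fun binop_val :: "nat \<Rightarrow> binop \<Rightarrow> nat \<Rightarrow> nat \<Rightarrow> nat" where
  "binop_val w Add x y = (x + y) mod 2 ^ w"
| "binop_val w Sub x y = (x + 2 ^ w - y) mod 2 ^ w"
| "binop_val w Mul x y = (x * y) mod 2 ^ w"
| "binop_val w Div x y = x div y"
| "binop_val w Mod x y = x mod y"
| "binop_val w And x y = Bit_Operations.and x y"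
| "binop_val w Or x y = Bit_Operations.or x y"
| "binop_val w Xor x y = Bit_Operations.xor x y"
| "binop_val w Shl x y = push_bit y x mod 2 ^ w"
| "binop_val w Shr x y = drop_bit y x"

fun exec :: "nat \<Rightarrow> instr \<Rightarrow> config \<Rightarrow> config" where
  "exec w (Const d k) s = s\<lparr>pc := pc s + 1, regs := (regs s)(d := k mod 2 ^ w)\<rparr>"
| "exec w (Op f d a b) s =
     s\<lparr>pc := pc s + 1, regs := (regs s)(d := binop_val w f (regs s a) (regs s b))\<rparr>"
| "exec w (Load d a) s = s\<lparr>pc := pc s + 1, regs := (regs s)(d := mem s (regs s a))\<rparr>"
| "exec w (Store a b) s = s\<lparr>pc := pc s + 1, mem := (mem s)(regs s a := regs s b)\<rparr>"
| "exec w (Jump l) s = s\<lparr>pc := l\<rparr>"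
| "exec w (JumpEq a b l) s = s\<lparr>pc := (if regs s a = regs s b then l else pc s + 1)\<rparr>"
| "exec w (JumpLess a b l) s = s\<lparr>pc := (if regs s a < regs s b then l else pc s + 1)\<rparr>"

definition halted :: "instr list \<Rightarrow> config \<Rightarrow> bool" where
  "halted prog s \<longleftrightarrow> length prog \<le> pc s"

definition step :: "nat \<Rightarrow> instr list \<Rightarrow> config \<Rightarrow> config" where
  "step w prog s = (if halted prog s then s else exec w (prog ! pc s) s)"

definition run :: "nat \<Rightarrow> instr list \<Rightarrow> nat \<Rightarrow> config \<Rightarrow> config" where
  "run w prog t s = (step w prog ^^ t) s"

definition terminates :: "nat \<Rightarrow> instr list \<Rightarrow> config \<Rightarrow> bool" where
  "terminates w prog s \<longleftrightarrow> (\<exists>t. halted prog (run w prog t s))"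

definition run_time :: "nat \<Rightarrow> instr list \<Rightarrow> config \<Rightarrow> nat" where
  "run_time w prog s = (LEAST t. halted prog (run w prog t s))"

definition final_config :: "nat \<Rightarrow> instr list \<Rightarrow> config \<Rightarrow> config" where
  "final_config w prog s = run w prog (run_time w prog s) s"

definition accessed :: "instr list \<Rightarrow> config \<Rightarrow> nat set" where
  "accessed prog s =
     (if halted prog s then {}
      else case prog ! pc s of
             Load d a \<Rightarrow> {regs s a}
           | Store a b \<Rightarrow> {regs s a}
           | _ \<Rightarrow> {})"

text \<open>Space is the length of the shortest memory prefix containing every cell that is read or
  written, also those holding input or output. It thus bounds the number of distinct cells used; the
  constantly many registers are not counted. Both functions \<open>run_time\<close> and \<open>run_space\<close> are meaningful
  only for terminating runs.\<close>

definition run_space :: "nat \<Rightarrow> instr list \<Rightarrow> config \<Rightarrow> nat" where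
  "run_space w prog s =
     (LEAST m. \<forall>t < run_time w prog s. accessed prog (run w prog t s) \<subseteq> {..<m})"


section \<open>Input and output conventions\<close>

text \<open>Memory initially holds \<open>n\<close>, \<open>r\<close> and the characters of the three strings, one per word, followed
  by zeros.\<close>

definition input_words :: "nat list \<Rightarrow> nat list \<Rightarrow> nat list \<Rightarrow> nat list" where
  "input_words A B P = [length A, length P] @ A @ B @ P"

definition init_config :: "nat list \<Rightarrow> config" where
  "init_config xs =
     \<lparr>pc = 0, regs = (\<lambda>_. 0), mem = (\<lambda>i. if i < length xs then xs ! i else 0)\<rparr>"

text \<open>On halting, cell \<open>0\<close> holds \<open>|Z| + 1\<close> and the next \<open>|Z|\<close> cells hold \<open>Z\<close>. As
  \<open>|\<bottom>| = -1\<close>, the undefined solution is signalled by the value \<open>0\<close>.\<close>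

definition answer :: "config \<Rightarrow> nat list option" where
  "answer s = (if mem s 0 = 0 then None else Some (map (mem s) [1..<mem s 0]))"


section \<open>Resource bounds\<close>

text \<open>For \<open>r < 2\<close>, where \<open>r / log r\<close> is not meaningful, the logarithm is replaced by \<open>1\<close>; this does
  not matter, as the first summand is then dominated by the second one.\<close>

definition time_bound :: "nat \<Rightarrow> nat \<Rightarrow> nat \<Rightarrow> real" where
  "time_bound n r l =
     real n * real r / log 2 (max 2 (real r)) + real n * (real n - real l + 1)"

definition space_bound :: "nat \<Rightarrow> nat \<Rightarrow> real" where
  "space_bound n l = (real l + 1) * (real n - real l + 1)"

end

theory Submission imports Defs begin

text \<open>Let \<open>D = n - lcs A B\<close>. A solution consists of a common subsequence of two prefixes, the pattern
  inside a window of either string, and a common subsequence of the remaining suffixes. A longest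
  common subsequence of \<open>A\<close> and \<open>B\<close> leaves out only \<open>D\<close> characters on either side, so prefixes of
  lengths \<open>i\<close> and \<open>j\<close> have a common subsequence of length at least \<open>min i j - D\<close>. An optimal prefix part
  therefore leaves out at most \<open>D\<close> characters of the shorter of the two prefixes, and likewise for
  suffixes; hence tables over \<open>D + 1\<close> diagonals of length \<open>lcs A B + 1\<close> suffice. Each
  diagonal is filled, and later combined with the windows, by scans with monotone pointers in
  \<open>O(n)\<close> steps.

  The shortest windows ending at each position are found by cutting \<open>P\<close> into blocks of \<open>k\<close>
  characters, \<open>k\<close> proportional to \<open>log r\<close>. The windows of the prefixes of a block are nested, so the
  state of a block fits into one code of \<open>O(k)\<close> bits that a precomputed table updates in constant time
  per character of the text, in total \<open>O(n r / k)\<close>. Indexing the pattern in sorted groups of \<open>k\<^sup>2\<close>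
  characters makes the characters available as small numbers within the same time.

  The algorithm is written in a small structured language, verified there with a weakest-precondition
  calculus that counts steps, and compiled to the word RAM.\<close>

section \<open>A structured language over the word RAM\<close>

text \<open>The tables hold thresholds \<open>FF\<close> instead of LCS lengths. Thresholds grow
  along a diagonal, which pays for all pointer moves, and comparing thresholds of adjacent diagonals
  is enough for tracing back. Their asymmetry is the reason for four tables and two passes: the
  bound \<open>D\<close> on diagonals holds only for the shorter of two prefixes or suffixes, and
  either string may have it.

  Memory cannot be divided among the arrays before \<open>lcs A B\<close> is known. Interleaving all
  arrays with a fixed stride avoids any division: the footprint is a constant times the largest
  index used by any of them.

  The block length \<open>k\<close> is the number of digits of \<open>r\<close> in base 256. Codes
  and masks together take \<open>4 * k\<close> bits, so the transition table has
  \<open>16 ^ k\<close> entries; since 256 is the square of 16, even O(k) steps per entry cost only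
  O(n). The base also keeps \<open>k ^ 3\<close> below \<open>r + 2\<close>, so that sorting in r
  k^2 steps and looking up each character in O(r/k + k) steps stay within the time bound. The
  dictionary exists because characters are arbitrary words, whereas match masks must be addressed by
  small numbers.\<close>

datatype exp = N nat | V nat | Arr nat exp | Bin binop exp exp

datatype bexp = BEq exp exp | BNe exp exp | BLt exp exp | BLe exp exp | BAnd bexp bexp

datatype com =
    SKIP
  | Assign nat exp
  | Write nat exp exp
  | Seq com com
  | Cond bexp com com
  | While bexp com

notation Assign (infix "::=" 62)
notation Seq (infixr ";;" 60)
notation Cond ("(IF _/ THEN _/ ELSE _)" [0, 0, 61] 61)
notation While ("(WHILE _/ DO _)" [0, 61] 61)
abbreviation plus_exp (infixl "\<oplus>" 65) where "plus_exp \<equiv> Bin Add"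
abbreviation minus_exp (infixl "\<ominus>" 65) where "minus_exp \<equiv> Bin Sub"
abbreviation times_exp (infixl "\<otimes>" 70) where "times_exp \<equiv> Bin Mul"

text \<open>The field \<open>clk\<close> is a ghost counter of executed statements and tests.\<close>

record st =
  vv :: "nat \<Rightarrow> nat"
  aa :: "nat \<Rightarrow> nat \<Rightarrow> nat"
  clk :: nat

definition tick :: "st \<Rightarrow> st" where "tick s = s\<lparr>clk := clk s + 1\<rparr>"

lemma tick_simps [simp]: "vv (tick s) = vv s" "aa (tick s) = aa s" "clk (tick s) = clk s + 1"
  by (simp_all add: tick_def)

text \<open>It is both the number of arrays and the stride of their interleaving; the array names in
  use go up to 23.\<close>

definition narr :: nat where "narr = 32"

fun opv :: "binop \<Rightarrow> nat \<Rightarrow> nat \<Rightarrow> nat" where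
  "opv Add x y = x + y"
| "opv Sub x y = x - y"
| "opv Mul x y = x * y"
| "opv Div x y = x div y"
| "opv Mod x y = x mod y"
| "opv _ x y = 0"

fun ev :: "exp \<Rightarrow> st \<Rightarrow> nat" where
  "ev (N n) s = n"
| "ev (V x) s = vv s x"
| "ev (Arr k e) s = aa s k (ev e s)"
| "ev (Bin f a b) s = opv f (ev a s) (ev b s)"

fun bval :: "bexp \<Rightarrow> st \<Rightarrow> bool" where
  "bval (BEq a b) s \<longleftrightarrow> ev a s = ev b s"
| "bval (BNe a b) s \<longleftrightarrow> ev a s \<noteq> ev b s"
| "bval (BLt a b) s \<longleftrightarrow> ev a s < ev b s"
| "bval (BLe a b) s \<longleftrightarrow> ev a s \<le> ev b s"
| "bval (BAnd a b) s \<longleftrightarrow> bval a s \<and> bval b s"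

fun mv :: "com \<Rightarrow> nat set" where
  "mv SKIP = {}"
| "mv (x ::= e) = {x}"
| "mv (Write k i e) = {}"
| "mv (a ;; b) = mv a \<union> mv b"
| "mv (IF b THEN c ELSE d) = mv c \<union> mv d"
| "mv (WHILE b DO c) = mv c"

fun ma :: "com \<Rightarrow> nat set" where
  "ma SKIP = {}"
| "ma (x ::= e) = {}"
| "ma (Write k i e) = {k}"
| "ma (a ;; b) = ma a \<union> ma b"
| "ma (IF b THEN c ELSE d) = ma c \<union> ma d"
| "ma (WHILE b DO c) = ma c"

text \<open>Syntactic frame condition. \<open>wp_conseq\<close> and \<open>wp_While\<close> supply
  it at every step, so that specifications and invariants mention only what changes.\<close>

definition frame :: "com \<Rightarrow> st \<Rightarrow> st \<Rightarrow> bool" where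
  "frame c s t \<longleftrightarrow> (\<forall>x. x \<notin> mv c \<longrightarrow> vv t x = vv s x) \<and> (\<forall>k. k \<notin> ma c \<longrightarrow> aa t k = aa s k)
     \<and> clk s \<le> clk t"

lemma frame_vv: "frame c s t \<Longrightarrow> x \<notin> mv c \<Longrightarrow> vv t x = vv s x"
  and frame_aa: "frame c s t \<Longrightarrow> k \<notin> ma c \<Longrightarrow> aa t k = aa s k"
  and frame_clk: "frame c s t \<Longrightarrow> clk s \<le> clk t"
  by (auto simp: frame_def)

text \<open>Values are unbounded natural numbers; \<open>safe\<close> states that neither an overflow nor a truncated
  subtraction occurs and that array indices stay below the bound \<open>M\<close>. Array \<open>0\<close> is the raw memory
  below address \<open>Z\<close>; the other arrays are interleaved above it.\<close>

locale bounds =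
  fixes W M Z :: nat
begin

definition idx_ok :: "nat \<Rightarrow> nat \<Rightarrow> bool" where
  "idx_ok k i \<longleftrightarrow> k < narr \<and> i < M \<and> (k = 0 \<longrightarrow> i < Z)"

fun opsafe :: "binop \<Rightarrow> nat \<Rightarrow> nat \<Rightarrow> bool" where
  "opsafe Add x y \<longleftrightarrow> x + y < W"
| "opsafe Sub x y \<longleftrightarrow> y \<le> x \<and> x < W"
| "opsafe Mul x y \<longleftrightarrow> x * y < W"
| "opsafe Div x y \<longleftrightarrow> True"
| "opsafe Mod x y \<longleftrightarrow> True"
| "opsafe _ x y \<longleftrightarrow> False"

fun safe :: "exp \<Rightarrow> st \<Rightarrow> bool" where
  "safe (N n) s \<longleftrightarrow> n < W"
| "safe (V x) s \<longleftrightarrow> True"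
| "safe (Arr k e) s \<longleftrightarrow> safe e s \<and> idx_ok k (ev e s)"
| "safe (Bin f a b) s \<longleftrightarrow> safe a s \<and> safe b s \<and> opsafe f (ev a s) (ev b s)"

fun bsafe :: "bexp \<Rightarrow> st \<Rightarrow> bool" where
  "bsafe (BEq a b) s \<longleftrightarrow> safe a s \<and> safe b s"
| "bsafe (BNe a b) s \<longleftrightarrow> safe a s \<and> safe b s"
| "bsafe (BLt a b) s \<longleftrightarrow> safe a s \<and> safe b s"
| "bsafe (BLe a b) s \<longleftrightarrow> safe a s \<and> safe b s"
| "bsafe (BAnd a b) s \<longleftrightarrow> bsafe a s \<and> (bval a s \<longrightarrow> bsafe b s)"

inductive big :: "com \<Rightarrow> st \<Rightarrow> st \<Rightarrow> bool" where
  Skip: "big SKIP s s"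
| Assign: "safe e s \<Longrightarrow> big (x ::= e) s (s\<lparr>vv := (vv s)(x := ev e s), clk := clk s + 1\<rparr>)"
| Write: "safe i s \<Longrightarrow> safe e s \<Longrightarrow> idx_ok k (ev i s) \<Longrightarrow>
    big (Write k i e) s (s\<lparr>aa := (aa s)(k := (aa s k)(ev i s := ev e s)), clk := clk s + 1\<rparr>)"
| Seq: "big c s s' \<Longrightarrow> big d s' s'' \<Longrightarrow> big (c ;; d) s s''"
| IfT: "bsafe b s \<Longrightarrow> bval b s \<Longrightarrow> big c (tick s) s' \<Longrightarrow> big (IF b THEN c ELSE d) s s'"
| IfF: "bsafe b s \<Longrightarrow> \<not> bval b s \<Longrightarrow> big d (tick s) s' \<Longrightarrow> big (IF b THEN c ELSE d) s s'"
| WhileF: "bsafe b s \<Longrightarrow> \<not> bval b s \<Longrightarrow> big (WHILE b DO c) s (tick s)"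
| WhileT: "bsafe b s \<Longrightarrow> bval b s \<Longrightarrow> big c (tick s) s' \<Longrightarrow> big (WHILE b DO c) s' s'' \<Longrightarrow>
    big (WHILE b DO c) s s''"

inductive_cases SkipE: "big SKIP s t"
inductive_cases AssignE: "big (x ::= e) s t"
inductive_cases WriteE: "big (Write k i e) s t"
inductive_cases SeqE: "big (c ;; d) s t"
inductive_cases IfE: "big (IF b THEN c ELSE d) s t"

lemma big_frame: "big c s t \<Longrightarrow> frame c s t"
  by (induction rule: big.induct) (auto simp: frame_def)

text \<open>Existence of a complete run makes this total correctness. It includes freedom from
  overflow, because \<open>big\<close> has no rule for an unsafe step.\<close>

definition wp :: "com \<Rightarrow> (st \<Rightarrow> bool) \<Rightarrow> st \<Rightarrow> bool" where
  "wp c Q s \<longleftrightarrow> (\<exists>t. big c s t \<and> Q t)"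

lemma wp_Skip: "wp SKIP Q s \<longleftrightarrow> Q s"
  by (auto simp: wp_def intro: big.intros elim: SkipE)

lemma wp_Assign: "wp (x ::= e) Q s \<longleftrightarrow>
    safe e s \<and> Q (s\<lparr>vv := (vv s)(x := ev e s), clk := clk s + 1\<rparr>)"
  by (auto simp: wp_def intro: big.intros elim: AssignE)

lemma wp_Write: "wp (Write k i e) Q s \<longleftrightarrow> safe i s \<and> safe e s \<and> idx_ok k (ev i s) \<and>
    Q (s\<lparr>aa := (aa s)(k := (aa s k)(ev i s := ev e s)), clk := clk s + 1\<rparr>)"
  by (auto simp: wp_def intro: big.intros elim: WriteE)

lemma wp_Seq: "wp (c ;; d) Q s \<longleftrightarrow> wp c (wp d Q) s"
  by (auto simp: wp_def intro: big.intros elim!: SeqE)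

lemma wp_If: "wp (IF b THEN c ELSE d) Q s \<longleftrightarrow>
    bsafe b s \<and> (if bval b s then wp c Q (tick s) else wp d Q (tick s))"
  by (auto simp: wp_def intro: big.intros elim!: IfE)

lemmas wp_simps = wp_Skip wp_Assign wp_Write wp_Seq wp_If

lemma wp_conseq:
  assumes "wp c P s" "\<And>t. P t \<Longrightarrow> frame c s t \<Longrightarrow> Q t"
  shows "wp c Q s"
  using assms big_frame unfolding wp_def by blast

lemma wp_SeqI:
  assumes "wp c P s" "\<And>t. P t \<Longrightarrow> frame c s t \<Longrightarrow> wp d Q t"
  shows "wp (c ;; d) Q s"
  unfolding wp_Seq using assms by (rule wp_conseq)

text \<open>Every iteration advances the clock, so an invariant bounding the clock implies termination.\<close>

lemma wp_While:
  assumes init: "I s"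
    and time: "\<And>t. I t \<Longrightarrow> frame c s t \<Longrightarrow> bsafe b t \<and> clk t \<le> T"
    and body: "\<And>t. I t \<Longrightarrow> frame c s t \<Longrightarrow> bval b t \<Longrightarrow> wp c I (tick t)"
    and exit: "\<And>t. I t \<Longrightarrow> frame c s t \<Longrightarrow> \<not> bval b t \<Longrightarrow> Q (tick t)"
  shows "wp (WHILE b DO c) Q s"
proof -
  have "\<exists>u. big (WHILE b DO c) t u \<and> Q u" if "I t" "frame c s t" for t
    using that
  proof (induction "T - clk t" arbitrary: t rule: less_induct)
    case less
    show ?case
    proof (cases "bval b t")
      case False
      then show ?thesis
        using less time exit by (blast intro: big.intros)
    next
      case True
      obtain u where u: "big c (tick t) u" "I u"
        using body[OF less.prems True] by (auto simp: wp_def)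
      have fr: "frame c (tick t) u" by (rule big_frame[OF u(1)])
      then have fr': "frame c s u"
        using less.prems(2) by (auto simp: frame_def)
      have "T - clk u < T - clk t"
        using fr time[OF u(2) fr'] time[OF less.prems] by (auto simp: frame_def)
      from less.hyps[OF this u(2) fr'] show ?thesis
        using u(1) True time[OF less.prems] by (blast intro: big.intros)
    qed
  qed
  from this[OF init] show ?thesis
    by (simp add: wp_def frame_def)
qed

end

section \<open>Compilation\<close>

text \<open>Register 0 is kept for the base address \<open>Z\<close>. Variables get the positive
  even registers and temporaries the odd ones, so neither class has to be bounded.\<close>

definition vreg :: "nat \<Rightarrow> nat" where "vreg x = 2 * x + 2"
definition treg :: "nat \<Rightarrow> nat" where "treg t = 2 * t + 1"

lemma reg_neq [simp]: "vreg x \<noteq> 0" "treg t \<noteq> 0" "vreg x \<noteq> treg t" "treg t \<noteq> vreg x"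
    "vreg x = vreg y \<longleftrightarrow> x = y" "treg t = treg u \<longleftrightarrow> t = u"
    "0 \<noteq> vreg x" "0 \<noteq> treg t"
  unfolding vreg_def treg_def by presburger+

fun caddr :: "nat \<Rightarrow> nat \<Rightarrow> instr list" where
  "caddr k t = (if k = 0 then [] else
    [Const (treg (t + 1)) narr, Op Mul (treg t) (treg t) (treg (t + 1)), Op Add (treg t) (treg t) 0,
     Const (treg (t + 1)) k, Op Add (treg t) (treg t) (treg (t + 1))])"

text \<open>Temporaries form a stack: code at depth \<open>t\<close> leaves its value in
  \<open>treg t\<close> and changes no temporary below. As the machine has no move instruction,
  \<open>And\<close> of a register with itself copies it.\<close>

fun cexp :: "nat \<Rightarrow> exp \<Rightarrow> instr list" where
  "cexp t (N n) = [Const (treg t) n]"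
| "cexp t (V x) = [Op And (treg t) (vreg x) (vreg x)]"
| "cexp t (Arr k e) = cexp t e @ caddr k t @ [Load (treg t) (treg t)]"
| "cexp t (Bin f a b) = cexp t a @ cexp (t + 1) b @ [Op f (treg t) (treg t) (treg (t + 1))]"

text \<open>The code falls through if the test holds and jumps to \<open>f\<close> otherwise.
  Conjunction is thereby evaluated lazily, as \<open>bsafe\<close> presupposes for array accesses
  guarded by an index test.\<close>

fun cbexp :: "nat \<Rightarrow> bexp \<Rightarrow> nat \<Rightarrow> instr list" where
  "cbexp p (BEq a b) f = (let c = cexp 0 a @ cexp 1 b in
     c @ [JumpEq (treg 0) (treg 1) (p + length c + 2), Jump f])"
| "cbexp p (BNe a b) f = cexp 0 a @ cexp 1 b @ [JumpEq (treg 0) (treg 1) f]"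
| "cbexp p (BLt a b) f = (let c = cexp 0 a @ cexp 1 b in
     c @ [JumpLess (treg 0) (treg 1) (p + length c + 2), Jump f])"
| "cbexp p (BLe a b) f = cexp 0 a @ cexp 1 b @ [JumpLess (treg 1) (treg 0) f]"
| "cbexp p (BAnd a b) f = (let c = cbexp p a f in c @ cbexp (p + length c) b f)"

text \<open>Lengths are defined apart from the code because the targets of forward jumps depend on
  them.\<close>

fun blen :: "bexp \<Rightarrow> nat" where
  "blen (BEq a b) = length (cexp 0 a) + length (cexp 1 b) + 2"
| "blen (BNe a b) = length (cexp 0 a) + length (cexp 1 b) + 1"
| "blen (BLt a b) = length (cexp 0 a) + length (cexp 1 b) + 2"
| "blen (BLe a b) = length (cexp 0 a) + length (cexp 1 b) + 1"
| "blen (BAnd a b) = blen a + blen b"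

lemma length_cbexp [simp]: "length (cbexp p b f) = blen b"
  by (induction b arbitrary: p) (auto simp: Let_def)

fun clen :: "com \<Rightarrow> nat" where
  "clen SKIP = 0"
| "clen (x ::= e) = length (cexp 0 e) + 1"
| "clen (Write k i e) = length (cexp 0 i) + length (caddr k 0) + length (cexp 1 e) + 1"
| "clen (c ;; d) = clen c + clen d"
| "clen (IF b THEN c ELSE d) = blen b + clen c + clen d + 1"
| "clen (WHILE b DO c) = blen b + clen c + 1"

fun ccom :: "nat \<Rightarrow> com \<Rightarrow> instr list" where
  "ccom p SKIP = []"
| "ccom p (x ::= e) = cexp 0 e @ [Op And (vreg x) (treg 0) (treg 0)]"
| "ccom p (Write k i e) = cexp 0 i @ caddr k 0 @ cexp 1 e @ [Store (treg 0) (treg 1)]"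
| "ccom p (c ;; d) = ccom p c @ ccom (p + clen c) d"
| "ccom p (IF b THEN c ELSE d) = (let q = p + blen b + clen c + 1 in
     cbexp p b q @ ccom (p + blen b) c @ [Jump (q + clen d)] @ ccom q d)"
| "ccom p (WHILE b DO c) =
     cbexp p b (p + blen b + clen c + 1) @ ccom (p + blen b) c @ [Jump p]"

lemma length_ccom [simp]: "length (ccom p c) = clen c"
  by (induction c arbitrary: p) (auto simp: Let_def)

definition code_at :: "instr list \<Rightarrow> nat \<Rightarrow> instr list \<Rightarrow> bool" where
  "code_at prog p c \<longleftrightarrow> p + length c \<le> length prog \<and> (\<forall>i < length c. prog ! (p + i) = c ! i)"

lemma code_at_append:
  "code_at prog p (c @ d) \<longleftrightarrow> code_at prog p c \<and> code_at prog (p + length c) d"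
proof
  assume *: "code_at prog p (c @ d)"
  have "prog ! (p + length c + i) = d ! i" if "i < length d" for i
    using * that unfolding code_at_def
    by (metis add.assoc length_append nat_add_left_cancel_less nth_append_length_plus)
  moreover have "prog ! (p + i) = c ! i" if "i < length c" for i
    using * that unfolding code_at_def
    by (metis length_append nth_append trans_less_add1)
  ultimately show "code_at prog p c \<and> code_at prog (p + length c) d"
    using * by (auto simp: code_at_def)
next
  assume *: "code_at prog p c \<and> code_at prog (p + length c) d"
  show "code_at prog p (c @ d)"
    unfolding code_at_def
  proof (intro conjI allI impI)
    fix i assume i: "i < length (c @ d)"
    show "prog ! (p + i) = (c @ d) ! i"
    proof (cases "i < length c")
      case True
      then show ?thesis using * by (simp add: code_at_def nth_append)
    next
      case False
      then have "i - length c < length d" using i by auto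
      then have "prog ! (p + length c + (i - length c)) = d ! (i - length c)"
        using * unfolding code_at_def by blast
      then show ?thesis using False by (simp add: nth_append)
    qed
  qed (use * in \<open>auto simp: code_at_def\<close>)
qed

lemma code_at_Nil [simp]: "p \<le> length prog \<Longrightarrow> code_at prog p []"
  by (simp add: code_at_def)

lemma code_at_Cons: "code_at prog p (x # c) \<longleftrightarrow> p < length prog \<and> prog ! p = x \<and> code_at prog (Suc p) c"
proof -
  have "code_at prog p [x] \<longleftrightarrow> p < length prog \<and> prog ! p = x"
    by (auto simp: code_at_def)
  then show ?thesis using code_at_append[of prog p "[x]" c] by simp
qed

section \<open>Simulation of the structured language by the machine\<close>

locale ram = bounds W M Z for W M Z :: nat +
  fixes w :: nat and prog :: "instr list"
  assumes W_def: "W = 2 ^ w" and big_enough: "Z + narr * M < W" and M_pos: "0 < M"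
begin

definition limit :: nat where "limit = Z + narr * M"

text \<open>Excluding earlier halting and far memory accesses along the whole run lets one
  simulation yield both the exact \<open>run_time\<close> and the bound on
  \<open>run_space\<close>.\<close>

definition reach :: "nat \<Rightarrow> config \<Rightarrow> config \<Rightarrow> bool" where
  "reach t \<sigma> \<sigma>' \<longleftrightarrow> run w prog t \<sigma> = \<sigma>' \<and>
     (\<forall>u < t. \<not> halted prog (run w prog u \<sigma>) \<and> accessed prog (run w prog u \<sigma>) \<subseteq> {..<limit})"

lemma run_add: "run w prog (t + u) \<sigma> = run w prog u (run w prog t \<sigma>)"
  by (metis add.commute comp_apply funpow_add run_def)

lemma reach_0 [simp]: "reach 0 \<sigma> \<sigma>"
  by (simp add: reach_def run_def)

lemma reach_trans:
  assumes "reach t \<sigma> \<sigma>'" "reach u \<sigma>' \<sigma>''"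
  shows "reach (t + u) \<sigma> \<sigma>''"
proof -
  have "\<not> halted prog (run w prog v \<sigma>) \<and> accessed prog (run w prog v \<sigma>) \<subseteq> {..<limit}"
    if "v < t + u" for v
  proof (cases "v < t")
    case True
    then show ?thesis using assms(1) by (simp add: reach_def)
  next
    case False
    then have "run w prog v \<sigma> = run w prog (v - t) \<sigma>'"
      using assms(1) run_add[of t "v - t" \<sigma>] by (simp add: reach_def)
    moreover have "v - t < u" using False that by simp
    ultimately show ?thesis using assms(2) by (simp add: reach_def)
  qed
  then show ?thesis using assms by (auto simp: reach_def run_add)
qed

lemma reach_step:
  assumes "pc \<sigma> < length prog" "accessed prog \<sigma> \<subseteq> {..<limit}"
  shows "reach 1 \<sigma> (exec w (prog ! pc \<sigma>) \<sigma>)"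
  using assms by (simp add: reach_def run_def step_def halted_def)

lemma reach_instr:
  assumes "code_at prog (pc \<sigma>) (x # c)"
    and "\<And>d a. x = Load d a \<Longrightarrow> regs \<sigma> a < limit" "\<And>a b. x = Store a b \<Longrightarrow> regs \<sigma> a < limit"
  shows "reach 1 \<sigma> (exec w x \<sigma>)"
proof -
  have "pc \<sigma> < length prog" "prog ! pc \<sigma> = x"
    using assms(1) by (auto simp: code_at_Cons)
  then show ?thesis
    using reach_step[of \<sigma>] assms(2,3) by (cases x) (auto simp: accessed_def halted_def)
qed

definition addr :: "nat \<Rightarrow> nat \<Rightarrow> nat" where
  "addr k i = (if k = 0 then i else Z + narr * i + k)"

lemma addr_limit:
  assumes "idx_ok k i" shows "addr k i < limit"
proof -
  have "narr * i + k < narr * M"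
    using assms mult_le_mono2[of "Suc i" M narr] by (simp add: idx_ok_def)
  then show ?thesis
    using assms by (auto simp: idx_ok_def addr_def limit_def)
qed

text \<open>Array 0 stays below \<open>Z\<close> and all other arrays lie above it; there the
  distance from \<open>Z\<close> modulo \<open>narr\<close> reveals the array.\<close>

lemma addr_inj:
  assumes "k < narr" "k' < narr" "k = 0 \<longrightarrow> i < Z" "k' = 0 \<longrightarrow> i' < Z"
  shows "addr k i = addr k' i' \<longleftrightarrow> k = k' \<and> i = i'"
proof
  assume eq: "addr k i = addr k' i'"
  show "k = k' \<and> i = i'"
  proof (cases "k = 0 \<or> k' = 0")
    case True
    then show ?thesis using eq assms by (auto simp: addr_def split: if_splits)
  next
    case False
    then have *: "narr * i + k = narr * i' + k'" using eq by (simp add: addr_def)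
    have "k = (narr * i + k) mod narr" "k' = (narr * i' + k') mod narr"
      using assms by auto
    then have "k = k'" using * by metis
    moreover then have "i = i'" using * by (simp add: narr_def)
    ultimately show ?thesis by simp
  qed
qed auto

definition rel :: "st \<Rightarrow> config \<Rightarrow> bool" where
  "rel s \<sigma> \<longleftrightarrow> regs \<sigma> 0 = Z \<and> (\<forall>x. regs \<sigma> (vreg x) = vv s x) \<and>
     (\<forall>k i. k < narr \<longrightarrow> (k = 0 \<longrightarrow> i < Z) \<longrightarrow> mem \<sigma> (addr k i) = aa s k i)"

lemma rel_tick [simp]: "rel (tick s) \<sigma> = rel s \<sigma>"
  by (simp add: rel_def)

lemma rel_temps:
  assumes "rel s \<sigma>" "\<And>x. (\<forall>t. x \<noteq> treg t) \<Longrightarrow> regs \<sigma>' x = regs \<sigma> x" "mem \<sigma>' = mem \<sigma>"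
  shows "rel s \<sigma>'"
  using assms by (auto simp: rel_def)

lemma narr_W: "narr < W" "0 < W"
proof -
  have "narr * 1 \<le> narr * M" using M_pos by simp
  then show "narr < W" "0 < W" using big_enough by linarith+
qed

lemma idx_W:
  assumes "idx_ok k i"
  shows "i * narr < W" "i * narr + Z < W" "Z + narr * i + k < W"
proof -
  have "narr * i + k < narr * M"
    using assms mult_le_mono2[of "Suc i" M narr] by (simp add: idx_ok_def)
  then show "i * narr < W" "i * narr + Z < W" "Z + narr * i + k < W"
    using big_enough by (auto simp: mult.commute)
qed

text \<open>The accounting of a test: its single clock tick buys \<open>L\<close> machine steps,
  enough for evaluating it and for the jump that closes the branch or loop body.\<close>

lemma mult_diff_Suc: "a + 1 \<le> b \<Longrightarrow> L + L * (b - Suc a) = L * (b - a)" for L :: nat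
  using mult_Suc_right[of L "b - Suc a"] Suc_diff_Suc[of a b] by simp

lemma sub_mod:
  fixes x y m :: nat
  assumes "y \<le> x" "x < m" shows "(x + m - y) mod m = x - y"
proof -
  have "(x - y + m) mod m = x - y" unfolding mod_add_self2 using assms by simp
  moreover have "x + m - y = x - y + m" using assms by simp
  ultimately show ?thesis by metis
qed

lemma caddr_correct:
  assumes "code_at prog (pc \<sigma>) (caddr k t)" "idx_ok k (regs \<sigma> (treg t))" "regs \<sigma> 0 = Z"
  shows "\<exists>\<sigma>'. reach (length (caddr k t)) \<sigma> \<sigma>' \<and> pc \<sigma>' = pc \<sigma> + length (caddr k t) \<and>
     mem \<sigma>' = mem \<sigma> \<and> regs \<sigma>' (treg t) = addr k (regs \<sigma> (treg t)) \<and>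
     (\<forall>x. (\<forall>u \<ge> t. x \<noteq> treg u) \<longrightarrow> regs \<sigma>' x = regs \<sigma> x)"
proof (cases "k = 0")
  case True
  then show ?thesis by (auto simp: addr_def intro!: exI[of _ \<sigma>])
next
  case False
  let ?i1 = "Const (treg (t + 1)) narr" and ?i2 = "Op Mul (treg t) (treg t) (treg (t + 1))"
  let ?i3 = "Op Add (treg t) (treg t) 0" and ?i4 = "Const (treg (t + 1)) k"
  let ?i5 = "Op Add (treg t) (treg t) (treg (t + 1))"
  define s1 where "s1 = exec w ?i1 \<sigma>"
  define s2 where "s2 = exec w ?i2 s1"
  define s3 where "s3 = exec w ?i3 s2"
  define s4 where "s4 = exec w ?i4 s3"
  define s5 where "s5 = exec w ?i5 s4"
  note code = assms(1)[simplified caddr.simps if_not_P[OF False] code_at_Cons]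
  have kn: "k < narr" using assms(2) by (simp add: idx_ok_def)
  have p: "pc s1 = pc \<sigma> + 1" "pc s2 = pc \<sigma> + 2" "pc s3 = pc \<sigma> + 3" "pc s4 = pc \<sigma> + 4"
    "pc s5 = pc \<sigma> + 5"
    by (simp_all add: s1_def s2_def s3_def s4_def s5_def)
  have "reach 1 \<sigma> s1" unfolding s1_def by (rule reach_instr[where c = "[]"]) (use code in \<open>auto simp: code_at_Cons\<close>)
  moreover have "reach 1 s1 s2" unfolding s2_def by (rule reach_instr[where c = "[]"]) (use code p in \<open>auto simp: code_at_Cons\<close>)
  moreover have "reach 1 s2 s3" unfolding s3_def by (rule reach_instr[where c = "[]"]) (use code p in \<open>auto simp: code_at_Cons numeral_eq_Suc\<close>)
  moreover have "reach 1 s3 s4" unfolding s4_def by (rule reach_instr[where c = "[]"]) (use code p in \<open>auto simp: code_at_Cons numeral_eq_Suc\<close>)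
  moreover have "reach 1 s4 s5" unfolding s5_def by (rule reach_instr[where c = "[]"]) (use code p in \<open>auto simp: code_at_Cons numeral_eq_Suc\<close>)
  ultimately have "reach (1 + (1 + (1 + (1 + 1)))) \<sigma> s5"
    by (intro reach_trans)
  moreover have "regs s5 (treg t) = addr k (regs \<sigma> (treg t))"
    using idx_W[OF assms(2)] narr_W kn False assms(3)
    by (simp add: s1_def s2_def s3_def s4_def s5_def addr_def W_def[symmetric] algebra_simps)
  moreover have "regs s5 x = regs \<sigma> x" if "\<forall>u \<ge> t. x \<noteq> treg u" for x
    using that by (simp add: s1_def s2_def s3_def s4_def s5_def)
  moreover have "mem s5 = mem \<sigma>"
    by (simp add: s1_def s2_def s3_def s4_def s5_def)
  ultimately show ?thesis using False p by (intro exI[of _ s5]) simp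
qed

lemma cexp_correct:
  assumes "code_at prog (pc \<sigma>) (cexp t e)" "safe e s" "rel s \<sigma>"
  shows "\<exists>\<sigma>'. reach (length (cexp t e)) \<sigma> \<sigma>' \<and> pc \<sigma>' = pc \<sigma> + length (cexp t e) \<and>
     mem \<sigma>' = mem \<sigma> \<and> regs \<sigma>' (treg t) = ev e s \<and>
     (\<forall>x. (\<forall>u \<ge> t. x \<noteq> treg u) \<longrightarrow> regs \<sigma>' x = regs \<sigma> x)"
  using assms
proof (induction e arbitrary: t \<sigma>)
  case (N n)
  then have "n < 2 ^ w" by (simp add: W_def[symmetric])
  with N show ?case
    using reach_instr[of \<sigma> "Const (treg t) n" "[]"]
    by (intro exI[of _ "exec w (Const (treg t) n) \<sigma>"]) auto
next
  case (V x)
  let ?i = "Op And (treg t) (vreg x) (vreg x)"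
  show ?case
    using reach_instr[of \<sigma> ?i "[]"] V
    by (intro exI[of _ "exec w ?i \<sigma>"]) (auto simp: rel_def)
next
  case (Arr k e)
  from Arr.prems have c: "code_at prog (pc \<sigma>) (cexp t e)"
    "code_at prog (pc \<sigma> + length (cexp t e)) (caddr k t)"
    "code_at prog (pc \<sigma> + length (cexp t e) + length (caddr k t)) [Load (treg t) (treg t)]"
    by (simp_all only: cexp.simps code_at_append length_append add.assoc)
  from Arr.prems have s: "safe e s" "idx_ok k (ev e s)" by auto
  obtain s1 where s1: "reach (length (cexp t e)) \<sigma> s1" "pc s1 = pc \<sigma> + length (cexp t e)"
    "mem s1 = mem \<sigma>" "regs s1 (treg t) = ev e s"
    "\<And>x. (\<forall>u \<ge> t. x \<noteq> treg u) \<Longrightarrow> regs s1 x = regs \<sigma> x"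
    using Arr.IH[OF c(1) s(1) Arr.prems(3)] by blast
  have z: "regs s1 0 = Z" using Arr.prems(3) s1(5)[of 0] by (simp add: rel_def)
  obtain s2 where s2: "reach (length (caddr k t)) s1 s2" "pc s2 = pc s1 + length (caddr k t)"
    "mem s2 = mem s1" "regs s2 (treg t) = addr k (ev e s)"
    "\<And>x. (\<forall>u \<ge> t. x \<noteq> treg u) \<Longrightarrow> regs s2 x = regs s1 x"
    using caddr_correct[of s1 k t] c(2) s s1 z by auto
  let ?i = "Load (treg t) (treg t)"
  have 3: "reach 1 s2 (exec w ?i s2)"
    by (rule reach_instr[where c = "[]"]) (use c(3) s1 s2 addr_limit[OF s(2)] in auto)
  have "reach (length (cexp t e) + (length (caddr k t) + 1)) \<sigma> (exec w ?i s2)"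
    by (intro reach_trans[OF s1(1)] reach_trans[OF s2(1)] 3)
  moreover have "mem s2 (addr k (ev e s)) = aa s k (ev e s)"
    using Arr.prems(3) s(2) s1 s2 by (simp add: rel_def idx_ok_def)
  ultimately show ?case
    using s1 s2 by (intro exI[of _ "exec w ?i s2"]) (auto simp del: caddr.simps)
next
  case (Bin f a b)
  from Bin.prems have c: "code_at prog (pc \<sigma>) (cexp t a)"
    "code_at prog (pc \<sigma> + length (cexp t a)) (cexp (t + 1) b)"
    "code_at prog (pc \<sigma> + length (cexp t a) + length (cexp (t + 1) b))
       [Op f (treg t) (treg t) (treg (t + 1))]"
    by (simp_all only: cexp.simps code_at_append length_append add.assoc)
  from Bin.prems have s: "safe a s" "safe b s" "opsafe f (ev a s) (ev b s)" by auto
  obtain s1 where s1: "reach (length (cexp t a)) \<sigma> s1" "pc s1 = pc \<sigma> + length (cexp t a)"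
    "mem s1 = mem \<sigma>" "regs s1 (treg t) = ev a s"
    "\<And>x. (\<forall>u \<ge> t. x \<noteq> treg u) \<Longrightarrow> regs s1 x = regs \<sigma> x"
    using Bin.IH(1)[OF c(1) s(1) Bin.prems(3)] by blast
  have r1: "rel s s1"
    by (rule rel_temps[OF Bin.prems(3)]) (use s1 in auto)
  obtain s2 where s2: "reach (length (cexp (t + 1) b)) s1 s2" "pc s2 = pc s1 + length (cexp (t + 1) b)"
    "mem s2 = mem s1" "regs s2 (treg (t + 1)) = ev b s"
    "\<And>x. (\<forall>u \<ge> t + 1. x \<noteq> treg u) \<Longrightarrow> regs s2 x = regs s1 x"
    using Bin.IH(2)[of s1 "t + 1"] c(2) s(2) r1 s1 by auto
  let ?i = "Op f (treg t) (treg t) (treg (t + 1))"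
  have 3: "reach 1 s2 (exec w ?i s2)"
    by (rule reach_instr[where c = "[]"]) (use c(3) s1 s2 in auto)
  have "reach (length (cexp t a) + (length (cexp (t + 1) b) + 1)) \<sigma> (exec w ?i s2)"
    by (intro reach_trans[OF s1(1)] reach_trans[OF s2(1)] 3)
  \<comment> \<open>The second operand is evaluated one level higher on the stack of temporaries and
    so preserves the first value.\<close>
  moreover have "regs s2 (treg t) = ev a s"
    using s2(5)[of "treg t"] s1 by simp
  moreover have "binop_val w f (ev a s) (ev b s) = opv f (ev a s) (ev b s)"
  proof (cases "f = Sub")
    case True
    show ?thesis using s(3) True sub_mod by (simp add: W_def[symmetric])
  qed (use s(3) in \<open>cases f; simp add: W_def[symmetric]\<close>)
  ultimately show ?case
    using s1 s2 by (intro exI[of _ "exec w ?i s2"]) auto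
qed

lemma cexp2_correct:
  assumes "code_at prog (pc \<sigma>) (cexp 0 a @ cexp 1 b)" "safe a s" "safe b s" "rel s \<sigma>"
  shows "\<exists>\<sigma>'. reach (length (cexp 0 a @ cexp 1 b)) \<sigma> \<sigma>' \<and>
     pc \<sigma>' = pc \<sigma> + length (cexp 0 a @ cexp 1 b) \<and>
     rel s \<sigma>' \<and> regs \<sigma>' (treg 0) = ev a s \<and> regs \<sigma>' (treg 1) = ev b s"
proof -
  from assms have c: "code_at prog (pc \<sigma>) (cexp 0 a)"
    "code_at prog (pc \<sigma> + length (cexp 0 a)) (cexp 1 b)"
    by (simp_all add: code_at_append)
  obtain s1 where s1: "reach (length (cexp 0 a)) \<sigma> s1" "pc s1 = pc \<sigma> + length (cexp 0 a)"
    "mem s1 = mem \<sigma>" "regs s1 (treg 0) = ev a s"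
    "\<And>x. (\<forall>u \<ge> 0. x \<noteq> treg u) \<Longrightarrow> regs s1 x = regs \<sigma> x"
    using cexp_correct[OF c(1) assms(2,4)] by blast
  have r1: "rel s s1"
    by (rule rel_temps[OF assms(4)]) (use s1 in auto)
  obtain s2 where s2: "reach (length (cexp 1 b)) s1 s2" "pc s2 = pc s1 + length (cexp 1 b)"
    "mem s2 = mem s1" "regs s2 (treg 1) = ev b s"
    "\<And>x. (\<forall>u \<ge> 1. x \<noteq> treg u) \<Longrightarrow> regs s2 x = regs s1 x"
    using cexp_correct[of s1 1 b s] c(2) assms(3) r1 s1(2) by auto
  have r2: "rel s s2"
    by (rule rel_temps[OF r1]) (use s2 in auto)
  show ?thesis
    using reach_trans[OF s1(1) s2(1)] s1 s2 r2 by (intro exI[of _ s2]) auto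
qed

lemma cbexp_correct:
  assumes "code_at prog (pc \<sigma>) (cbexp (pc \<sigma>) b f)" "bsafe b s" "rel s \<sigma>"
  shows "\<exists>t \<sigma>'. reach t \<sigma> \<sigma>' \<and> t \<le> blen b \<and> rel s \<sigma>' \<and>
    pc \<sigma>' = (if bval b s then pc \<sigma> + blen b else f)"
  using assms
proof (induction b arbitrary: \<sigma>)
  case (BEq a b)
  let ?c = "cexp 0 a @ cexp 1 b"
  let ?i = "JumpEq (treg 0) (treg 1) (pc \<sigma> + length ?c + 2)"
  have c: "code_at prog (pc \<sigma>) ?c" "code_at prog (pc \<sigma> + length ?c) [?i, Jump f]"
    using BEq.prems(1) unfolding cbexp.simps Let_def code_at_append[of _ _ "?c"] by auto
  obtain s1 where s1: "reach (length ?c) \<sigma> s1" "pc s1 = pc \<sigma> + length ?c" "rel s s1"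
    "regs s1 (treg 0) = ev a s" "regs s1 (treg 1) = ev b s"
    using cexp2_correct[OF c(1)] BEq.prems by auto
  have 2: "reach 1 s1 (exec w ?i s1)"
    by (rule reach_instr) (use c s1 in auto)
  show ?case
  proof (cases "ev a s = ev b s")
    case True
    then show ?thesis
      using reach_trans[OF s1(1) 2] s1
      by (intro exI[of _ "length ?c + 1"] exI[of _ "exec w ?i s1"]) (auto simp: rel_def)
  next
    case False
    let ?s2 = "exec w ?i s1"
    have 3: "reach 1 ?s2 (exec w (Jump f) ?s2)"
      by (rule reach_instr[where c = "[]"]) (use c s1 False in \<open>auto simp: code_at_Cons\<close>)
    show ?thesis
      using reach_trans[OF s1(1) reach_trans[OF 2 3]] s1 False
      by (intro exI[of _ "length ?c + (1 + 1)"] exI[of _ "exec w (Jump f) ?s2"]) (auto simp: rel_def)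
  qed
next
  case (BLt a b)
  let ?c = "cexp 0 a @ cexp 1 b"
  let ?i = "JumpLess (treg 0) (treg 1) (pc \<sigma> + length ?c + 2)"
  have c: "code_at prog (pc \<sigma>) ?c" "code_at prog (pc \<sigma> + length ?c) [?i, Jump f]"
    using BLt.prems(1) unfolding cbexp.simps Let_def code_at_append[of _ _ "?c"] by auto
  obtain s1 where s1: "reach (length ?c) \<sigma> s1" "pc s1 = pc \<sigma> + length ?c" "rel s s1"
    "regs s1 (treg 0) = ev a s" "regs s1 (treg 1) = ev b s"
    using cexp2_correct[OF c(1)] BLt.prems by auto
  have 2: "reach 1 s1 (exec w ?i s1)"
    by (rule reach_instr) (use c s1 in auto)
  show ?case
  proof (cases "ev a s < ev b s")
    case True
    then show ?thesis
      using reach_trans[OF s1(1) 2] s1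
      by (intro exI[of _ "length ?c + 1"] exI[of _ "exec w ?i s1"]) (auto simp: rel_def)
  next
    case False
    let ?s2 = "exec w ?i s1"
    have 3: "reach 1 ?s2 (exec w (Jump f) ?s2)"
      by (rule reach_instr[where c = "[]"]) (use c s1 False in \<open>auto simp: code_at_Cons\<close>)
    show ?thesis
      using reach_trans[OF s1(1) reach_trans[OF 2 3]] s1 False
      by (intro exI[of _ "length ?c + (1 + 1)"] exI[of _ "exec w (Jump f) ?s2"]) (auto simp: rel_def)
  qed
next
  case (BNe a b)
  let ?c = "cexp 0 a @ cexp 1 b"
  let ?i = "JumpEq (treg 0) (treg 1) f"
  have c: "code_at prog (pc \<sigma>) ?c" "code_at prog (pc \<sigma> + length ?c) [?i]"
    using BNe.prems(1) unfolding cbexp.simps append_assoc[symmetric] code_at_append[of _ _ "?c"] by auto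
  obtain s1 where s1: "reach (length ?c) \<sigma> s1" "pc s1 = pc \<sigma> + length ?c" "rel s s1"
    "regs s1 (treg 0) = ev a s" "regs s1 (treg 1) = ev b s"
    using cexp2_correct[OF c(1)] BNe.prems by auto
  have 2: "reach 1 s1 (exec w ?i s1)"
    by (rule reach_instr) (use c s1 in auto)
  show ?case
    using reach_trans[OF s1(1) 2] s1
    by (intro exI[of _ "length ?c + 1"] exI[of _ "exec w ?i s1"]) (auto simp: rel_def)
next
  case (BLe a b)
  let ?c = "cexp 0 a @ cexp 1 b"
  let ?i = "JumpLess (treg 1) (treg 0) f"
  have c: "code_at prog (pc \<sigma>) ?c" "code_at prog (pc \<sigma> + length ?c) [?i]"
    using BLe.prems(1) unfolding cbexp.simps append_assoc[symmetric] code_at_append[of _ _ "?c"] by auto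
  obtain s1 where s1: "reach (length ?c) \<sigma> s1" "pc s1 = pc \<sigma> + length ?c" "rel s s1"
    "regs s1 (treg 0) = ev a s" "regs s1 (treg 1) = ev b s"
    using cexp2_correct[OF c(1)] BLe.prems by auto
  have 2: "reach 1 s1 (exec w ?i s1)"
    by (rule reach_instr) (use c s1 in auto)
  show ?case
    using reach_trans[OF s1(1) 2] s1
    by (intro exI[of _ "length ?c + 1"] exI[of _ "exec w ?i s1"]) (auto simp: rel_def)
next
  case (BAnd a b)
  let ?c = "cbexp (pc \<sigma>) a f"
  have c: "code_at prog (pc \<sigma>) ?c" "code_at prog (pc \<sigma> + blen a) (cbexp (pc \<sigma> + blen a) b f)"
    using BAnd.prems(1) unfolding cbexp.simps Let_def code_at_append[of _ _ "?c"] by auto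
  obtain t s1 where s1: "reach t \<sigma> s1" "t \<le> blen a" "rel s s1"
    "pc s1 = (if bval a s then pc \<sigma> + blen a else f)"
    using BAnd.IH(1)[OF c(1)] BAnd.prems by auto
  show ?case
  proof (cases "bval a s")
    case False
    then show ?thesis using s1 by (intro exI[of _ t] exI[of _ s1]) auto
  next
    case True
    then obtain u s2 where s2: "reach u s1 s2" "u \<le> blen b" "rel s s2"
      "pc s2 = (if bval b s then pc s1 + blen b else f)"
      using BAnd.IH(2)[of s1] c(2) BAnd.prems s1 by auto
    then show ?thesis
      using reach_trans[OF s1(1) s2(1)] True s1
      by (intro exI[of _ "t + u"] exI[of _ s2]) auto
  qed
qed

text \<open>Each clock tick is charged with at most \<open>L\<close> instructions, since the code of
  one assignment, or of one test with its closing jump, is no longer than the whole command. Any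
  bound on the code length thus converts clock bounds into machine time.\<close>

lemma ccom_correct:
  assumes "big c s s'" "code_at prog p (ccom p c)" "rel s \<sigma>" "pc \<sigma> = p" "clen c \<le> L"
  shows "\<exists>t \<sigma>'. reach t \<sigma> \<sigma>' \<and> t \<le> L * (clk s' - clk s) \<and> rel s' \<sigma>' \<and> pc \<sigma>' = p + clen c"
  using assms
proof (induction arbitrary: p \<sigma> rule: big.induct)
  case (Skip s)
  then show ?case by (intro exI[of _ 0] exI[of _ \<sigma>]) auto
next
  case (Assign e s x)
  let ?i = "Op And (vreg x) (treg 0) (treg 0)"
  have c: "code_at prog (pc \<sigma>) (cexp 0 e)" "code_at prog (pc \<sigma> + length (cexp 0 e)) [?i]"
    using Assign.prems by (auto simp: code_at_append)
  obtain s1 where s1: "reach (length (cexp 0 e)) \<sigma> s1" "pc s1 = pc \<sigma> + length (cexp 0 e)"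
    "mem s1 = mem \<sigma>" "regs s1 (treg 0) = ev e s"
    "\<And>x. (\<forall>u \<ge> 0. x \<noteq> treg u) \<Longrightarrow> regs s1 x = regs \<sigma> x"
    using cexp_correct[OF c(1) Assign.hyps Assign.prems(2)] by blast
  have 2: "reach 1 s1 (exec w ?i s1)"
    by (rule reach_instr[where c = "[]"]) (use c s1 in auto)
  have "rel (s\<lparr>vv := (vv s)(x := ev e s), clk := clk s + 1\<rparr>) (exec w ?i s1)"
    using Assign.prems(2) s1 by (auto simp: rel_def)
  then show ?case
    using reach_trans[OF s1(1) 2] s1 Assign.prems
    by (intro exI[of _ "length (cexp 0 e) + 1"] exI[of _ "exec w ?i s1"]) auto
next
  case (Write i s e k)
  let ?a = "cexp 0 i" and ?b = "caddr k 0" and ?e = "cexp 1 e"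
  let ?i = "Store (treg 0) (treg 1)"
  have c: "code_at prog (pc \<sigma>) ?a" "code_at prog (pc \<sigma> + length ?a) ?b"
    "code_at prog (pc \<sigma> + length ?a + length ?b) ?e"
    "code_at prog (pc \<sigma> + length ?a + length ?b + length ?e) [?i]"
    using Write.prems(1,3) by (simp_all only: ccom.simps code_at_append add.assoc)
  obtain s1 where s1: "reach (length ?a) \<sigma> s1" "pc s1 = pc \<sigma> + length ?a"
    "mem s1 = mem \<sigma>" "regs s1 (treg 0) = ev i s"
    "\<And>x. (\<forall>u \<ge> 0. x \<noteq> treg u) \<Longrightarrow> regs s1 x = regs \<sigma> x"
    using cexp_correct[OF c(1) Write.hyps(1) Write.prems(2)] by blast
  have r1: "rel s s1"
    by (rule rel_temps[OF Write.prems(2)]) (use s1 in auto)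
  have z: "regs s1 0 = Z" using r1 by (simp add: rel_def)
  obtain s2 where s2: "reach (length ?b) s1 s2" "pc s2 = pc s1 + length ?b"
    "mem s2 = mem s1" "regs s2 (treg 0) = addr k (ev i s)"
    "\<And>x. (\<forall>u \<ge> 0. x \<noteq> treg u) \<Longrightarrow> regs s2 x = regs s1 x"
    using caddr_correct[of s1 k 0] c(2) Write.hyps s1 z by auto
  have r2: "rel s s2"
    by (rule rel_temps[OF r1]) (use s2 in auto)
  obtain s3 where s3: "reach (length ?e) s2 s3" "pc s3 = pc s2 + length ?e"
    "mem s3 = mem s2" "regs s3 (treg 1) = ev e s"
    "\<And>x. (\<forall>u \<ge> 1. x \<noteq> treg u) \<Longrightarrow> regs s3 x = regs s2 x"
    using cexp_correct[of s2 1 e s] c(3) Write.hyps r2 s1(2) s2(2) by (auto simp del: caddr.simps)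
  have r3: "rel s s3"
    by (rule rel_temps[OF r2]) (use s3 in auto)
  have a: "regs s3 (treg 0) = addr k (ev i s)" using s3(5)[of "treg 0"] s2(4) by simp
  have 4: "reach 1 s3 (exec w ?i s3)"
    by (rule reach_instr[where c = "[]"])
      (use c(4) s1 s2 s3 a addr_limit[OF Write.hyps(3)] in \<open>auto simp del: caddr.simps\<close>)
  have "rel (s\<lparr>aa := (aa s)(k := (aa s k)(ev i s := ev e s)), clk := clk s + 1\<rparr>) (exec w ?i s3)"
    using r3 a s3(4) Write.hyps(3) by (auto simp: rel_def idx_ok_def addr_inj)
  moreover have "reach (length ?a + (length ?b + (length ?e + 1))) \<sigma> (exec w ?i s3)"
    by (intro reach_trans[OF s1(1)] reach_trans[OF s2(1)] reach_trans[OF s3(1)] 4)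
  ultimately show ?case
    using s1(2) s2(2) s3(2) Write.prems(3,4)
    by (intro exI[of _ "length ?a + (length ?b + (length ?e + 1))"] exI[of _ "exec w ?i s3"])
      (auto simp del: caddr.simps)
next
  case (Seq c s s' d s'')
  have cc: "code_at prog p (ccom p c)" "code_at prog (p + clen c) (ccom (p + clen c) d)"
    using Seq.prems by (auto simp: code_at_append)
  obtain t s1 where s1: "reach t \<sigma> s1" "t \<le> L * (clk s' - clk s)" "rel s' s1" "pc s1 = p + clen c"
    using Seq.IH(1)[OF cc(1) Seq.prems(2,3)] Seq.prems(4) by auto
  obtain u s2 where s2: "reach u s1 s2" "u \<le> L * (clk s'' - clk s')" "rel s'' s2"
    "pc s2 = p + clen c + clen d"
    using Seq.IH(2)[OF cc(2) s1(3,4)] Seq.prems(4) by auto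
  have "clk s \<le> clk s'" "clk s' \<le> clk s''"
    using Seq.hyps big_frame by (auto simp: frame_def)
  then have "L * (clk s' - clk s) + L * (clk s'' - clk s') = L * (clk s'' - clk s)"
    by (simp flip: distrib_left)
  then show ?case
    using reach_trans[OF s1(1) s2(1)] s1 s2 by (intro exI[of _ "t + u"] exI[of _ s2]) auto
next
  case (IfT b s c s' d)
  let ?q = "p + blen b + clen c + 1"
  let ?i = "Jump (?q + clen d)"
  have cc: "code_at prog p (cbexp p b ?q)" "code_at prog (p + blen b) (ccom (p + blen b) c)"
     "code_at prog (p + blen b + clen c) [?i]"
    using IfT.prems by (auto simp: code_at_append Let_def code_at_Cons)
  obtain t s1 where s1: "reach t \<sigma> s1" "t \<le> blen b" "rel (tick s) s1" "pc s1 = p + blen b"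
    using cbexp_correct[of \<sigma> b ?q s] IfT cc by auto
  obtain u s2 where s2: "reach u s1 s2" "u \<le> L * (clk s' - clk (tick s))" "rel s' s2"
    "pc s2 = p + blen b + clen c"
    using IfT.IH[OF cc(2) s1(3,4)] IfT.prems(4) by auto
  have 3: "reach 1 s2 (exec w ?i s2)"
    by (rule reach_instr[where c = "[]"]) (use cc s2 in auto)
  have "clk s + 1 \<le> clk s'"
    using IfT.hyps big_frame by (fastforce simp: frame_def)
  then have "L + L * (clk s' - clk (tick s)) = L * (clk s' - clk s)"
    using mult_diff_Suc by simp
  moreover have "blen b + 1 \<le> L" using IfT.prems by simp
  ultimately show ?case
    using reach_trans[OF s1(1) reach_trans[OF s2(1) 3]] s1 s2
    by (intro exI[of _ "t + (u + 1)"] exI[of _ "exec w ?i s2"]) (auto simp: rel_def)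
next
  case (IfF b s d s' c)
  let ?q = "p + blen b + clen c + 1"
  let ?i = "Jump (?q + clen d)"
  have cc: "code_at prog p (cbexp p b ?q)" "code_at prog ?q (ccom ?q d)"
    using IfF.prems by (auto simp: code_at_append Let_def code_at_Cons)
  obtain t s1 where s1: "reach t \<sigma> s1" "t \<le> blen b" "rel (tick s) s1" "pc s1 = ?q"
    using cbexp_correct[of \<sigma> b ?q s] IfF cc by auto
  obtain u s2 where s2: "reach u s1 s2" "u \<le> L * (clk s' - clk (tick s))" "rel s' s2"
    "pc s2 = ?q + clen d"
    using IfF.IH[OF cc(2) s1(3,4)] IfF.prems(4) by auto
  have "clk s + 1 \<le> clk s'"
    using IfF.hyps big_frame by (fastforce simp: frame_def)
  then have "L + L * (clk s' - clk (tick s)) = L * (clk s' - clk s)"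
    using mult_diff_Suc by simp
  moreover have "blen b + 1 \<le> L" using IfF.prems by simp
  ultimately show ?case
    using reach_trans[OF s1(1) s2(1)] s1 s2
    by (intro exI[of _ "t + u"] exI[of _ s2]) (auto simp: rel_def)
next
  case (WhileF b s c)
  let ?q = "p + blen b + clen c + 1"
  have cc: "code_at prog p (cbexp p b ?q)"
    using WhileF.prems by (auto simp: code_at_append Let_def code_at_Cons)
  obtain t s1 where s1: "reach t \<sigma> s1" "t \<le> blen b" "rel (tick s) s1" "pc s1 = ?q"
    using cbexp_correct[of \<sigma> b ?q s] WhileF cc by auto
  then show ?case
    using WhileF.prems by (intro exI[of _ t] exI[of _ s1]) auto
next
  case (WhileT b s c s' s'')
  let ?q = "p + blen b + clen c + 1"
  have cc: "code_at prog p (cbexp p b ?q)" "code_at prog (p + blen b) (ccom (p + blen b) c)"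
     "code_at prog (p + blen b + clen c) [Jump p]"
    using WhileT.prems by (auto simp: code_at_append Let_def code_at_Cons)
  obtain t s1 where s1: "reach t \<sigma> s1" "t \<le> blen b" "rel (tick s) s1" "pc s1 = p + blen b"
    using cbexp_correct[of \<sigma> b ?q s] WhileT cc by auto
  obtain u s2 where s2: "reach u s1 s2" "u \<le> L * (clk s' - clk (tick s))" "rel s' s2"
    "pc s2 = p + blen b + clen c"
    using WhileT.IH(1)[OF cc(2) s1(3,4)] WhileT.prems(4) by auto
  have 3: "reach 1 s2 (exec w (Jump p) s2)"
    by (rule reach_instr[where c = "[]"]) (use cc s2 in auto)
  obtain v s3 where s3: "reach v (exec w (Jump p) s2) s3" "v \<le> L * (clk s'' - clk s')" "rel s'' s3"
    "pc s3 = ?q"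
    using WhileT.IH(2)[OF WhileT.prems(1), of "exec w (Jump p) s2"] WhileT.prems(4) s2(3) by (auto simp: rel_def)
  have "clk s + 1 \<le> clk s'" "clk s' \<le> clk s''"
    using WhileT.hyps big_frame by (fastforce simp: frame_def)+
  then have "L + L * (clk s' - clk (tick s)) + L * (clk s'' - clk s') = L * (clk s'' - clk s)"
    using mult_diff_Suc[of "clk s" "clk s'" L] by (simp flip: distrib_left)
  moreover have "blen b + 1 \<le> L" using WhileT.prems by simp
  ultimately show ?case
    using reach_trans[OF s1(1) reach_trans[OF s2(1) reach_trans[OF 3 s3(1)]]] s1 s2 s3
    by (intro exI[of _ "t + (u + (1 + v))"] exI[of _ s3]) auto
qed

end

section \<open>Longest common subsequences of prefixes\<close>

definition cs :: "'a list \<Rightarrow> 'a list \<Rightarrow> nat \<Rightarrow> nat \<Rightarrow> nat \<Rightarrow> bool" where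
  "cs S T s i j \<longleftrightarrow> (\<exists>Z. length Z = s \<and> subseq Z (take i S) \<and> subseq Z (take j T))"

lemma subseq_take: "i \<le> i' \<Longrightarrow> subseq Z (take i S) \<Longrightarrow> subseq Z (take i' S)"
  by (metis prefix_imp_subseq subseq_order.order_trans take_is_prefix min.absorb1 take_take)

lemma cs_mono: "cs S T s i j \<Longrightarrow> s' \<le> s \<Longrightarrow> i \<le> i' \<Longrightarrow> j \<le> j' \<Longrightarrow> cs S T s' i' j'"
  unfolding cs_def
proof (elim exE conjE)
  fix Z assume *: "length Z = s" "subseq Z (take i S)" "subseq Z (take j T)"
    "s' \<le> s" "i \<le> i'" "j \<le> j'"
  then have "subseq (take s' Z) (take i' S)" "subseq (take s' Z) (take j' T)"
    by (meson prefix_imp_subseq subseq_order.order_trans take_is_prefix subseq_take)+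
  then show "\<exists>Z. length Z = s' \<and> subseq Z (take i' S) \<and> subseq Z (take j' T)"
    using * by (intro exI[of _ "take s' Z"]) auto
qed

lemma cs_0 [simp]: "cs S T 0 i j"
  by (auto simp: cs_def)

lemma cs_sym: "cs S T s i j \<longleftrightarrow> cs T S s j i"
  by (auto simp: cs_def)

lemma cs_le: "cs S T s i j \<Longrightarrow> s \<le> i \<and> s \<le> j"
  unfolding cs_def by (auto dest!: list_emb_length)

lemma subseq_rev: "subseq xs ys \<Longrightarrow> subseq (rev xs) (rev ys)"
  by (induction rule: list_emb.induct) (auto intro: subseq_rev_drop_many)

lemma subseq_snoc2: "subseq (xs @ [x]) (ys @ [y]) \<longleftrightarrow> (if x = y then subseq xs ys else subseq (xs @ [x]) ys)"
proof (cases "x = y")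
  case False
  have "subseq (xs @ [x]) ys" if "subseq (xs @ [x]) (ys @ [y])"
  proof -
    obtain us vs where "xs @ [x] = us @ vs" "subseq us ys" "subseq vs [y]"
      using \<open>subseq (xs @ [x]) (ys @ [y])\<close> by (auto simp: subseq_append_iff)
    moreover have "vs = [] \<or> vs = [y]"
      using \<open>subseq vs [y]\<close> by (cases vs) (auto split: if_splits)
    ultimately show ?thesis using False by auto
  qed
  then show ?thesis using False by auto
qed simp

text \<open>The case distinction is whether the common subsequence ends with the last character of
  the prefix of \<open>S\<close>. If it does, the partner in \<open>T\<close> may be any position
  \<open>j'\<close> whose predecessors still leave room for the first \<open>s\<close>
  characters.\<close>

lemma cs_Suc:
  assumes i: "i < length S"
  shows "cs S T (Suc s) (Suc i) j \<longleftrightarrow> cs S T (Suc s) i j \<or>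
    (\<exists>j' < j. j' < length T \<and> T ! j' = S ! i \<and> cs S T s i j')" (is "?l \<longleftrightarrow> ?r")
proof
  assume ?l
  then obtain Z where Z: "length Z = Suc s" "subseq Z (take (Suc i) S)" "subseq Z (take j T)"
    by (auto simp: cs_def)
  obtain Y z where Y: "Z = Y @ [z]" using Z(1) by (cases Z rule: rev_cases) auto
  show ?r
  proof (cases "z = S ! i")
    case False
    then have "subseq Z (take i S)"
      using Z(2) i by (simp add: take_Suc_conv_app_nth Y subseq_snoc2)
    then show ?thesis using Z by (auto simp: cs_def)
  next
    case True
    have 1: "subseq Y (take i S)"
      using Z(2) i True by (simp add: take_Suc_conv_app_nth Y subseq_snoc2)
    obtain us vs where uv: "take j T = us @ vs" "subseq Y us" "subseq [z] vs"
      using Z(3) unfolding Y by (blast dest: list_emb_appendD)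
    then have "z \<in> set vs" by (simp add: subseq_singleton_left)
    then obtain v1 v2 where v: "vs = v1 @ z # v2" by (auto dest: split_list)
    define j' where "j' = length us + length v1"
    have l: "length (take j T) = length us + length vs" using uv by simp
    then have j': "j' < j" "j' < length T" by (auto simp: j'_def v)
    have "take j T ! j' = z" by (simp add: uv(1) v j'_def nth_append)
    then have "T ! j' = S ! i" using j' True by simp
    moreover have "take j' T = us @ v1"
    proof -
      have "take j' T = take j' (take j T)" using j' by simp
      then show ?thesis by (simp add: uv(1) v j'_def)
    qed
    then have "subseq Y (take j' T)" using uv(2) by (simp add: subseq_rev_drop_many)
    ultimately show ?thesis using 1 Z(1) Y j' by (auto simp: cs_def)
  qed
next
  assume ?r
  then show ?l
  proof (elim disjE exE conjE)
    assume "cs S T (Suc s) i j" then show ?l by (rule cs_mono) auto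
  next
    fix j' assume j': "j' < j" "j' < length T" "T ! j' = S ! i" "cs S T s i j'"
    then obtain Z where Z: "length Z = s" "subseq Z (take i S)" "subseq Z (take j' T)"
      by (auto simp: cs_def)
    have "subseq (Z @ [S ! i]) (take (Suc i) S)"
      using Z i by (simp add: take_Suc_conv_app_nth)
    moreover have "subseq (Z @ [S ! i]) (take (Suc j') T)"
      using Z j' by (simp add: take_Suc_conv_app_nth)
    then have "subseq (Z @ [S ! i]) (take j T)" using j'(1) by (intro subseq_take[of "Suc j'" j]) auto
    ultimately show ?l using Z(1) by (auto simp: cs_def intro!: exI[of _ "Z @ [S ! i]"])
  qed
qed

lemma finite_common_subseq: "finite {Z. common_subseq A B Z}"
proof -
  have "{Z. common_subseq A B Z} \<subseteq> {Z. set Z \<subseteq> set A \<and> length Z \<le> length A}"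
    by (auto simp: common_subseq_def dest: list_emb_length elim: list_emb_set)
  then show ?thesis
    using finite_lists_length_le finite_subset by blast
qed

lemma cs_lcs:
  assumes "length A \<le> i" "length B \<le> j"
  shows "cs A B s i j \<longleftrightarrow> s \<le> lcs A B"
proof
  let ?L = "length ` {Z. common_subseq A B Z}"
  have fin: "finite ?L" and ne: "?L \<noteq> {}"
    using finite_common_subseq by (auto simp: common_subseq_def intro: exI[of _ "[]"])
  show "s \<le> lcs A B" if "cs A B s i j"
    unfolding lcs_def
  proof (rule Max_ge[OF fin])
    show "s \<in> ?L" using that assms by (auto simp: cs_def common_subseq_def)
  qed
  have "lcs A B \<in> ?L" unfolding lcs_def by (rule Max_in[OF fin ne])
  then have "cs A B (lcs A B) i j" using assms by (auto simp: cs_def common_subseq_def)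
  then show "cs A B s i j" if "s \<le> lcs A B" using that by (rule cs_mono) auto
qed

lemma lcs_le: "lcs A B \<le> length A" "lcs A B \<le> length B"
  using cs_lcs[of A "length A" B "length B" "lcs A B"] cs_le[of A B "lcs A B" "length A" "length B"]
  by auto

lemma lcs_eqI:
  assumes "\<And>s. cs A B s (length A) (length B) \<longleftrightarrow> s \<le> m"
  shows "lcs A B = m"
  using assms cs_lcs[of A "length A" B "length B"] by (metis order_antisym order_refl)

lemma lcs_sym: "lcs A B = lcs B A"
  using cs_lcs[of B "length B" A "length A"] cs_sym[of A B]
  by (intro lcs_eqI) simp

lemma lcs_rev: "lcs (rev A) (rev B) = lcs A B"
proof -
  have "cs (rev A) (rev B) s (length A) (length B) \<longleftrightarrow> cs A B s (length A) (length B)" for s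
    unfolding cs_def by (simp, metis length_rev subseq_rev rev_rev_ident)
  then show ?thesis using cs_lcs[of A "length A" B "length B"] by (intro lcs_eqI) simp
qed

text \<open>Embedding \<open>Z\<close> skips \<open>length A - length Z\<close> characters
  altogether, hence no more than that before the end of any prefix of \<open>Z\<close>.\<close>

lemma subseq_take_gap:
  "subseq Z A \<Longrightarrow> subseq (take t Z) (take (t + (length A - length Z)) A)"
proof (induction Z A arbitrary: t rule: list_emb.induct)
  case (list_emb_Cons xs ys y)
  then have l: "length xs \<le> length ys" using list_emb_length by blast
  show ?case
  proof (cases t)
    case (Suc u)
    have "Suc u + (length (y # ys) - length xs) = Suc (Suc u + (length ys - length xs))"
      using l by simp
    then show ?thesis using list_emb_Cons.IH[of t] Suc by (simp add: list_emb.list_emb_Cons)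
  qed simp
next
  case (list_emb_Cons2 x y xs ys)
  then show ?case by (cases t) auto
qed simp

text \<open>The longest common subsequence leaves out only \<open>n - lcs\<close> characters on either side.\<close>

lemma cs_lower:
  assumes "length A = n" "length B = n" "i \<le> n" "j \<le> n"
  shows "cs A B (min i j - (n - lcs A B)) i j"
proof -
  define D where "D = n - lcs A B"
  obtain Z where Z: "length Z = lcs A B" "subseq Z A" "subseq Z B"
    using cs_lcs[of A n B n "lcs A B"] assms by (auto simp: cs_def)
  have l: "length Z \<le> n" using Z lcs_le assms by auto
  let ?t = "min i j - D"
  show ?thesis
  proof (cases "D \<le> min i j")
    case True
    have "subseq (take ?t Z) (take (?t + D) A)" "subseq (take ?t Z) (take (?t + D) B)"
      using subseq_take_gap[OF Z(2), of ?t] subseq_take_gap[OF Z(3), of ?t] assms Z(1)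
      by (simp_all add: D_def)
    then have "subseq (take ?t Z) (take i A)" "subseq (take ?t Z) (take j B)"
      using True by (auto intro: subseq_take[rotated])
    moreover have "?t \<le> length Z" using assms l Z(1) by (auto simp: D_def)
    ultimately show ?thesis unfolding D_def[symmetric] cs_def
      by (intro exI[of _ "take ?t Z"]) auto
  next
    case False
    then have "?t = 0" by arith
    then show ?thesis unfolding D_def[symmetric] by simp
  qed
qed

text \<open>\<open>FF S T s i\<close> is the length of the shortest prefix of \<open>T\<close> having a common subsequence of length
  \<open>s\<close> with the prefix of \<open>S\<close> of length \<open>i\<close>; the value \<open>length T + 1\<close> means that there is none.\<close>

definition FF :: "'a list \<Rightarrow> 'a list \<Rightarrow> nat \<Rightarrow> nat \<Rightarrow> nat" where
  "FF S T s i = (if \<exists>j \<le> length T. cs S T s i j then LEAST j. cs S T s i j else length T + 1)"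

lemma FF_iff: "j \<le> length T \<Longrightarrow> cs S T s i j \<longleftrightarrow> FF S T s i \<le> j"
proof (cases "\<exists>j \<le> length T. cs S T s i j")
  case True
  then obtain j0 where "cs S T s i j0" by blast
  then have "cs S T s i (FF S T s i)" using True unfolding FF_def by (auto intro: LeastI)
  then show ?thesis using True unfolding FF_def
    by (auto intro: Least_le elim: cs_mono)
qed (auto simp: FF_def)

lemma FF_le: "FF S T s i \<le> length T + 1"
  using FF_iff[of "length T" T S s i] unfolding FF_def by (auto intro: Least_le le_SucI order_trans)

text \<open>A threshold is determined by its Galois connection with \<open>cs\<close>, the default
  \<open>length T + 1\<close> included; the recurrences below are derived in this form.\<close>

lemma FF_unique:
  assumes "v \<le> length T + 1" "\<And>j. j \<le> length T \<Longrightarrow> cs S T s i j \<longleftrightarrow> v \<le> j"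
  shows "FF S T s i = v"
proof (rule order_antisym)
  show "FF S T s i \<le> v"
    using assms FF_iff[of v T S s i] FF_le[of S T s i] by (cases "v \<le> length T") auto
  show "v \<le> FF S T s i"
    using assms(1) assms(2)[of "FF S T s i"] FF_iff[of "FF S T s i" T S s i]
    by (cases "FF S T s i \<le> length T") auto
qed

section \<open>Values, growth and recurrence of the thresholds\<close>

lemma FF_0 [simp]: "FF S T 0 i = 0"
  by (rule FF_unique) auto

lemma FF_inf: "i < s \<Longrightarrow> FF S T s i = length T + 1"
  by (rule FF_unique) (auto dest: cs_le)

lemma FF_cs: "FF S T s i \<le> length T \<Longrightarrow> cs S T s i (FF S T s i)"
  by (simp add: FF_iff)

text \<open>The last matched character occupies a position in either string, so removing it shortens
  both prefixes strictly.\<close>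

lemma cs_drop_last:
  assumes "cs S T (Suc s) (Suc i) j"
  shows "\<exists>j' < j. cs S T s i j'"
proof -
  obtain Z where Z: "length Z = Suc s" "subseq Z (take (Suc i) S)" "subseq Z (take j T)"
    using assms by (auto simp: cs_def)
  obtain Y z where Y: "Z = Y @ [z]" using Z(1) by (cases Z rule: rev_cases) auto
  have *: "\<exists>j' < j. subseq Y (take j' X)" if yz: "subseq (Y @ [z]) (take j X)" for X :: "'a list" and j
  proof -
    obtain us vs where uv: "take j X = us @ vs" "subseq Y us" "subseq [z] vs"
      using yz by (blast dest: list_emb_appendD)
    then have "vs \<noteq> []" by auto
    then have "length us < j" using arg_cong[OF uv(1), of length] by (cases vs) auto
    moreover have "take (length us) X = us"
      by (metis uv(1) calculation append_eq_conv_conj less_imp_le min.absorb1 take_take)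
    ultimately show ?thesis using uv(2) by auto
  qed
  obtain j' where "j' < j" "subseq Y (take j' T)" using *[of j T] Z Y by auto
  moreover obtain i' where "i' < Suc i" "subseq Y (take i' S)" using *[of "Suc i" S] Z Y by auto
  then have "subseq Y (take i S)" by (auto intro: subseq_take[rotated])
  ultimately show ?thesis using Z(1) Y by (auto simp: cs_def)
qed

text \<open>Growth along diagonals is what makes the total pointer movement within one row linear;
  it also drives the monotone pointers of the final scan.\<close>

lemma FF_diag: "FF S T s i < FF S T (Suc s) (Suc i) \<or> FF S T (Suc s) (Suc i) = length T + 1"
proof (cases "FF S T (Suc s) (Suc i) \<le> length T")
  case True
  then obtain j where "j < FF S T (Suc s) (Suc i)" "cs S T s i j"
    using cs_drop_last[OF FF_cs[OF True]] by auto
  then show ?thesis using True FF_iff[of j T S s i] by auto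
next
  case False
  then show ?thesis using FF_le[of S T "Suc s" "Suc i"] by auto
qed

lemma FF_diag_mono: "d \<le> d' \<Longrightarrow> FF S T s i \<le> FF S T (s + d) (i + d)"
proof -
  have "FF S T s i \<le> FF S T (s + d) (i + d)" for d
  proof (induction d)
    case (Suc d)
    have "FF S T (s + d) (i + d) \<le> FF S T (s + Suc d) (i + Suc d)"
      using FF_diag[of S T "s + d" "i + d"] FF_le[of S T "s + d" "i + d"] by auto
    then show ?case using Suc.IH by simp
  qed simp
  then show "d \<le> d' \<Longrightarrow> FF S T s i \<le> FF S T (s + d) (i + d)" .
qed

text \<open>Only positions strictly between two old thresholds matter: up to
  \<open>FF S T s i\<close> there is no room for the first \<open>s\<close> characters, and from
  \<open>FF S T (Suc s) i\<close> on a match gains nothing. Positions count from 1, whence the index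
  \<open>j - 1\<close>.\<close>

lemma FF_Suc_match:
  assumes "i < length S" "FF S T s i < j" "j < FF S T (Suc s) i" "T ! (j - 1) = S ! i"
    "\<And>j'. FF S T s i < j' \<Longrightarrow> j' < j \<Longrightarrow> T ! (j' - 1) \<noteq> S ! i"
  shows "FF S T (Suc s) (Suc i) = j"
proof (rule FF_unique)
  have jl: "j \<le> length T" using assms(3) FF_le[of S T "Suc s" i] by auto
  then show "j \<le> length T + 1" by simp
  fix k assume k: "k \<le> length T"
  show "cs S T (Suc s) (Suc i) k \<longleftrightarrow> j \<le> k"
  proof
    assume "j \<le> k"
    moreover have "cs S T s i (j - 1)" using assms(2) jl by (simp add: FF_iff)
    ultimately show "cs S T (Suc s) (Suc i) k"
      unfolding cs_Suc[OF assms(1)] using assms(2,4) jl by (intro disjI2 exI[of _ "j - 1"]) auto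
  next
    assume "cs S T (Suc s) (Suc i) k"
    then show "j \<le> k"
      unfolding cs_Suc[OF assms(1)]
    proof (elim disjE exE conjE)
      assume "cs S T (Suc s) i k" then show ?thesis using k assms(3) by (simp add: FF_iff)
    next
      fix j' assume j': "j' < k" "j' < length T" "T ! j' = S ! i" "cs S T s i j'"
      then have "FF S T s i < Suc j'" by (simp add: FF_iff less_Suc_eq_le)
      then have "\<not> Suc j' < j" using assms(5)[of "Suc j'"] j' by auto
      then show ?thesis using j' by simp
    qed
  qed
qed

lemma FF_Suc_nomatch:
  assumes "i < length S"
    "\<And>j. FF S T s i < j \<Longrightarrow> j < FF S T (Suc s) i \<Longrightarrow> T ! (j - 1) \<noteq> S ! i"
  shows "FF S T (Suc s) (Suc i) = FF S T (Suc s) i"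
proof (rule FF_unique[OF FF_le])
  fix k assume k: "k \<le> length T"
  show "cs S T (Suc s) (Suc i) k \<longleftrightarrow> FF S T (Suc s) i \<le> k"
  proof
    assume "FF S T (Suc s) i \<le> k"
    then show "cs S T (Suc s) (Suc i) k"
      unfolding cs_Suc[OF assms(1)] using k by (simp add: FF_iff)
  next
    assume "cs S T (Suc s) (Suc i) k"
    then show "FF S T (Suc s) i \<le> k"
      unfolding cs_Suc[OF assms(1)]
    proof (elim disjE exE conjE)
      assume "cs S T (Suc s) i k" then show ?thesis using k by (simp add: FF_iff)
    next
      fix j' assume j': "j' < k" "j' < length T" "T ! j' = S ! i" "cs S T s i j'"
      then have "FF S T s i < Suc j'" by (simp add: FF_iff less_Suc_eq_le)
      then have "\<not> Suc j' < FF S T (Suc s) i" using assms(2)[of "Suc j'"] j' by auto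
      then show ?thesis using j' by simp
    qed
  qed
qed

text \<open>Backtracking rule: a threshold changed by admitting \<open>S ! i\<close> can only stem
  from matching this character, at exactly the position that the threshold names.\<close>

lemma FF_trace:
  assumes "i < length S" "FF S T (Suc s) (Suc i) \<noteq> FF S T (Suc s) i"
  defines "j \<equiv> FF S T (Suc s) (Suc i)"
  shows "FF S T s i < j" "j \<le> length T" "T ! (j - 1) = S ! i"
proof -
  obtain j' where j': "FF S T s i < j'" "j' < FF S T (Suc s) i" "T ! (j' - 1) = S ! i"
    using FF_Suc_nomatch[OF assms(1), of T s] assms(2) by blast
  let ?P = "\<lambda>j'. FF S T s i < j' \<and> j' < FF S T (Suc s) i \<and> T ! (j' - 1) = S ! i"
  define k where "k = (LEAST j'. ?P j')"
  have k: "FF S T s i < k \<and> k < FF S T (Suc s) i \<and> T ! (k - 1) = S ! i"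
    unfolding k_def by (rule LeastI[of ?P j']) (use j' in auto)
  have "FF S T (Suc s) (Suc i) = k"
    by (rule FF_Suc_match) (use k assms(1) not_less_Least[of _ ?P, folded k_def] in force)+
  then show "FF S T s i < j" "j \<le> length T" "T ! (j - 1) = S ! i"
    using k FF_le[of S T "Suc s" i] by (auto simp: j_def)
qed

section \<open>Windows containing the pattern\<close>

text \<open>\<open>sg S P p i\<close> is one more than the largest \<open>b\<close> such that the first \<open>p\<close> characters of \<open>P\<close> form a
  subsequence of positions \<open>b, \<dots>, i - 1\<close> of \<open>S\<close>; the value \<open>0\<close> means that there is no such \<open>b\<close>.\<close>

fun sg :: "'a list \<Rightarrow> 'a list \<Rightarrow> nat \<Rightarrow> nat \<Rightarrow> nat" where
  "sg S P 0 i = i + 1"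
| "sg S P (Suc p) 0 = 0"
| "sg S P (Suc p) (Suc i) = (if S ! i = P ! p then sg S P p i else sg S P (Suc p) i)"

text \<open>Greedy matching from the right is optimal: by \<open>subseq_snoc2\<close>, agreeing last
  characters may always be matched with each other, and disagreeing ones let the text character be
  dropped.\<close>

lemma sg_iff:
  "p \<le> length P \<Longrightarrow> i \<le> length S \<Longrightarrow> b \<le> i \<Longrightarrow>
   subseq (take p P) (drop b (take i S)) \<longleftrightarrow> b < sg S P p i"
proof (induction S P p i arbitrary: b rule: sg.induct)
  case (2 S P p)
  then have "P \<noteq> []" by auto
  then show ?case by simp
next
  case (3 S P p i)
  show ?case
  \<comment> \<open>For an empty window no last character can be split off; there the bound
    \<open>i + 1\<close> on window starts decides.\<close>
  proof (cases "b = Suc i")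
    case True
    have "sg S P p i \<le> i + 1" for p
      by (induction S P p i rule: sg.induct) auto
    then have "\<not> b < sg S P (Suc p) (Suc i)"
      using True by (auto simp: not_less le_Suc_eq split: if_splits)
    moreover have "P \<noteq> []" using 3 by auto
    ultimately show ?thesis using True 3 by simp
  next
    case False
    then have "drop b (take (Suc i) S) = drop b (take i S) @ [S ! i]"
      using 3 by (simp add: take_Suc_conv_app_nth)
    moreover have "take (Suc p) P = take p P @ [P ! p]"
      using 3 by (simp add: take_Suc_conv_app_nth)
    ultimately show ?thesis
      using 3 False by (auto simp: subseq_snoc2)
  qed
qed simp

lemma sg_le: "sg S P p i \<le> i + 1"
  by (induction S P p i rule: sg.induct) auto

text \<open>A window remains a window when its end moves to the right, so the latest start cannot
  move back.\<close>

lemma sg_mono: "p \<le> length P \<Longrightarrow> i \<le> i' \<Longrightarrow> i' \<le> length S \<Longrightarrow> sg S P p i \<le> sg S P p i'"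
proof (rule ccontr)
  assume *: "p \<le> length P" "i \<le> i'" "i' \<le> length S" "\<not> sg S P p i \<le> sg S P p i'"
  let ?b = "sg S P p i'"
  have b: "?b \<le> i" using * sg_le[of S P p i] by auto
  have "subseq (take p P) (drop ?b (take i S))" using * b by (subst sg_iff) auto
  moreover have "subseq (drop ?b (take i S)) (drop ?b (take i' S))"
    using *(2) b
    by (metis drop_append le_add_diff_inverse min.absorb1 subseq_rev_drop_many subseq_order.order_refl
        take_add)
  ultimately have "subseq (take p P) (drop ?b (take i' S))" by (rule subseq_order.order_trans)
  then show False using * b by (subst (asm) sg_iff) auto
qed

lemma take_rev_drop: "length S = n \<Longrightarrow> take (n - e) (rev S) = rev (drop e S)"
  by (simp add: rev_drop)

text \<open>A solution splits into a common subsequence before a window of either string, the pattern, and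
  a common subsequence after the two windows.\<close>

definition ic_split :: "'a list \<Rightarrow> 'a list \<Rightarrow> 'a list \<Rightarrow> nat \<Rightarrow> nat \<Rightarrow> nat \<Rightarrow> nat \<Rightarrow> bool" where
  "ic_split A B P s t e f \<longleftrightarrow> e \<le> length A \<and> f \<le> length B \<and>
     0 < sg A P (length P) e \<and> 0 < sg B P (length P) f \<and>
     cs A B s (sg A P (length P) e - 1) (sg B P (length P) f - 1) \<and>
     cs (rev A) (rev B) t (length A - e) (length B - f)"

text \<open>Cut \<open>Z\<close> around \<open>P\<close> in either string independently. Moving a
  window start to the latest possible one only enlarges the prefix left for \<open>X\<close>.
  Suffixes are treated as prefixes of the reversed strings, so that one theory of prefixes serves
  both ends.\<close>

lemma ic_candidate_split:
  assumes "ic_candidate A B P Z"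
  shows "\<exists>s t e f. ic_split A B P s t e f \<and> length Z = s + length P + t"
proof -
  obtain X Y where Z: "Z = X @ P @ Y" "subseq Z A" "subseq Z B"
    using assms by (auto simp: ic_candidate_def sublist_def common_subseq_def)
  have *: "\<exists>e \<le> length S. 0 < sg S P (length P) e \<and> subseq X (take (sg S P (length P) e - 1) S) \<and>
      subseq Y (drop e S)" if S: "subseq Z S" for S
  proof -
    obtain S1 S' where 1: "S = S1 @ S'" "subseq X S1" "subseq (P @ Y) S'"
      using S unfolding Z(1) by (blast dest: list_emb_appendD)
    obtain S2 S3 where 2: "S' = S2 @ S3" "subseq P S2" "subseq Y S3"
      using 1(3) by (blast dest: list_emb_appendD)
    define e where "e = length S1 + length S2"
    have "subseq (take (length P) P) (drop (length S1) (take e S))"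
      using 1 2 by (simp add: e_def)
    then have b: "length S1 < sg S P (length P) e"
      using 1 2 by (subst (asm) sg_iff) (auto simp: e_def)
    moreover have "subseq X (take (length S1) S)" using 1 by simp
    then have "subseq X (take (sg S P (length P) e - 1) S)"
      using b by (auto intro: subseq_take[rotated])
    ultimately show ?thesis using 1 2 by (intro exI[of _ e]) (auto simp: e_def)
  qed
  obtain e where e: "e \<le> length A" "0 < sg A P (length P) e"
    "subseq X (take (sg A P (length P) e - 1) A)" "subseq Y (drop e A)"
    using *[OF Z(2)] by auto
  obtain f where f: "f \<le> length B" "0 < sg B P (length P) f"
    "subseq X (take (sg B P (length P) f - 1) B)" "subseq Y (drop f B)"
    using *[OF Z(3)] by auto
  have "cs (rev A) (rev B) (length Y) (length A - e) (length B - f)"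
    using e f unfolding cs_def by (intro exI[of _ "rev Y"]) (simp add: take_rev_drop subseq_rev)
  moreover have "cs A B (length X) (sg A P (length P) e - 1) (sg B P (length P) f - 1)"
    using e f by (auto simp: cs_def)
  ultimately show ?thesis using e f Z(1)
    by (intro exI[of _ "length X"] exI[of _ "length Y"] exI[of _ e] exI[of _ f])
      (auto simp: ic_split_def)
qed

lemma window_subseq:
  assumes "e \<le> length S" "0 < sg S P (length P) e"
    "subseq X (take (sg S P (length P) e - 1) S)" "subseq Y (take (length S - e) (rev S))"
  shows "subseq (X @ P @ rev Y) S"
proof -
  define b where "b = sg S P (length P) e - 1"
  have be: "b \<le> e" using sg_le[of S P "length P" e] assms(2) by (simp add: b_def)
  have "subseq P (drop b (take e S))"
    using sg_iff[of "length P" P e S b] assms be by (simp add: b_def)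
  moreover have "subseq (rev Y) (drop e S)"
    using assms(4) by (simp add: take_rev_drop) (metis subseq_rev rev_rev_ident)
  ultimately have "subseq (X @ P @ rev Y) (take b S @ drop b (take e S) @ drop e S)"
    using assms(3) by (intro list_emb_append_mono) (auto simp: b_def)
  also have "take b S @ drop b (take e S) @ drop e S = S"
    using be by (metis append.assoc append_take_drop_id min.absorb1 take_take)
  finally show ?thesis .
qed

lemma ic_candidateI:
  assumes "length A = n" "length B = n" "e \<le> n" "f \<le> n"
    "0 < sg A P (length P) e" "0 < sg B P (length P) f"
    "subseq X (take (sg A P (length P) e - 1) A)" "subseq X (take (sg B P (length P) f - 1) B)"
    "subseq Y (take (n - e) (rev A))" "subseq Y (take (n - f) (rev B))"
  shows "ic_candidate A B P (X @ P @ rev Y)"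
  using assms window_subseq[of e A P X Y] window_subseq[of f B P X Y]
  by (auto simp: ic_candidate_def common_subseq_def sublist_def)

section \<open>Reading the input\<close>

abbreviation (input) "vn \<equiv> (10::nat)"
abbreviation (input) "vr \<equiv> (11::nat)"
abbreviation (input) "vk \<equiv> (12::nat)"
abbreviation (input) "vK \<equiv> (13::nat)"
abbreviation (input) "vD \<equiv> (14::nat)"
abbreviation (input) "vl \<equiv> (15::nat)"

abbreviation (input) "vi \<equiv> (20::nat)"
abbreviation (input) "vj \<equiv> (21::nat)"
abbreviation (input) "vm \<equiv> (22::nat)"
abbreviation (input) "vg \<equiv> (23::nat)"
abbreviation (input) "vp \<equiv> (24::nat)"
abbreviation (input) "vt \<equiv> (25::nat)"
abbreviation (input) "vx \<equiv> (26::nat)"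
abbreviation (input) "vf \<equiv> (27::nat)"
abbreviation (input) "vh \<equiv> (28::nat)"
abbreviation (input) "ve \<equiv> (29::nat)"
abbreviation (input) "vq \<equiv> (30::nat)"
abbreviation (input) "vb \<equiv> (31::nat)"

text \<open>\<open>aA\<close> to \<open>aP\<close> hold the strings, \<open>aAr\<close> and \<open>aBr\<close>
  reversed; \<open>aQ\<close> is the dictionary, \<open>aIA\<close>, \<open>aIB\<close>, \<open>aIP\<close> are the strings translated by it; \<open>aT\<close> and \<open>aTB\<close>
  are the tables for codes, \<open>aM\<close> the match masks, \<open>aV\<close> the timeline; \<open>aSA\<close>, \<open>aSB\<close> are the window
  starts, \<open>aR\<close> is a row, \<open>aF\<close> to \<open>aGr\<close> are the tables of \<open>FF\<close>, and \<open>aU\<close>, \<open>aUr\<close> the traced parts.\<close>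

abbreviation (input) "aA \<equiv> (2::nat)"
abbreviation (input) "aB \<equiv> (3::nat)"
abbreviation (input) "aAr \<equiv> (4::nat)"
abbreviation (input) "aBr \<equiv> (5::nat)"
abbreviation (input) "aP \<equiv> (6::nat)"
abbreviation (input) "aQ \<equiv> (7::nat)"
abbreviation (input) "aIA \<equiv> (8::nat)"
abbreviation (input) "aIB \<equiv> (9::nat)"
abbreviation (input) "aIP \<equiv> (10::nat)"
abbreviation (input) "aT \<equiv> (11::nat)"
abbreviation (input) "aTB \<equiv> (12::nat)"
abbreviation (input) "aM \<equiv> (13::nat)"
abbreviation (input) "aV \<equiv> (14::nat)"
abbreviation (input) "aSA \<equiv> (15::nat)"
abbreviation (input) "aSB \<equiv> (16::nat)"
abbreviation (input) "aR \<equiv> (17::nat)"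
abbreviation (input) "aF \<equiv> (18::nat)"
abbreviation (input) "aG \<equiv> (19::nat)"
abbreviation (input) "aFr \<equiv> (20::nat)"
abbreviation (input) "aGr \<equiv> (21::nat)"
abbreviation (input) "aU \<equiv> (22::nat)"
abbreviation (input) "aUr \<equiv> (23::nat)"

text \<open>Storage from index 1 makes indices agree with prefix lengths and thus with
  thresholds.\<close>

definition str :: "st \<Rightarrow> nat \<Rightarrow> nat list \<Rightarrow> bool" where
  "str s a xs \<longleftrightarrow> (\<forall>i < length xs. aa s a (Suc i) = xs ! i)"

lemma strD: "str s a xs \<Longrightarrow> 1 \<le> i \<Longrightarrow> i \<le> length xs \<Longrightarrow> aa s a i = xs ! (i - 1)"
  by (cases i) (auto simp: str_def)

text \<open>\<open>M\<close> bounds the array indices and, being below \<open>W\<close>, leaves room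
  for intermediate values. The factor 300 covers the multiplication by 256 in
  \<open>choose_k\<close>, powers up to \<open>16 * 16 ^ k\<close> in \<open>set_masks\<close>, and
  code tables of at most \<open>16 * (n + 1)\<close> entries. The \<open>3 * n + 2\<close> raw cells
  hold the input and finally the output.\<close>

locale sized = bounds W M Z for W M Z :: nat +
  fixes n r :: nat
  assumes rn: "r \<le> n" and nM: "300 * (n + 1) \<le> M" and MW: "M < W" and nZ: "3 * n + 2 \<le> Z"
begin

definition copy_strings :: com where
  "copy_strings = WHILE BLt (V vi) (V vn) DO (
     Write aA (V vi \<oplus> N 1) (Arr 0 (V vi \<oplus> N 2));;
     Write aB (V vi \<oplus> N 1) (Arr 0 (V vi \<oplus> V vn \<oplus> N 2));;
     Write aAr (V vn \<ominus> V vi) (Arr 0 (V vi \<oplus> N 2));;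
     Write aBr (V vn \<ominus> V vi) (Arr 0 (V vi \<oplus> V vn \<oplus> N 2));;
     vi ::= V vi \<oplus> N 1)"

lemma copy_strings_wp:
  assumes "length A = n" "length B = n" "vv s vn = n" "vv s vi = 0"
    and A: "\<And>i. i < n \<Longrightarrow> aa s 0 (i + 2) = A ! i"
    and B: "\<And>i. i < n \<Longrightarrow> aa s 0 (i + n + 2) = B ! i"
  shows "wp copy_strings (\<lambda>t. str t aA A \<and> str t aB B \<and> str t aAr (rev A) \<and> str t aBr (rev B) \<and>
    clk t \<le> clk s + 6 * n + 1) s"
  unfolding copy_strings_def
proof (rule wp_While[where T = "clk s + 6 * n" and I = "\<lambda>t. vv t vi \<le> n \<and>
    (\<forall>i < vv t vi. aa t aA (Suc i) = A ! i \<and> aa t aB (Suc i) = B ! i \<and>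
       aa t aAr (n - i) = A ! i \<and> aa t aBr (n - i) = B ! i) \<and>
    clk t \<le> clk s + 6 * vv t vi"], goal_cases)
  case (2 t)
  note fr = frame_vv[OF 2(2)] frame_aa[OF 2(2)]
  show ?case using 2(1) by auto
next
  case (3 t)
  note fr = frame_vv[OF 3(2)] frame_aa[OF 3(2)]
  show ?case using 3(1,3) assms nM MW nZ
    by (auto simp: wp_simps fr idx_ok_def narr_def less_Suc_eq)
next
  case (4 t)
  note fr = frame_vv[OF 4(2)] frame_aa[OF 4(2)]
  have i: "vv t vi = n" using 4(1,3) assms by (simp add: fr)
  have "aa t aAr (Suc i) = rev A ! i" "aa t aBr (Suc i) = rev B ! i" if "i < n" for i
    using 4(1) that assms unfolding i
    by (auto simp: rev_nth dest!: spec[of _ "n - Suc i"])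
  then show ?case using 4(1) assms by (auto simp: str_def i)
qed (use assms in auto)

lemma mv_copy_strings [simp]: "mv copy_strings = {20}" "ma copy_strings = {2,3,4,5}"
  by (auto simp: copy_strings_def)

definition copy_pattern :: com where
  "copy_pattern = WHILE BLt (V vi) (V vr) DO (
     Write aP (V vi) (Arr 0 (V vi \<oplus> V vn \<oplus> V vn \<oplus> N 2));;
     Write aQ (V vi) (Arr 0 (V vi \<oplus> V vn \<oplus> V vn \<oplus> N 2));;
     vi ::= V vi \<oplus> N 1)"

lemma copy_pattern_wp:
  assumes "vv s vn = n" "vv s vr = r" "vv s vi = 0"
    and P: "\<And>i. i < r \<Longrightarrow> aa s 0 (i + n + n + 2) = P ! i"
  shows "wp copy_pattern (\<lambda>t. (\<forall>i < r. aa t aP i = P ! i \<and> aa t aQ i = P ! i) \<and>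
    clk t \<le> clk s + 4 * r + 1) s"
  unfolding copy_pattern_def
proof (rule wp_While[where T = "clk s + 4 * r" and I = "\<lambda>t. vv t vi \<le> r \<and>
    (\<forall>i < vv t vi. aa t aP i = P ! i \<and> aa t aQ i = P ! i) \<and>
    clk t \<le> clk s + 4 * vv t vi"], goal_cases)
  case (2 t)
  show ?case using 2(1) by auto
next
  case (3 t)
  note fr = frame_vv[OF 3(2)] frame_aa[OF 3(2)]
  show ?case using 3(1,3) assms nM MW nZ rn
    by (auto simp: wp_simps fr idx_ok_def narr_def less_Suc_eq)
next
  case (4 t)
  note fr = frame_vv[OF 4(2)] frame_aa[OF 4(2)]
  show ?case using 4(1,3) assms by (simp add: fr)
qed (use assms in auto)

lemma mv_copy_pattern [simp]: "mv copy_pattern = {20}" "ma copy_pattern = {6,7}"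
  by (auto simp: copy_pattern_def)

definition read_input :: com where
  "read_input = vn ::= Arr 0 (N 0);; vr ::= Arr 0 (N 1);; vi ::= N 0;; copy_strings;;
     vi ::= N 0;; copy_pattern"

lemma read_input_wp:
  assumes "length A = n" "length B = n" "length P = r"
    and mem: "\<And>i. i < 2 * n + r + 2 \<Longrightarrow> aa s 0 i = input_words A B P ! i"
  shows "wp read_input (\<lambda>t. vv t vn = n \<and> vv t vr = r \<and>
    str t aA A \<and> str t aB B \<and> str t aAr (rev A) \<and> str t aBr (rev B) \<and>
    (\<forall>i < r. aa t aP i = P ! i \<and> aa t aQ i = P ! i) \<and> clk t \<le> clk s + 10 * n + 6) s"
proof -
  have m: "aa s 0 0 = n" "aa s 0 1 = r" "\<And>i. i < n \<Longrightarrow> aa s 0 (i + 2) = A ! i"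
    "\<And>i. i < n \<Longrightarrow> aa s 0 (i + n + 2) = B ! i"
    "\<And>i. i < r \<Longrightarrow> aa s 0 (i + n + n + 2) = P ! i"
    using assms by (auto simp: input_words_def nth_append)
  have ok: "idx_ok 0 0" "idx_ok 0 (Suc 0)" "0 < W" "Suc 0 < W"
    using nM MW nZ by (auto simp: idx_ok_def narr_def)
  show ?thesis
    unfolding read_input_def
    apply (simp add: wp_simps m ok)
    apply (rule wp_conseq[OF copy_strings_wp[of A B]]; (use assms m in simp; fail)?)
    subgoal premises p for t
    proof -
      note fr = frame_vv[OF p(2)] frame_aa[OF p(2)]
      show ?thesis
        apply (simp add: wp_simps ok)
        apply (rule wp_conseq[OF copy_pattern_wp[of _ P]]; (use m in \<open>simp add: fr\<close>; fail)?)
        subgoal premises q for u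
          using p(1) q(1) frame_vv[OF q(2)] frame_aa[OF q(2)] rn m(2)[unfolded One_nat_def]
          by (simp add: fr m str_def)
        done
    qed
    done
qed

lemma mv_read_input [simp]: "mv read_input = {10, 11, 20}" "ma read_input = {2,3,4,5,6,7}"
  by (auto simp: read_input_def)

section \<open>The block length\<close>

definition choose_k :: com where
  "choose_k = vk ::= N 1;; vK ::= N 2;; vx ::= N 256;;
     WHILE BLe (V vx) (V vr) DO (vx ::= V vx \<otimes> N 256;; vk ::= V vk \<oplus> N 1;; vK ::= V vK \<otimes> N 2)"

text \<open>For positive \<open>r\<close> this is the number of digits in base 256, which lies
  between (log r)/8 and (log r)/8 + 1; for \<open>r = 0\<close> it is 1.\<close>

definition block_len :: "nat \<Rightarrow> bool" where
  "block_len k \<longleftrightarrow> 1 \<le> k \<and> r < 256 ^ k \<and> (k = 1 \<or> 256 ^ (k - 1) \<le> r)"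

lemma mv_choose_k [simp]: "mv choose_k = {12, 13, 26}" "ma choose_k = {}"
  by (auto simp: choose_k_def)

lemma choose_k_wp:
  assumes "vv s vr = r"
  shows "wp choose_k (\<lambda>t. block_len (vv t vk) \<and> vv t vK = 2 ^ vv t vk \<and>
    clk t \<le> clk s + 4 * r + 8) s"
proof -
  have ok: "256 < W" "2 < W" "Suc 0 < W" using nM MW by auto
  have pow: "2 ^ k \<le> r \<and> k < r" if "256 ^ k \<le> r" for k
  proof -
    have "(2::nat) ^ k \<le> 256 ^ k" by (rule power_mono) auto
    then show ?thesis using that less_exp[of k] by linarith
  qed
  show ?thesis
    unfolding choose_k_def
    apply (simp add: wp_simps ok)
    apply (rule wp_While[where T = "clk s + 4 * r + 7" and I = "\<lambda>t. 1 \<le> vv t vk \<and>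
       vv t vx = 256 ^ vv t vk \<and> vv t vK = 2 ^ vv t vk \<and>
       (vv t vk = 1 \<or> 256 ^ (vv t vk - 1) \<le> r) \<and> clk t + 1 \<le> clk s + 4 * vv t vk"])
       apply simp
    subgoal premises p for t
      using p(1) pow[of "vv t vk - 1"] by auto
    subgoal premises p for t
    proof -
      note fr = frame_vv[OF p(2)]
      have r: "vv t vx \<le> r" using p(3) by (simp add: fr assms)
      then have "256 ^ vv t vk \<le> r" using p(1) by simp
      note q = this pow[OF this]
      have "vv t vx * 256 < W" "vv t vk + 1 < W" "vv t vK * 2 < W"
        using r q p(1) nM MW rn by auto
      then show ?thesis using p(1) q ok by (auto simp: wp_simps)
    qed
    subgoal premises p for t
    proof -
      note fr = frame_vv[OF p(2)]
      show ?thesis using p(1,3) pow[of "vv t vk - 1"]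
        by (auto simp: block_len_def fr assms not_le)
    qed
    done
qed

section \<open>A dictionary for the pattern characters\<close>

definition sort_insert :: com where
  "sort_insert = WHILE BAnd (BLt (V vg) (V vj)) (BLt (Arr aQ (V vj)) (Arr aQ (V vj \<ominus> N 1))) DO (
     vt ::= Arr aQ (V vj);; Write aQ (V vj) (Arr aQ (V vj \<ominus> N 1));;
     Write aQ (V vj \<ominus> N 1) (V vt);; vj ::= V vj \<ominus> N 1)"

text \<open>Only elements of the same group of \<open>m\<close> consecutive cells are compared, so that insertion sort
  takes \<open>O(r m)\<close> steps.\<close>

definition sort_groups :: com where
  "sort_groups = vm ::= V vk \<otimes> V vk;; vg ::= N 0;; vp ::= N 0;;
    WHILE BLt (V vp) (V vr) DO (
      (IF BEq (V vp) (V vg \<oplus> V vm) THEN vg ::= V vp ELSE SKIP);;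
      vj ::= V vp;; sort_insert;; vp ::= V vp \<oplus> N 1)"

lemma mv_sort_insert [simp]: "mv sort_insert = {21, 25}" "ma sort_insert = {7}"
  by (auto simp: sort_insert_def)

lemma mv_sort_groups [simp]: "mv sort_groups = {21, 22, 23, 24, 25}" "ma sort_groups = {7}"
  by (auto simp: sort_groups_def)

definition sorted_groups :: "nat \<Rightarrow> (nat \<Rightarrow> nat) \<Rightarrow> nat \<Rightarrow> bool" where
  "sorted_groups m Q p \<longleftrightarrow> (\<forall>a b. a < b \<longrightarrow> b < p \<longrightarrow> a div m = b div m \<longrightarrow> Q a \<le> Q b)"

lemma swap_image: "i \<in> A \<Longrightarrow> j \<in> A \<Longrightarrow> (f(i := f j, j := f i)) ` A = f ` A"
  by (auto simp: image_iff)

lemma sort_insert_wp: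
  assumes "vv s vg = g" "vv s vj = p" "g \<le> p" "p < g + m" "p < r" "m dvd g"
    and sorted: "sorted_groups m (aa s aQ) p"
  shows "wp sort_insert (\<lambda>t. sorted_groups m (aa t aQ) (Suc p) \<and>
    aa t aQ ` {..<r} = aa s aQ ` {..<r} \<and> clk t \<le> clk s + 5 * m + 1) s"
  unfolding sort_insert_def
\<comment> \<open>The element on the move, at \<open>vj\<close>, is exempt only as the
  larger-indexed partner of a comparison: towards the right of its group the order already
  holds.\<close>
proof (rule wp_While[where T = "clk s + 5 * m" and I = "\<lambda>t. g \<le> vv t vj \<and> vv t vj \<le> p \<and>
    (\<forall>a b. a < b \<longrightarrow> b \<le> p \<longrightarrow> a div m = b div m \<longrightarrow> b \<noteq> vv t vj \<longrightarrow> aa t aQ a \<le> aa t aQ b) \<and>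
    aa t aQ ` {..<r} = aa s aQ ` {..<r} \<and> clk t + 5 * vv t vj \<le> clk s + 5 * p"], goal_cases)
  case 1
  then show ?case using assms by (auto simp: sorted_groups_def le_less)
next
  case (2 t)
  then show ?case using assms nM MW rn
    by (auto simp: idx_ok_def narr_def)
next
  case (3 t)
  note fr = frame_vv[OF 3(2)]
  let ?j = "vv t vj" and ?Q = "aa t aQ"
  let ?Q' = "?Q(?j := ?Q (?j - 1), ?j - 1 := ?Q ?j)"
  have j: "g < ?j" "?Q ?j < ?Q (?j - 1)" "?j \<le> p"
    using 3(1,3) assms by (auto simp: fr)
  have I: "\<And>a b. a < b \<Longrightarrow> b \<le> p \<Longrightarrow> a div m = b div m \<Longrightarrow> b \<noteq> ?j \<Longrightarrow> ?Q a \<le> ?Q b"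
    using 3(1) by blast
  have dj: "x div m = g div m" if "g \<le> x" "x \<le> p" for x
  proof -
    obtain c where c: "g = m * c" using assms(6) by blast
    have "m > 0" using assms(3,4) by auto
    then show ?thesis using that c assms(4) by (intro div_nat_eqI) (auto simp: mult.commute)
  qed
  have "?Q' a \<le> ?Q' b" if "a < b" "b \<le> p" "a div m = b div m" "b \<noteq> ?j - 1" for a b
  proof (cases "b = ?j")
    case True
    then show ?thesis
      using that j I[of a "?j - 1"] dj[of ?j] dj[of "?j - 1"] by auto
  next
    case False
    then show ?thesis
      using that j I[of a b] I[of ?j b] I[of "?j - 1" b] dj[of ?j] dj[of "?j - 1"] by auto
  qed
  moreover have "?Q' ` {..<r} = ?Q ` {..<r}"
    using j assms(5) by (intro swap_image) auto
  ultimately show ?case using 3(1) j nM MW rn assms(5)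
    by (auto simp: wp_simps idx_ok_def narr_def)
next
  case (4 t)
  note fr = frame_vv[OF 4(2)]
  let ?j = "vv t vj" and ?Q = "aa t aQ"
  have I: "\<And>a b. a < b \<Longrightarrow> b \<le> p \<Longrightarrow> a div m = b div m \<Longrightarrow> b \<noteq> ?j \<Longrightarrow> ?Q a \<le> ?Q b"
    using 4(1) by blast
  have j: "g \<le> ?j" "?j \<le> p" "g = ?j \<or> ?Q (?j - 1) \<le> ?Q ?j"
    using 4(1,3) assms by (auto simp: fr)
  obtain c where c: "g = m * c" using assms(6) by blast
  have m: "m > 0" using assms(3,4) by auto
  have dj: "x div m = c" if "g \<le> x" "x \<le> p" for x
    using that c assms(4) m by (intro div_nat_eqI) (auto simp: mult.commute)
  have "?Q a \<le> ?Q b" if ab: "a < b" "b < Suc p" "a div m = b div m" for a b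
  proof (cases "b = ?j")
    case True
    have "a div m = c" using ab dj[of b] j True by auto
    then have "g \<le> a" using c m by (metis div_times_less_eq_dividend mult.commute)
    then have "?Q (?j - 1) \<le> ?Q ?j" "a \<le> ?j - 1" "(?j - 1) div m = c"
      using True ab j dj[of "?j - 1"] by auto
    moreover have "?Q a \<le> ?Q (?j - 1)" if "a \<noteq> ?j - 1"
    proof (rule I)
      show "a < ?j - 1" "?j - 1 \<le> p" "?j - 1 \<noteq> ?j" using that True ab j by auto
      show "a div m = (?j - 1) div m" using calculation \<open>a div m = c\<close> by simp
    qed
    ultimately show ?thesis using True by (cases "a = ?j - 1") auto
  qed (use ab I in auto)
  then have "sorted_groups m ?Q (Suc p)" by (auto simp: sorted_groups_def)
  then show ?case using 4(1) assms(3,4) by auto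
qed

lemma sort_groups_wp:
  assumes "vv s vr = r" "vv s vk = k" "1 \<le> k" "k * k \<le> r + 1"
  shows "wp sort_groups (\<lambda>t. vv t vm = k * k \<and> sorted_groups (k * k) (aa t aQ) r \<and>
    aa t aQ ` {..<r} = aa s aQ ` {..<r} \<and> clk t \<le> clk s + r * (5 * (k * k) + 7) + 4) s"
proof -
  let ?m = "k * k"
  have ok: "?m < W" "0 < W" "0 < ?m" using assms nM MW rn by auto
  show ?thesis
    unfolding sort_groups_def
    apply (simp add: wp_simps ok assms)
    apply (rule wp_While[where T = "clk s + r * (5 * ?m + 7) + 3" and I = "\<lambda>t.
       vv t vp \<le> r \<and> ?m dvd vv t vg \<and> vv t vg \<le> vv t vp \<and> vv t vp \<le> vv t vg + ?m \<and>
       sorted_groups ?m (aa t aQ) (vv t vp) \<and> aa t aQ ` {..<r} = aa s aQ ` {..<r} \<and>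
       clk t \<le> clk s + vv t vp * (5 * ?m + 7) + 3"])
       apply (simp add: sorted_groups_def)
    subgoal premises p for t
    proof -
      have "vv t vp * (5 * ?m + 7) \<le> r * (5 * ?m + 7)" using p(1) by (intro mult_le_mono1) auto
      then show ?thesis using p(1) by (intro conjI) (simp, linarith)
    qed
    subgoal premises p for t
    proof -
      note fr = frame_vv[OF p(2)]
      have v: "vv t vp < r" "vv t vm = ?m" using p(3) by (simp_all add: fr assms)
      have ok': "vv t vg + ?m < W" "Suc 0 < W" "Suc (vv t vp) < W" using p(1) v assms nM MW rn by auto
      define g where "g = (if vv t vp = vv t vg + ?m then vv t vp else vv t vg)"
      have g: "?m dvd g" "g \<le> vv t vp" "vv t vp < g + ?m"
        using p(1) ok(3) by (auto simp: g_def)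
      show ?thesis
      proof (rule wp_SeqI[where P = "\<lambda>u. vv u vg = g \<and> clk u \<le> clk t + 3"], goal_cases)
        case 1
        then show ?case using ok' by (auto simp: wp_simps fr v g_def)
      next
        case (2 u)
        note fr' = frame_vv[OF 2(2)] frame_aa[OF 2(2)]
        show ?case
          apply (simp add: wp_simps)
          apply (rule wp_conseq[OF sort_insert_wp[of _ g "vv t vp" ?m]];
              (use 2(1) g v p(1) in \<open>simp add: fr'\<close>; fail)?)
          subgoal premises q for x
            using q(1) 2(1) p(1) v g ok' frame_vv[OF q(2)]
            by (simp add: wp_simps fr' algebra_simps)
          done
      qed
    qed
    subgoal premises p for t
    proof -
      note fr = frame_vv[OF p(2)]
      have "vv t vp = r" "vv t vm = ?m" using p(1,3) by (simp_all add: fr assms)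
      then show ?thesis using p(1) by simp
    qed
    done
qed

section \<open>Searching the dictionary\<close>

definition jump_chunks :: com where
  "jump_chunks = WHILE BAnd (BLe (V vp \<oplus> V vk) (V vh)) (BLt (Arr aQ (V vp \<oplus> V vk \<ominus> N 1)) (V vx)) DO
     vp ::= V vp \<oplus> V vk"

definition scan_chunk :: com where
  "scan_chunk = WHILE BAnd (BLt (V vp) (V ve)) (BNe (Arr aQ (V vp)) (V vx)) DO vp ::= V vp \<oplus> N 1"

text \<open>A sorted group of \<open>k * k\<close> cells is searched in O(k) steps: at most
  \<open>k\<close> jumps over chunks whose last entry is too small, then a scan of a single chunk.
  This group size balances r k^2 steps of sorting against about r/k steps per lookup.\<close>

definition search_group :: com where
  "search_group =
     vh ::= V vg \<oplus> V vm;; (IF BLt (V vr) (V vh) THEN vh ::= V vr ELSE SKIP);;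
     vp ::= V vg;; jump_chunks;;
     ve ::= V vp \<oplus> V vk;; (IF BLt (V vh) (V ve) THEN ve ::= V vh ELSE SKIP);;
     scan_chunk;;
     (IF BLt (V vp) (V ve) THEN vf ::= V vp ELSE SKIP);;
     vg ::= V vg \<oplus> V vm"

definition search :: com where
  "search = vf ::= V vr;; vg ::= N 0;;
     WHILE BAnd (BLt (V vg) (V vr)) (BEq (V vf) (V vr)) DO search_group"

definition lookup :: "nat \<Rightarrow> nat \<Rightarrow> exp \<Rightarrow> exp \<Rightarrow> com" where
  "lookup src dst lo hi = vi ::= lo;;
     WHILE BLt (V vi) hi DO (vx ::= Arr src (V vi);; search;; Write dst (V vi) (V vf);; vi ::= V vi \<oplus> N 1)"

lemma mv_lookup [simp]: "mv jump_chunks = {24}" "ma jump_chunks = {}" "mv scan_chunk = {24}" "ma scan_chunk = {}"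
  "mv search_group = {23, 24, 27, 28, 29}" "ma search_group = {}"
  "mv search = {23, 24, 27, 28, 29}" "ma search = {}"
  "mv (lookup src dst lo hi) = {20, 23, 24, 26, 27, 28, 29}" "ma (lookup src dst lo hi) = {dst}"
  by (auto simp: jump_chunks_def scan_chunk_def search_group_def search_def lookup_def)

text \<open>What remains is one chunk of \<open>k\<close> cells. The exception for a chunk ending in
  \<open>x\<close> itself is needed because equal entries may continue beyond it; in that case the
  scan of the chunk finds one anyway.\<close>

lemma jump_chunks_wp:
  assumes v: "vv s vk = k" "vv s vh = h" "vv s vx = x" "vv s vp = g"
    and h: "h \<le> r" "h \<le> g + k * k" "g \<le> h" and k: "1 \<le> k" "k \<le> r + 1"
    and s: "\<And>a b. g \<le> a \<Longrightarrow> a \<le> b \<Longrightarrow> b < h \<Longrightarrow> aa s aQ a \<le> aa s aQ b"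
  shows "wp jump_chunks (\<lambda>t. g \<le> vv t vp \<and> vv t vp \<le> h \<and>
    (\<forall>a. g \<le> a \<longrightarrow> a < vv t vp \<longrightarrow> aa s aQ a \<noteq> x) \<and>
    (\<forall>a. vv t vp + k \<le> a \<longrightarrow> a < h \<longrightarrow> aa s aQ (vv t vp + k - 1) \<noteq> x \<longrightarrow> aa s aQ a \<noteq> x) \<and>
    clk t \<le> clk s + 2 * k + 1) s"
  unfolding jump_chunks_def
proof (rule wp_While[where T = "clk s + 2 * k" and I = "\<lambda>t. vv t vp \<le> h \<and>
    (\<forall>a. g \<le> a \<longrightarrow> a < vv t vp \<longrightarrow> aa s aQ a < x) \<and>
    (\<exists>u \<le> k. vv t vp = g + k * u \<and> clk t \<le> clk s + 2 * u)"], goal_cases)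
  case 1
  then show ?case using v h by auto
next
  case (2 t)
  note fr = frame_vv[OF 2(2)]
  show ?case
    using 2(1) v h k nM MW rn by (auto simp: idx_ok_def narr_def fr)
next
  case (3 t)
  note fr = frame_vv[OF 3(2)] frame_aa[OF 3(2)]
  obtain u where u: "u \<le> k" "vv t vp = g + k * u" "clk t \<le> clk s + 2 * u"
    using 3(1) by blast
  have c: "vv t vp + k \<le> h" "aa s aQ (vv t vp + k - 1) < x"
    using 3(3) v by (auto simp: fr)
  \<comment> \<open>The next jump still ends inside the group of \<open>k * k\<close> cells, so at
    most \<open>k\<close> jumps are possible whatever the entries are.\<close>
  have "k * (u + 1) \<le> k * k" using c h(2) u(2) by (simp add: algebra_simps)
  then have u': "u + 1 \<le> k" using k by (metis mult_le_cancel1 less_le_trans zero_less_one)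
  have "aa s aQ a < x" if "g \<le> a" "a < vv t vp + k" for a
  proof -
    have "a \<le> vv t vp + k - 1" "vv t vp + k - 1 < h" using that c k by linarith+
    then show ?thesis using s[of a "vv t vp + k - 1"] that c by simp
  qed
  then show ?case
    using c u u' h k nM MW rn v(1) by (auto simp: wp_simps fr intro!: exI[of _ "u + 1"])
next
  case (4 t)
  note fr = frame_vv[OF 4(2)] frame_aa[OF 4(2)]
  have c: "h < vv t vp + k \<or> x \<le> aa s aQ (vv t vp + k - 1)"
    using 4(3) v by (auto simp: fr)
  have "x < aa s aQ a" if a: "vv t vp + k \<le> a" "a < h" "aa s aQ (vv t vp + k - 1) \<noteq> x" for a
  proof -
    have "aa s aQ (vv t vp + k - 1) \<le> aa s aQ a"
      using 4(1) a k by (intro s) auto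
    then show ?thesis using c a by auto
  qed
  then show ?case using 4(1) by fastforce
qed

lemma scan_chunk_wp:
  assumes v: "vv s ve = e" "vv s vx = x" "vv s vp = p" and e: "p \<le> e" "e \<le> p + k" "e \<le> r"
  shows "wp scan_chunk (\<lambda>t. p \<le> vv t vp \<and> vv t vp \<le> e \<and>
    (\<forall>a. p \<le> a \<longrightarrow> a < vv t vp \<longrightarrow> aa s aQ a \<noteq> x) \<and> (vv t vp < e \<longrightarrow> aa s aQ (vv t vp) = x) \<and>
    clk t \<le> clk s + 2 * k + 1) s"
  unfolding scan_chunk_def
proof (rule wp_While[where T = "clk s + 2 * k" and I = "\<lambda>t. p \<le> vv t vp \<and> vv t vp \<le> e \<and>
    (\<forall>a. p \<le> a \<longrightarrow> a < vv t vp \<longrightarrow> aa s aQ a \<noteq> x) \<and> clk t + 2 * p \<le> clk s + 2 * vv t vp"],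
    goal_cases)
  case (2 t)
  note fr = frame_vv[OF 2(2)]
  show ?case
    using 2(1) v e nM MW rn by (auto simp: idx_ok_def narr_def fr)
next
  case (3 t)
  note fr = frame_vv[OF 3(2)] frame_aa[OF 3(2)]
  show ?case using 3(1,3) v e nM MW rn by (auto simp: wp_simps fr less_Suc_eq)
next
  case (4 t)
  note fr = frame_vv[OF 4(2)] frame_aa[OF 4(2)]
  show ?case using 4(1,3) v e by (auto simp: fr)
qed (use v e in auto)

lemma search_group_wp:
  assumes v: "vv s vk = k" "vv s vm = k * k" "vv s vr = r" "vv s vx = x" "vv s vf = r" "vv s vg = g"
    and k: "1 \<le> k" "k * k \<le> r + 1" and g: "g < r" "k * k dvd g"
    and sorted: "sorted_groups (k * k) (aa s aQ) r"
  shows "wp search_group (\<lambda>t. vv t vg = g + k * k \<and>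
    (if vv t vf = r then \<forall>a. g \<le> a \<longrightarrow> a < g + k * k \<longrightarrow> a < r \<longrightarrow> aa s aQ a \<noteq> x
     else g \<le> vv t vf \<and> vv t vf < r \<and> aa s aQ (vv t vf) = x \<and>
       (\<forall>a. g \<le> a \<longrightarrow> a < vv t vf \<longrightarrow> aa s aQ a \<noteq> x)) \<and>
    clk t \<le> clk s + 4 * k + 13) s"
proof -
  define h where "h = min (g + k * k) r"
  have "k \<le> k * k" using k by simp
  then have kr: "k \<le> r + 1" using k by linarith
  have ok: "g + k * k < W" "0 < W" "Suc 0 < W" using g k nM MW rn by auto
  have h: "h \<le> r" "h \<le> g + k * k" "g \<le> h" using g by (auto simp: h_def)
  have srt: "aa s aQ a \<le> aa s aQ b" if ab: "g \<le> a" "a \<le> b" "b < h" for a b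
  proof (cases "a = b")
    case False
    obtain c where c: "g = (k * k) * c" using g(2) by blast
    have "x div (k * k) = c" if "g \<le> x" "x < g + k * k" for x
      using that c k by (intro div_nat_eqI) (auto simp: mult.commute)
    then have "a div (k * k) = b div (k * k)" using ab h by auto
    then show ?thesis using sorted ab h False unfolding sorted_groups_def by auto
  qed simp
  show ?thesis
    unfolding search_group_def
  proof (subst wp_Seq, subst wp_Assign, intro conjI, goal_cases)
    case 2
    let ?s1 = "s\<lparr>vv := (vv s)(vh := ev (V vg \<oplus> V vm) s), clk := clk s + 1\<rparr>"
    show ?case
    proof (rule wp_SeqI[where P = "\<lambda>t. vv t vh = h \<and> clk t \<le> clk s + 3"], goal_cases)
      case 1
      then show ?case using v by (auto simp: wp_simps h_def)
    next
      case (2 t)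
      note ft = frame_vv[OF 2(2)] frame_aa[OF 2(2)]
      show ?case
        apply (simp add: wp_simps)
        apply (rule wp_conseq[OF jump_chunks_wp[of _ k h x g]];
            (use v h k kr 2(1) srt in \<open>simp add: ft\<close>; fail)?)
        subgoal premises q for u
        proof -
          note fu = frame_vv[OF q(2)] frame_aa[OF q(2)]
          have q1: "g \<le> vv u vp" "vv u vp \<le> h" "clk u \<le> clk s + 2 * k + 5"
            "\<And>a. g \<le> a \<Longrightarrow> a < vv u vp \<Longrightarrow> aa s aQ a \<noteq> x"
            "\<And>a. vv u vp + k \<le> a \<Longrightarrow> a < h \<Longrightarrow> aa s aQ (vv u vp + k - 1) \<noteq> x \<Longrightarrow> aa s aQ a \<noteq> x"
            using q(1) 2(1) by (auto simp: ft)
          define e where "e = min (vv u vp + k) h"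
          have e: "vv u vp \<le> e" "e \<le> vv u vp + k" "e \<le> r" using q1 h by (auto simp: e_def)
          have ok': "vv u vp + k < W" using q1(2) h(1) kr nM MW rn by auto
          show ?thesis
            apply (simp add: wp_Seq wp_Assign fu ft v ok')
            apply (rule wp_conseq[where P = "\<lambda>t. vv t ve = e \<and> clk t \<le> clk u + 3"])
             apply (use 2(1) in \<open>simp add: wp_simps fu ft v e_def\<close>; fail)
            subgoal premises w for t'
            proof -
              note fw = frame_vv[OF w(2)] frame_aa[OF w(2)]
              show ?thesis
                apply (simp add: wp_Seq)
                apply (rule wp_conseq[OF scan_chunk_wp[of _ e x "vv u vp" k]];
                    (use w(1) e v in \<open>simp add: fw fu ft\<close>; fail)?)
                subgoal premises z for x'
                proof -
                  note fz = frame_vv[OF z(2)] frame_aa[OF z(2)]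
                  have z1: "vv u vp \<le> vv x' vp" "vv x' vp \<le> e" "clk x' \<le> clk s + 4 * k + 9"
                    "\<And>a. vv u vp \<le> a \<Longrightarrow> a < vv x' vp \<Longrightarrow> aa s aQ a \<noteq> x"
                    "vv x' vp < e \<Longrightarrow> aa s aQ (vv x' vp) = x"
                    using z(1) w(1) q1(3) by (auto simp: fw fu ft)
                  have A: "aa s aQ a \<noteq> x" if "g \<le> a" "a < vv x' vp" for a
                    using q1(4)[of a] z1(4)[of a] that by (cases "a < vv u vp") auto
                  \<comment> \<open>A scan that reaches the end of a full chunk has seen its last
                    entry differ from \<open>x\<close>, which closes the exception left open by the
                    jumps.\<close>
                  have B: "aa s aQ a \<noteq> x" if "vv x' vp = e" "g \<le> a" "a < h" for a
                    using A[of a] A[of "vv u vp + k - 1"] q1(1) q1(5)[of a] that k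
                    by (cases "a < e") (auto simp: e_def min_def split: if_splits)
                  show ?thesis
                    using A B z1 e h ok v w(1) q1(1)
                    by (auto simp: wp_simps fz fw fu ft h_def)
                qed
                done
            qed
            done
        qed
        done
    qed
  qed (use v ok in simp)
qed

text \<open>The dictionary is sorted only within groups and may repeat a character; taking the least
  position makes the identifier canonical. All characters foreign to the pattern share the
  identifier \<open>r\<close>.\<close>

definition idf :: "(nat \<Rightarrow> nat) \<Rightarrow> nat \<Rightarrow> nat" where
  "idf Q x = (if \<exists>p < r. Q p = x then LEAST p. Q p = x else r)"

lemma idf_eqI:
  assumes "p < r" "Q p = x" "\<And>a. a < p \<Longrightarrow> Q a \<noteq> x"
  shows "idf Q x = p"
  using assms unfolding idf_def by (auto intro!: Least_equality simp: not_less[symmetric])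

definition search_time :: "nat \<Rightarrow> nat" where
  "search_time k = (r div (k * k) + 1) * (4 * k + 14) + 3"

lemma search_wp:
  assumes v: "vv s vk = k" "vv s vm = k * k" "vv s vr = r" "vv s vx = x"
    and k: "1 \<le> k" "k * k \<le> r + 1"
    and sorted: "sorted_groups (k * k) (aa s aQ) r"
  shows "wp search (\<lambda>t. vv t vf = idf (aa s aQ) x \<and> clk t \<le> clk s + search_time k) s"
proof -
  have ok: "0 < W" using nM MW by auto
  have km: "0 < k * k" using k by simp
  show ?thesis
    unfolding search_def
    apply (simp add: wp_simps ok v)
    \<comment> \<open>\<open>u\<close> counts the groups visited, and \<open>vf = r\<close> records
      that none of them contains \<open>x\<close>. Groups are visited in order and each yields its
      least hit, so the first hit is the least overall.\<close>
    apply (rule wp_While[where T = "clk s + (r div (k * k) + 1) * (4 * k + 14) + 2" and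
       I = "\<lambda>t. (\<exists>u. vv t vg = k * k * u \<and> u \<le> r div (k * k) + 1 \<and> clk t \<le> clk s + u * (4 * k + 14) + 2) \<and>
         (if vv t vf = r then \<forall>a < r. a < vv t vg \<longrightarrow> aa s aQ a \<noteq> x
          else vv t vf < r \<and> aa s aQ (vv t vf) = x \<and> (\<forall>a < vv t vf. aa s aQ a \<noteq> x))"])
    subgoal by (auto intro!: exI[of _ 0])
    subgoal premises p for t
    proof -
      obtain u where u: "u \<le> r div (k * k) + 1" "clk t \<le> clk s + u * (4 * k + 14) + 2"
        using p(1) by blast
      have "u * (4 * k + 14) \<le> (r div (k * k) + 1) * (4 * k + 14)" using u(1) by (intro mult_le_mono1)
      then show ?thesis using u(2) by (intro conjI) (simp, linarith)
    qed
    subgoal premises p for t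
    proof -
      note fr = frame_vv[OF p(2)] frame_aa[OF p(2)]
      obtain u where u: "vv t vg = k * k * u" "u \<le> r div (k * k) + 1" "clk t \<le> clk s + u * (4 * k + 14) + 2"
        using p(1) by blast
      have g: "vv t vg < r" "vv t vf = r" using p(3) by (simp_all add: fr v)
      have "u \<le> r div (k * k)" using g(1) km unfolding u(1)
        by (metis less_imp_le_nat div_le_mono nonzero_mult_div_cancel_left less_numeral_extra(3))
      then have u': "u + 1 \<le> r div (k * k) + 1" by simp
      have pre: "aa s aQ a \<noteq> x" if "a < vv t vg" for a using p(1) g that by simp
      show ?thesis
        apply (rule wp_conseq[OF search_group_wp[of _ k x "vv t vg"]];
            (use v k g u sorted in \<open>simp add: fr; fail\<close>)?)
        subgoal premises q for w
        proof -
          have 1: "vv w vg = k * k * (u + 1)" "clk w \<le> clk s + (u + 1) * (4 * k + 14) + 2"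
            using q(1) u by (auto simp: algebra_simps)
          have 2: "if vv w vf = r then \<forall>a < r. a < vv w vg \<longrightarrow> aa s aQ a \<noteq> x
            else vv w vf < r \<and> aa s aQ (vv w vf) = x \<and> (\<forall>a < vv w vf. aa s aQ a \<noteq> x)"
          proof -
            have "aa s aQ a \<noteq> x" if "a < vv w vg" "a < r" "vv w vf = r" for a
              using q(1) that pre[of a] by (cases "a < vv t vg") (auto simp: fr)
            moreover have "aa s aQ a \<noteq> x" if "a < vv w vf" "vv w vf \<noteq> r" for a
              using q(1) that pre[of a] by (cases "a < vv t vg") (auto simp: fr)
            ultimately show ?thesis using q(1) by (auto simp: fr)
          qed
          show ?thesis using 1 2 u' by blast
        qed
        done
    qed
    subgoal premises p for t
    proof -
      note fr = frame_vv[OF p(2)] frame_aa[OF p(2)]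
      obtain u where u: "u \<le> r div (k * k) + 1" "clk t \<le> clk s + u * (4 * k + 14) + 2"
        using p(1) by blast
      have "u * (4 * k + 14) \<le> (r div (k * k) + 1) * (4 * k + 14)" using u(1) by (intro mult_le_mono1)
      then have "clk t + 1 \<le> clk s + search_time k" using u(2) unfolding search_time_def by linarith
      moreover have "vv t vf = idf (aa s aQ) x"
      proof (cases "vv t vf = r")
        case True
        then have "\<not> (\<exists>a < r. aa s aQ a = x)" using p(1,3) by (auto simp: fr v not_less)
        then show ?thesis using True by (auto simp: idf_def)
      next
        case False
        then show ?thesis using p(1) by (intro idf_eqI[symmetric]) auto
      qed
      ultimately show ?thesis by simp
    qed
    done
qed

text \<open>The limit \<open>hi\<close> is an expression evaluated anew in every test; it is
  therefore required to be stable under everything that the loop may change.\<close>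

lemma lookup_wp:
  assumes v: "vv s vk = k" "vv s vm = k * k" "vv s vr = r" "ev lo s = l" "\<And>t. frame (lookup src dst lo hi) s t \<Longrightarrow> ev hi t = h \<and> safe hi t"
    and k: "1 \<le> k" "k * k \<le> r + 1" and lh: "l \<le> h" "h \<le> n + 1" "safe lo s"
    and d: "src \<noteq> 0" "dst \<noteq> 0" "src < narr" "dst < narr" "dst \<noteq> aQ" "dst \<noteq> src"
    and sorted: "sorted_groups (k * k) (aa s aQ) r"
  shows "wp (lookup src dst lo hi) (\<lambda>t. (\<forall>i. l \<le> i \<longrightarrow> i < h \<longrightarrow> aa t dst i = idf (aa s aQ) (aa s src i)) \<and>
    clk t \<le> clk s + (h - l) * (search_time k + 4) + 2) s"
proof -
  have ok: "Suc 0 < W" using nM MW by auto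
  show ?thesis
    unfolding lookup_def
    apply (simp add: wp_simps ok v lh)
    apply (rule wp_While[where T = "clk s + (h - l) * (search_time k + 4) + 1" and
       I = "\<lambda>t. l \<le> vv t vi \<and> vv t vi \<le> h \<and> (\<forall>i. l \<le> i \<longrightarrow> i < vv t vi \<longrightarrow> aa t dst i = idf (aa s aQ) (aa s src i)) \<and>
         clk t \<le> clk s + (vv t vi - l) * (search_time k + 4) + 1"])
    subgoal using lh by simp
    subgoal premises p for t
    proof -
      have "(vv t vi - l) * (search_time k + 4) \<le> (h - l) * (search_time k + 4)" using p(1) by (intro mult_le_mono1) auto
      moreover have "frame (lookup src dst lo hi) s t" using p(2) by (auto simp: frame_def)
      ultimately show ?thesis using p(1) v(5)[of t] by (intro conjI) (simp, linarith)
    qed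
    subgoal premises p for t
    proof -
      note fr = frame_vv[OF p(2)] frame_aa[OF p(2)]
      have "frame (lookup src dst lo hi) s t" using p(2) by (auto simp: frame_def)
      then have i: "vv t vi < h" using p(3) v(5) by auto
      have ok': "idx_ok src (vv t vi)" "idx_ok dst (vv t vi)" "Suc (vv t vi) < W"
        using i lh d nM MW by (auto simp: idx_ok_def)
      show ?thesis
        apply (simp add: wp_simps ok' fr d)
        apply (rule wp_conseq[OF search_wp[of _ k "aa s src (vv t vi)"]];
            (use v k sorted d in \<open>simp add: fr; fail\<close>)?)
        subgoal premises q for w
        proof -
          note fq = frame_vv[OF q(2)] frame_aa[OF q(2)]
          have "Suc (vv t vi) - l = Suc (vv t vi - l)" using p(1) by (simp add: Suc_diff_le)
          then show ?thesis using q(1) p(1) i ok ok' d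
            by (auto simp: wp_simps fq fr less_Suc_eq)
        qed
        done
    qed
    subgoal premises p for t
    proof -
      have "frame (lookup src dst lo hi) s t" using p(2) by (auto simp: frame_def)
      then have i: "vv t vi = h" using p(1,3) v(5) by auto
      show ?thesis using p(1) i by auto
    qed
    done
qed

end

section \<open>Monotone state codes\<close>

text \<open>A block of the pattern is tracked by the ages of its windows, which increase weakly with the
  position. Adding the position makes them strictly increasing, so that the whole state is a set of
  bit positions.\<close>

definition code :: "nat list \<Rightarrow> nat" where
  "code xs = sum_list (map (\<lambda>x. 2 ^ x) xs)"

lemma code_simps [simp]: "code [] = 0" "code (x # xs) = 2 ^ x + code xs"
  by (simp_all add: code_def)

lemma code_0_iff [simp]: "code xs = 0 \<longleftrightarrow> xs = []"
  by (cases xs) auto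

lemma code_pos_iff [simp]: "0 < code xs \<longleftrightarrow> xs \<noteq> []"
  using code_0_iff[of xs] by linarith

lemma code_snoc: "code (xs @ [x]) = code xs + 2 ^ x"
  by (simp add: code_def)

lemma code_shift:
  assumes "\<forall>x \<in> set xs. b < x"
  shows "code (map (\<lambda>x. x - b) xs) = 2 * code (map (\<lambda>x. x - Suc b) xs)"
  using assms
proof (induction xs)
  case (Cons x xs)
  then have "x - b = Suc (x - Suc b)" by auto
  then show ?case using Cons by simp
qed simp

text \<open>Decoding from the lowest bit: once the bits below \<open>b\<close> are consumed, parity
  tells whether the least remaining entry equals \<open>b\<close>.\<close>

lemma code_odd:
  assumes "sorted_wrt (<) xs" "\<forall>x \<in> set xs. b \<le> x" "odd (code (map (\<lambda>x. x - b) xs))"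
  obtains ys where "xs = b # ys" "\<forall>y \<in> set ys. Suc b \<le> y"
    "code (map (\<lambda>x. x - b) xs) div 2 = code (map (\<lambda>x. x - Suc b) ys)"
proof (cases xs)
  case Nil
  then show ?thesis using assms by simp
next
  case (Cons y ys)
  show ?thesis
  proof (cases "y = b")
    case True
    have *: "\<forall>y \<in> set ys. b < y" using assms Cons True by auto
    show ?thesis
      by (rule that[of ys]) (use * Cons True code_shift[OF *] in \<open>auto simp: Suc_le_eq\<close>)
  next
    case False
    then have "\<forall>x \<in> set xs. b < x" using assms Cons by fastforce
    then show ?thesis using assms(3) by (simp add: code_shift)
  qed
qed

lemma code_even:
  assumes "sorted_wrt (<) xs" "\<forall>x \<in> set xs. b \<le> x" "even (code (map (\<lambda>x. x - b) xs))"
  shows "\<forall>x \<in> set xs. Suc b \<le> x"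
    "code (map (\<lambda>x. x - b) xs) div 2 = code (map (\<lambda>x. x - Suc b) xs)"
proof -
  have *: "\<forall>x \<in> set xs. b < x"
  proof (cases xs)
    case (Cons y ys)
    have "y \<noteq> b"
    proof
      assume "y = b"
      then have "\<forall>x \<in> set ys. b < x" using assms Cons by auto
      then show False using assms(3) Cons \<open>y = b\<close> by (simp add: code_shift)
    qed
    then show ?thesis using assms Cons by fastforce
  qed simp
  then show "\<forall>x \<in> set xs. Suc b \<le> x" by auto
  show "code (map (\<lambda>x. x - b) xs) div 2 = code (map (\<lambda>x. x - Suc b) xs)"
    using * by (simp add: code_shift)
qed

lemma code_bounds:
  assumes "sorted_wrt (<) xs" "xs \<noteq> []"
  shows "2 ^ last xs \<le> code xs \<and> code xs < 2 ^ Suc (last xs)"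
  using assms
proof (induction xs rule: rev_induct)
  case (snoc x xs)
  show ?case
  proof (cases "xs = []")
    case False
    have "last xs < x" using snoc.prems False by (auto simp: sorted_wrt_append)
    then have "(2::nat) ^ Suc (last xs) \<le> 2 ^ x" by (intro power_increasing) auto
    then show ?thesis using snoc False by (simp add: code_snoc sorted_wrt_append)
  qed (simp add: code_snoc)
qed simp

text \<open>Entry \<open>p\<close> stands for an age plus \<open>p + 1\<close>. Without a match the
  age grows by one. With a match the window of the next shorter prefix is taken over, one step older
  and one position further, hence its entry plus 2. The initial \<open>u = 0\<close> of a block lets
  a new window enter with age 1.\<close>

fun stepl :: "nat \<Rightarrow> nat list \<Rightarrow> nat \<Rightarrow> nat list" where
  "stepl u [] m = []"
| "stepl u (x # xs) m = (if odd m then u + 2 else x + 1) # stepl x xs (m div 2)"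

lemma length_stepl [simp]: "length (stepl u xs m) = length xs"
  by (induction xs arbitrary: u m) auto

lemma nth_stepl:
  "p < length xs \<Longrightarrow> stepl u xs m ! p =
    (if odd (m div 2 ^ p) then (if p = 0 then u else xs ! (p - 1)) + 2 else xs ! p + 1)"
proof (induction xs arbitrary: u m p)
  case (Cons x xs)
  then show ?case by (cases p) (auto simp: div_mult2_eq nth_Cons')
qed simp

text \<open>Either way the new entry lies between the old predecessor plus 2 and its own old value
  plus 1. These ranges are disjoint and increase with the position.\<close>

lemma sorted_stepl:
  assumes "sorted_wrt (<) (u # xs)" shows "sorted_wrt (<) (stepl u xs m)"
  unfolding sorted_wrt_iff_nth_less
proof (intro allI impI)
  fix i j assume ij: "i < j" "j < length (stepl u xs m)"
  have ne: "xs \<noteq> []" using ij by auto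
  have s: "(u # xs) ! a < (u # xs) ! b" if "a < b" "b \<le> length xs" for a b
    using assms that unfolding sorted_wrt_iff_nth_less by auto
  have "stepl u xs m ! i \<le> xs ! i + 1"
    using ne ij s[of i "Suc i"] nth_stepl[of i xs u m] by (cases i) (auto split: if_splits)
  also have "\<dots> < xs ! (j - 1) + 2"
  proof (cases "i = j - 1")
    case False
    then have "Suc i < j" using ij by auto
    then show ?thesis using ij s[of "Suc i" j] by auto
  qed simp
  also have "\<dots> \<le> stepl u xs m ! j"
    using ne ij s[of j "Suc j"] nth_stepl[of j xs u m] by (cases j) auto
  finally show "stepl u xs m ! i < stepl u xs m ! j" .
qed

text \<open>The transition on codes; \<open>pb\<close> is the weight of the lowest bit of \<open>x\<close>, and \<open>pp\<close> the weight of the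
  previous bit that was set.\<close>

fun stepg :: "nat \<Rightarrow> nat \<Rightarrow> nat \<Rightarrow> nat \<Rightarrow> nat" where
  "stepg pb pp x m = (if x = 0 then 0
     else if even x then stepg (2 * pb) pp (x div 2) m
     else (if even m then 2 * pb else 4 * pp) + stepg (2 * pb) pb (x div 2) (m div 2))"

declare stepg.simps [simp del]

text \<open>The code is consumed bit by bit, the list and the mask entry by entry: a cleared bit
  changes only the weight, a set bit also uses up one mask bit. The code decreases in each call,
  which justifies the induction.\<close>

lemma stepg_code:
  "sorted_wrt (<) xs \<Longrightarrow> \<forall>x \<in> set xs. b \<le> x \<Longrightarrow>
   stepg (2 ^ b) (2 ^ u) (code (map (\<lambda>x. x - b) xs)) m = code (stepl u xs m)"
proof (induction "code (map (\<lambda>x. x - b) xs)" arbitrary: xs b u m rule: less_induct)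
  case less
  let ?c = "code (map (\<lambda>x. x - b) xs)"
  show ?case
  proof (cases "xs = []")
    case False
    then have c: "?c \<noteq> 0" by simp
    then have lt: "?c div 2 < ?c" by (intro div_less_dividend) auto
    show ?thesis
    proof (cases "even ?c")
      case True
      note e = code_even[OF less.prems True]
      have "stepg (2 ^ Suc b) (2 ^ u) (?c div 2) m = code (stepl u xs m)"
        unfolding e(2) by (rule less.hyps) (use lt e less.prems in auto)
      then show ?thesis using c True by (subst stepg.simps) simp
    next
      case odd: False
      obtain ys where ys: "xs = b # ys" "\<forall>y \<in> set ys. Suc b \<le> y"
        "?c div 2 = code (map (\<lambda>x. x - Suc b) ys)"
        using code_odd[OF less.prems odd] .
      have "stepg (2 ^ Suc b) (2 ^ b) (?c div 2) (m div 2) = code (stepl b ys (m div 2))"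
        unfolding ys(3) by (rule less.hyps) (use lt ys less.prems in auto)
      then show ?thesis using c odd ys(1) by (subst stepg.simps) simp
    qed
  qed (simp add: stepg.simps)
qed

text \<open>A set bit moves up by at most two positions, because \<open>pp\<close> never exceeds
  \<open>pb\<close>. This keeps all partial sums of a table entry within a word.\<close>

lemma stepg_le: "pp \<le> pb \<Longrightarrow> stepg pb pp x m \<le> 4 * pb * x"
proof (induction pb pp x m rule: stepg.induct)
  case (1 pb pp x m)
  have "x = 2 * (x div 2) + x mod 2" by simp
  then obtain y where y: "x = 2 * y \<or> x = 2 * y + 1" by (metis mod2_eq_if add_0_right)
  then show ?case
    using 1 by (subst stepg.simps) (auto simp: algebra_simps)
qed

context sized begin

section \<open>Tables for the transition and for the top bit of a code\<close>

definition table_entry :: com where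
  "table_entry = vb ::= N 1;; vp ::= N 1;; vf ::= N 0;;
    WHILE BNe (V vx) (N 0) DO (
      (IF BEq (Bin Mod (V vx) (N 2)) (N 0) THEN SKIP ELSE (
        (IF BEq (Bin Mod (V vm) (N 2)) (N 0) THEN vf ::= V vf \<oplus> V vb \<otimes> N 2
         ELSE vf ::= V vf \<oplus> V vp \<otimes> N 4);;
        vp ::= V vb;; vm ::= Bin Div (V vm) (N 2)));;
      vx ::= Bin Div (V vx) (N 2);; vb ::= V vb \<otimes> N 2)"

lemma mv_table_entry [simp]: "mv table_entry = {22, 24, 26, 27, 31}" "ma table_entry = {}"
  by (auto simp: table_entry_def)

lemma table_entry_wp:
  assumes v: "vv s vx = X" "vv s vm = m" and X: "X < 2 ^ e" "4 * X < W"
  shows "wp table_entry (\<lambda>t. vv t vf = stepg 1 1 X m \<and> clk t \<le> clk s + 8 * e + 4) s"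
proof -
  have ok: "Suc 0 < W" "2 < W" "4 < W" "0 < W" using nM MW by auto
  have tot: "stepg 1 1 X m \<le> 4 * X" using stepg_le[of 1 1 X m] by simp
  show ?thesis
    unfolding table_entry_def
    apply (simp add: wp_simps ok v)
    \<comment> \<open>The accumulator plus the value of the pending recursion is constant. After
      \<open>j\<close> rounds at most \<open>e - j\<close> bits are left, which bounds the number of
      rounds.\<close>
    apply (rule wp_While[where T = "clk s + 8 * e + 3" and I = "\<lambda>t.
        vv t vf + stepg (vv t vb) (vv t vp) (vv t vx) (vv t vm) = stepg 1 1 X m \<and>
        vv t vp \<le> vv t vb \<and> vv t vb * vv t vx \<le> X \<and>
        (\<exists>j \<le> e. vv t vb = 2 ^ j \<and> vv t vx < 2 ^ (e - j) \<and> clk t \<le> clk s + 8 * j + 3)"])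
    subgoal using X by (auto simp: v intro!: exI[of _ 0])
    subgoal using ok by auto
    subgoal premises p for t
    proof -
      obtain j where j: "j \<le> e" "vv t vb = 2 ^ j" "vv t vx < 2 ^ (e - j)" "clk t \<le> clk s + 8 * j + 3"
        using p(1) by blast
      have x: "vv t vx \<noteq> 0" using p(3) by simp
      have "j \<noteq> e"
      proof
        assume "j = e" then show False using j(3) x by simp
      qed
      then have j': "Suc j \<le> e" "e - j = Suc (e - Suc j)" using j(1) by auto
      have x2: "vv t vx div 2 < 2 ^ (e - Suc j)" using j(3) unfolding j'(2) by (simp add: less_mult_imp_div_less)
      have "vv t vb * 1 \<le> vv t vb * vv t vx" using x by (intro mult_le_mono2) simp
      moreover have "vv t vb * vv t vx \<le> X" using p(1) by blast
      ultimately have "vv t vb \<le> X" by linarith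
      then have b4: "vv t vb * 4 < W" "vv t vp * 4 < W" "vv t vb * 2 < W" using X(2) p(1) by auto
      have dx: "vv t vb * 2 * (vv t vx div 2) \<le> X"
      proof -
        have "vv t vb * 2 * (vv t vx div 2) \<le> vv t vb * vv t vx"
          by (simp add: mult.assoc)
        then show ?thesis using p(1) by linarith
      qed
      have s: "stepg (vv t vb) (vv t vp) (vv t vx) (vv t vm) =
          (if even (vv t vx) then stepg (2 * vv t vb) (vv t vp) (vv t vx div 2) (vv t vm)
          else (if even (vv t vm) then 2 * vv t vb else 4 * vv t vp) +
            stepg (2 * vv t vb) (vv t vb) (vv t vx div 2) (vv t vm div 2))"
        using x by (subst stepg.simps) simp
      have y: "vv t vf + (if even (vv t vx) then 0 else if even (vv t vm) then 2 * vv t vb else 4 * vv t vp) < W"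
        using p(1) s tot X(2) by (auto split: if_splits)
      have p': "vv t vf + stepg (vv t vb) (vv t vp) (vv t vx) (vv t vm) = stepg 1 1 X m" "vv t vp \<le> vv t vb"
        using p(1) by blast+
      consider "even (vv t vx)" | "odd (vv t vx)" "even (vv t vm)" | "odd (vv t vx)" "odd (vv t vm)" by blast
      then show ?thesis
      proof cases
        case 1
        then show ?thesis using p' s b4 dx ok
          by (simp add: wp_simps mult.commute) (intro exI[of _ "Suc j"], use j j' x2 in simp)
      next
        case 2
        have "vv t vf + (2 * vv t vb + stepg (2 * vv t vb) (vv t vb) (vv t vx div 2) (vv t vm div 2)) = stepg 1 1 X m"
          "vv t vf + 2 * vv t vb < W" using p' s y 2 by auto
        with 2 show ?thesis using b4 dx ok
          by (simp add: wp_simps mult.commute odd_iff_mod_2_eq_one) (intro exI[of _ "Suc j"], use j j' x2 in simp)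
      next
        case 3
        have "vv t vf + (4 * vv t vp + stepg (2 * vv t vb) (vv t vb) (vv t vx div 2) (vv t vm div 2)) = stepg 1 1 X m"
          "vv t vf + 4 * vv t vp < W" using p' s y 3 by auto
        with 3 show ?thesis using b4 dx ok
          by (simp add: wp_simps mult.commute odd_iff_mod_2_eq_one) (intro exI[of _ "Suc j"], use j j' x2 in simp)
      qed
    qed
    subgoal premises p for t
    proof -
      obtain j where j: "j \<le> e" "clk t \<le> clk s + 8 * j + 3"
        using p(1) by blast
      then show ?thesis using p(1,3) by (simp add: stepg.simps)
    qed
    done
qed

definition build_table :: com where
  "build_table = ve ::= V vK \<otimes> V vK \<otimes> V vK \<otimes> V vK;; vi ::= N 0;;
    WHILE BLt (V vi) (V ve) DO (
      vx ::= Bin Div (V vi) (V vK);; vm ::= Bin Mod (V vi) (V vK);; table_entry;;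
      Write aT (V vi) (V vf);; vi ::= V vi \<oplus> N 1)"

lemma mv_build_table [simp]: "mv build_table = {20, 22, 24, 26, 27, 29, 31}" "ma build_table = {11}"
  by (auto simp: build_table_def)

text \<open>State and mask are packed into one index. A state has at most \<open>3 * k\<close> bits
  before a step and a mask has \<open>k\<close>, whence \<open>16 ^ k\<close> entries.\<close>

definition step_table :: "nat \<Rightarrow> (nat \<Rightarrow> nat) \<Rightarrow> bool" where
  "step_table k T \<longleftrightarrow> (\<forall>X m. X < 2 ^ (3 * k) \<longrightarrow> m < 2 ^ k \<longrightarrow> T (X * 2 ^ k + m) = stepg 1 1 X m)"

lemma pow16: "(2::nat) ^ k * 2 ^ k * 2 ^ k * 2 ^ k = 16 ^ k"
proof -
  have "(16::nat) ^ k = (2 ^ 4) ^ k" by simp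
  also have "\<dots> = 2 ^ k * 2 ^ k * 2 ^ k * 2 ^ k" by (simp only: power_mult[symmetric] power_add[symmetric]) (simp add: algebra_simps)
  finally show ?thesis by simp
qed

lemma pow8: "(2::nat) ^ k * 2 ^ k * 2 ^ k = 2 ^ (3 * k)"
  by (simp only: power_add[symmetric]) (simp add: algebra_simps)

lemma build_table_wp:
  assumes v: "vv s vK = 2 ^ k" and k: "16 ^ k \<le> 16 * (n + 1)"
  shows "wp build_table (\<lambda>t. step_table k (aa t aT) \<and> clk t \<le> clk s + 16 ^ k * (24 * k + 10) + 4) s"
proof -
  let ?K = "(2::nat) ^ k"
  have ok: "Suc 0 < W" "2 < W" "0 < W" using nM MW by auto
  have KW: "?K * ?K * ?K * ?K < W" using k nM MW unfolding pow16 by linarith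
  have "?K * 1 \<le> ?K * ?K" "?K * ?K * 1 \<le> ?K * ?K * ?K" "?K * ?K * ?K * 1 \<le> ?K * ?K * ?K * ?K"
    by (rule mult_le_mono2; simp)+
  then have KW': "?K * ?K < W" "?K * ?K * ?K < W" "?K < W" using KW by linarith+
  show ?thesis
    unfolding build_table_def
    apply (simp add: wp_simps ok v KW KW')
    apply (rule wp_While[where T = "clk s + 16 ^ k * (24 * k + 10) + 3" and I = "\<lambda>t. vv t vi \<le> 16 ^ k \<and>
        (\<forall>i < vv t vi. aa t aT i = stepg 1 1 (i div ?K) (i mod ?K)) \<and>
        clk t \<le> clk s + vv t vi * (24 * k + 10) + 2"])
    subgoal by simp
    subgoal premises p for t
    proof -
      have "vv t vi * (24 * k + 10) \<le> 16 ^ k * (24 * k + 10)" using p(1) by (intro mult_le_mono1) auto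
      then show ?thesis using p(1) by (intro conjI) (simp, linarith)
    qed
    subgoal premises p for t
    proof -
      note fr = frame_vv[OF p(2)] frame_aa[OF p(2)]
      have i: "vv t vi < 16 ^ k" using p(3) by (simp add: fr v pow16)
      have iW: "vv t vi < M" "Suc (vv t vi) < W" "4 * vv t vi < W" using i k nM MW by auto
      have "vv t vi < 2 ^ (3 * k) * 2 ^ k" using i by (simp add: pow16[symmetric] pow8[symmetric])
      then have X: "vv t vi div ?K < 2 ^ (3 * k)" by (simp add: less_mult_imp_div_less)
      have X4: "4 * (vv t vi div ?K) < W" using iW(3) div_le_dividend[of "vv t vi" ?K] by linarith
      show ?thesis
        apply (simp add: wp_simps fr v)
        apply (rule wp_conseq[OF table_entry_wp[of _ "vv t vi div ?K" "vv t vi mod ?K" "3 * k"]];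
          (use X X4 in simp; fail)?)
        subgoal premises q for u
          using q(1) p(1) i iW ok frame_vv[OF q(2)] frame_aa[OF q(2)]
          by (auto simp: wp_simps idx_ok_def narr_def less_Suc_eq)
        done
    qed
    subgoal premises p for t
    proof -
      note fr = frame_vv[OF p(2)] frame_aa[OF p(2)]
      have i: "vv t vi = 16 ^ k" using p(1,3) by (simp add: fr v pow16)
      have "aa t aT (X * ?K + m) = stepg 1 1 X m" if Xm: "X < 2 ^ (3 * k)" "m < ?K" for X m
      proof -
        have "X * ?K + m < X * ?K + ?K" using Xm by simp
        also have "\<dots> = Suc X * ?K" by simp
        also have "\<dots> \<le> 2 ^ (3 * k) * ?K" using Xm by (intro mult_le_mono1) simp
        also have "\<dots> = 16 ^ k" by (simp add: pow16[symmetric] pow8[symmetric])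
        finally have "aa t aT (X * ?K + m) = stepg 1 1 ((X * ?K + m) div ?K) ((X * ?K + m) mod ?K)"
          using p(1) i by simp
        then show ?thesis using Xm by simp
      qed
      then show ?thesis using p(1) i by (simp add: step_table_def)
    qed
    done
qed

definition build_topbit :: com where
  "build_topbit = ve ::= V vK \<otimes> V vK \<otimes> V vK \<otimes> N 2;;
    Write aTB (N 0) (N 0);; Write aTB (N 1) (N 0);; vi ::= N 2;;
    WHILE BLt (V vi) (V ve) DO (
      Write aTB (V vi) (Arr aTB (Bin Div (V vi) (N 2)) \<oplus> N 1);; vi ::= V vi \<oplus> N 1)"

lemma mv_build_topbit [simp]: "mv build_topbit = {20, 29}" "ma build_topbit = {12}"
  by (auto simp: build_topbit_def)

text \<open>The top bit is the entry of the last character of a block, the only one that the next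
  block depends on. After a step it can be bit \<open>3 * k\<close>, one more than
  \<open>step_table\<close> has to accept.\<close>

definition topbit_table :: "nat \<Rightarrow> (nat \<Rightarrow> nat) \<Rightarrow> bool" where
  "topbit_table k B \<longleftrightarrow> (\<forall>x. 0 < x \<longrightarrow> x < 2 ^ (3 * k + 1) \<longrightarrow> 2 ^ B x \<le> x \<and> x < 2 ^ Suc (B x))"

lemma topbit_code:
  assumes "topbit_table k B" "sorted_wrt (<) xs" "xs \<noteq> []" "last xs \<le> 3 * k"
  shows "B (code xs) = last xs"
proof -
  note c = code_bounds[OF assms(2,3)]
  have "(2::nat) ^ Suc (last xs) \<le> 2 ^ (3 * k + 1)" using assms(4) by (intro power_increasing) auto
  then have "code xs < 2 ^ (3 * k + 1)" "0 < code xs" using c assms(3) by (linarith, simp)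
  then have "2 ^ B (code xs) \<le> code xs \<and> code xs < 2 ^ Suc (B (code xs))"
    using assms(1) unfolding topbit_table_def by blast
  then have "(2::nat) ^ last xs < 2 ^ Suc (B (code xs))" "(2::nat) ^ B (code xs) < 2 ^ Suc (last xs)"
    using c by linarith+
  then show ?thesis by (simp only: power_strict_increasing_iff)
qed

lemma build_topbit_wp:
  assumes v: "vv s vK = 2 ^ k" and k: "16 ^ k \<le> 16 * (n + 1)" "1 \<le> k"
  shows "wp build_topbit (\<lambda>t. topbit_table k (aa t aTB) \<and> clk t \<le> clk s + 3 * 16 ^ k + 5) s"
proof -
  let ?K = "(2::nat) ^ k"
  have ok: "Suc 0 < W" "2 < W" "0 < W" "idx_ok 12 0" "idx_ok 12 (Suc 0)"
    using nM MW by (auto simp: idx_ok_def narr_def)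
  have K2: "2 \<le> ?K" using k(2) by (metis power_increasing power_one_right one_le_numeral)
  have KW: "?K * ?K * ?K * ?K < W" using k nM MW unfolding pow16 by linarith
  have "?K * 1 \<le> ?K * ?K" "?K * ?K * 1 \<le> ?K * ?K * ?K" by (rule mult_le_mono2; simp)+
  moreover have "?K * ?K * ?K * 2 \<le> ?K * ?K * ?K * ?K" using K2 by (intro mult_le_mono2)
  ultimately have KW': "?K * ?K < W" "?K * ?K * ?K < W" "?K < W" "?K * ?K * ?K * 2 < W" using KW by linarith+
  define E where "E = ?K * ?K * ?K * 2"
  have E: "E \<le> 16 ^ k" using \<open>?K * ?K * ?K * 2 \<le> _\<close> by (simp add: E_def pow16)
  then have EM: "E < M" using k nM by simp
  show ?thesis
    unfolding build_topbit_def
    apply (simp add: wp_simps ok v KW KW' E_def[symmetric] less_trans[OF EM MW])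
    apply (rule wp_While[where T = "clk s + 3 * E + 4" and I = "\<lambda>t. 2 \<le> vv t vi \<and> (2 \<le> E \<longrightarrow> vv t vi \<le> E) \<and>
        (\<forall>x. 0 < x \<longrightarrow> x < vv t vi \<longrightarrow> 2 ^ aa t aTB x \<le> x \<and> x < 2 ^ Suc (aa t aTB x) \<and> aa t aTB x < E) \<and>
        clk t + 2 \<le> clk s + 3 * vv t vi"])
    subgoal premises p
    proof -
      have "x = Suc 0" if "0 < x" "x < 2" for x :: nat using that by simp
      moreover have "1 * 1 * 1 * 2 \<le> E" unfolding E_def by (intro mult_le_mono) auto
      ultimately show ?thesis by auto
    qed
    subgoal premises p for t
    proof -
      have "1 * 1 * 1 * 2 \<le> E" unfolding E_def by (intro mult_le_mono) auto
      then show ?thesis using p(1) by auto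
    qed
    subgoal premises p for t
    proof -
      note fr = frame_vv[OF p(2)] frame_aa[OF p(2)]
      let ?i = "vv t vi" and ?h = "vv t vi div 2"
      have i: "?i < E" using p(3) by (simp add: fr E_def)
      have h: "0 < ?h" "?h < ?i" using p(1) by auto
      then have h': "2 ^ aa t aTB ?h \<le> ?h" "?h < 2 ^ Suc (aa t aTB ?h)" using p(1) by auto
      have "?i = 2 * ?h + ?i mod 2" by simp
      then have 1: "2 ^ Suc (aa t aTB ?h) \<le> ?i" "?i < 2 ^ Suc (Suc (aa t aTB ?h))"
        using h' by simp_all
      have 2: "Suc (aa t aTB ?h) < E" using 1(1) i less_exp[of "Suc (aa t aTB ?h)"] by linarith
      show ?thesis using p(1) i h 1 2 EM MW ok
        by (auto simp: wp_simps idx_ok_def narr_def less_Suc_eq)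
    qed
    subgoal premises p for t
    proof -
      note fr = frame_vv[OF p(2)] frame_aa[OF p(2)]
      have "1 * 1 * 1 * 2 \<le> E" unfolding E_def by (intro mult_le_mono) auto
      then have "vv t vi = E" using p(1,3) by (simp add: fr E_def)
      moreover have "E = 2 ^ (3 * k + 1)" by (simp add: E_def pow8)
      ultimately show ?thesis using p(1) E by (auto simp: topbit_table_def)
    qed
    done
qed

end

section \<open>Windows by blocks of the pattern\<close>

abbreviation (input) "vy \<equiv> (32::nat)"

fun pmask :: "(nat \<Rightarrow> nat) \<Rightarrow> nat \<Rightarrow> nat \<Rightarrow> nat \<Rightarrow> nat" where
  "pmask I q 0 c = 0"
| "pmask I q (Suc p) c = pmask I q p c + (if I (q + p) = c then 2 ^ p else 0)"

lemma pmask_less: "pmask I q p c < 2 ^ p"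
  by (induction p) auto

lemma pmask_bit: "i < p \<Longrightarrow> odd (pmask I q p c div 2 ^ i) \<longleftrightarrow> I (q + i) = c"
proof (induction p)
  case (Suc p)
  show ?case
  proof (cases "i = p")
    case True
    have "pmask I q p c div 2 ^ p = 0" using pmask_less[of I q p c] by simp
    then show ?thesis using True by simp
  next
    case False
    then have ip: "i < p" using Suc by simp
    then have "(2::nat) ^ p = 2 * 2 ^ (p - Suc i) * 2 ^ i"
      by (metis Suc_diff_Suc mult.commute power_Suc power_add le_add_diff_inverse2 less_imp_le)
    then have "(pmask I q p c + 2 ^ p) div 2 ^ i = 2 * 2 ^ (p - Suc i) + pmask I q p c div 2 ^ i"
      by (simp add: div_mult_self2)
    then show ?thesis using Suc.IH ip by simp
  qed
qed simp

text \<open>Ages \<open>1, ..., p\<close>: in a fresh timeline entry \<open>i\<close> sits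
  \<open>i + 1\<close> slots before the front, and adding its offset \<open>i + 1\<close> gives the
  bit position.\<close>

definition start_state :: "nat \<Rightarrow> nat list" where
  "start_state p = map (\<lambda>i. 2 * Suc i) [0..<p]"

context sized begin

definition init_row :: "nat \<Rightarrow> com" where
  "init_row dst = vi ::= N 0;; WHILE BLe (V vi) (V vn) DO (Write dst (V vi) (V vi \<oplus> N 1);; vi ::= V vi \<oplus> N 1)"

lemma mv_init_row [simp]: "mv (init_row dst) = {20}" "ma (init_row dst) = {dst}"
  by (auto simp: init_row_def)

lemma init_row_wp:
  assumes "vv s vn = n" "dst \<noteq> 0" "dst < narr"
  shows "wp (init_row dst) (\<lambda>t. (\<forall>i \<le> n. aa t dst i = i + 1) \<and> clk t \<le> clk s + 3 * n + 8) s"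
proof -
  have ok: "Suc 0 < W" "0 < W" using nM MW by auto
  show ?thesis
    unfolding init_row_def
    apply (simp add: wp_simps ok)
    apply (rule wp_While[where T = "clk s + 3 * n + 4" and I = "\<lambda>t. vv t vi \<le> n + 1 \<and>
      (\<forall>i < vv t vi. aa t dst i = i + 1) \<and> clk t \<le> clk s + 3 * vv t vi + 1"])
    apply simp_all[2]
    subgoal premises p for t
      using p(1,3) assms nM MW frame_vv[OF p(2)]
      by (auto simp: wp_simps idx_ok_def less_Suc_eq)
    subgoal premises p for t
      using p(1,3) assms frame_vv[OF p(2)] by auto
    done
qed

text \<open>Besides the masks, the code of the start state is accumulated in \<open>vg\<close> as a
  sum of powers of 4, and the first slots of the timeline are set to 0, since no nonempty prefix of
  the pattern has a window before the text begins.\<close>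

definition set_masks :: com where
  "set_masks = vp ::= N 0;; vb ::= N 1;; vh ::= N 4;; vg ::= N 0;;
     WHILE BLt (V vp) (V ve) DO (
       Write aM (Arr aIP (V vq \<oplus> V vp)) (Arr aM (Arr aIP (V vq \<oplus> V vp)) \<oplus> V vb);;
       vb ::= V vb \<otimes> N 2;; vg ::= V vg \<oplus> V vh;; vh ::= V vh \<otimes> N 4;;
       Write aV (V vk \<ominus> (V vp \<oplus> N 1)) (N 0);; vp ::= V vp \<oplus> N 1)"

lemma mv_set_masks [simp]: "mv set_masks = {23, 24, 28, 31}" "ma set_masks = {13, 14}"
  by (auto simp: set_masks_def)

lemma set_masks_wp:
  assumes v: "vv s ve = p" "vv s vk = k" "vv s vq = q" and p: "p \<le> k" "q + p \<le> r" "k \<le> r + 1"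
    and k: "16 ^ k \<le> 16 * (n + 1)"
    and IP: "\<And>i. i < r \<Longrightarrow> aa s aIP i < r" and M0: "\<And>c. c \<le> r \<Longrightarrow> aa s aM c = 0"
  shows "wp set_masks (\<lambda>t. vv t vg = code (start_state p) \<and>
    (\<forall>c \<le> r. aa t aM c = pmask (aa s aIP) q p c) \<and> (\<forall>i < p. aa t aV (k - Suc i) = 0) \<and>
    clk t \<le> clk s + 7 * p + 5) s"
proof -
  have ok: "Suc 0 < W" "0 < W" "2 < W" "4 < W" using nM MW by auto
  have e4: "4 ^ i * 4 < W" "2 ^ i < W" if "i \<le> Suc k" for i
  proof -
    have "(4::nat) ^ i \<le> 4 ^ Suc k" using that by (intro power_increasing) auto
    also have "\<dots> \<le> 4 * 16 ^ k" using power_mono[of 4 "16::nat" k] by simp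
    finally show "4 ^ i * 4 < W" using k nM MW by simp
    moreover have "(2::nat) ^ i \<le> 4 ^ i" by (rule power_mono) auto
    ultimately show "2 ^ i < W" by linarith
  qed
  show ?thesis
    unfolding set_masks_def
    apply (simp add: wp_simps ok)
    apply (rule wp_While[where T = "clk s + 7 * p + 4" and I = "\<lambda>t. vv t vp \<le> p \<and>
      vv t vb = 2 ^ vv t vp \<and> vv t vh = 2 ^ (2 * Suc (vv t vp)) \<and> vv t vg = code (start_state (vv t vp)) \<and>
      vv t vg < vv t vh \<and>
      (\<forall>c \<le> r. aa t aM c = pmask (aa s aIP) q (vv t vp) c) \<and> (\<forall>i < vv t vp. aa t aV (k - Suc i) = 0) \<and>
      clk t \<le> clk s + 7 * vv t vp + 4"])
    subgoal by (simp add: M0 start_state_def)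
    subgoal by simp
    subgoal premises a for t
    proof -
      note fr = frame_vv[OF a(2)] frame_aa[OF a(2)]
      let ?p = "vv t vp"
      have lt: "?p < p" using a(3) by (simp add: fr v)
      have c: "aa s aIP (q + ?p) < r" using IP lt p by simp
      have i1: "q + ?p < W" "idx_ok 10 (q + ?p)" "idx_ok 13 (aa s aIP (q + ?p))" "idx_ok 14 (k - Suc ?p)"
        "Suc ?p < W" "k < W" "Suc ?p \<le> k"
        using lt p c rn nM MW by (auto simp: idx_ok_def narr_def)
      have b: "vv t vb * 2 < W" "vv t vh * 4 < W" "vv t vg + vv t vh < W"
        "aa t aM (aa s aIP (q + ?p)) + vv t vb < W"
      proof -
        have pk: "Suc ?p \<le> k" using lt p by simp
        have vh: "vv t vh = 4 ^ Suc ?p" using a(1) by (simp add: power_mult)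
        show "vv t vb * 2 < W" "vv t vh * 4 < W" using a(1) e4(2)[of "Suc ?p"] e4(1)[of "Suc ?p"] pk vh by (auto simp: mult.commute)
        then show "vv t vg + vv t vh < W" using a(1) by linarith
        have "aa t aM (aa s aIP (q + ?p)) < vv t vb" using a(1) c pmask_less by simp
        then show "aa t aM (aa s aIP (q + ?p)) + vv t vb < W" using \<open>vv t vb * 2 < W\<close> by linarith
      qed
      have g: "vv t vg + vv t vh = code (start_state (Suc ?p))"
        using a(1) by (simp add: start_state_def code_snoc)
      show ?thesis
        using a(1) i1 b g c lt ok by (auto simp: wp_simps fr v less_Suc_eq)
    qed
    subgoal premises a for t
    proof -
      have "vv t vp = p" using a(1,3) frame_vv[OF a(2)] by (simp add: v)
      then show ?thesis using a(1) by simp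
    qed
    done
qed

definition clear_masks :: com where
  "clear_masks = vp ::= N 0;;
     WHILE BLt (V vp) (V ve) DO (Write aM (Arr aIP (V vq \<oplus> V vp)) (N 0);; vp ::= V vp \<oplus> N 1)"

lemma mv_clear_masks [simp]: "mv clear_masks = {24}" "ma clear_masks = {13}"
  by (auto simp: clear_masks_def)

lemma pmask_0: "(\<And>i. i < p \<Longrightarrow> I (q + i) \<noteq> c) \<Longrightarrow> pmask I q p c = 0"
  by (induction p) auto

lemma clear_masks_wp:
  assumes v: "vv s ve = p" "vv s vq = q" and p: "q + p \<le> r"
    and IP: "\<And>i. i < r \<Longrightarrow> aa s aIP i < r"
    and M: "\<And>c. c \<le> r \<Longrightarrow> aa s aM c = pmask (aa s aIP) q p c"
  shows "wp clear_masks (\<lambda>t. (\<forall>c \<le> r. aa t aM c = 0) \<and> clk t \<le> clk s + 3 * p + 2) s"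
proof -
  have ok: "Suc 0 < W" "0 < W" using nM MW by auto
  show ?thesis
    unfolding clear_masks_def
    apply (simp add: wp_simps ok)
    apply (rule wp_While[where T = "clk s + 3 * p + 1" and I = "\<lambda>t. vv t vp \<le> p \<and>
      (\<forall>c \<le> r. aa t aM c = (if \<exists>i < vv t vp. aa s aIP (q + i) = c then 0 else pmask (aa s aIP) q p c)) \<and>
      clk t \<le> clk s + 3 * vv t vp + 1"])
    subgoal by (simp add: M)
    subgoal by simp
    subgoal premises a for t
    proof -
      note fr = frame_vv[OF a(2)] frame_aa[OF a(2)]
      let ?p = "vv t vp"
      have lt: "?p < p" using a(3) by (simp add: fr v)
      have c: "aa s aIP (q + ?p) < r" using IP lt p by simp
      have i1: "q + ?p < W" "idx_ok 10 (q + ?p)" "idx_ok 13 (aa s aIP (q + ?p))" "Suc ?p < W"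
        using lt p c rn nM MW by (auto simp: idx_ok_def narr_def)
      show ?thesis
        using a(1) i1 c lt ok by (auto simp: wp_simps fr v less_Suc_eq)
    qed
    subgoal premises a for t
    proof -
      have "vv t vp = p" using a(1,3) frame_vv[OF a(2)] by (simp add: v)
      then show ?thesis using a(1) pmask_0[of p "aa s aIP" q] by auto
    qed
    done
qed

text \<open>Window starts enter a timeline, held in \<open>aV\<close>; the entry of age \<open>a\<close> after \<open>j\<close> characters of the
  current text segment is found at \<open>y + k + j - a\<close>. After \<open>k\<close> characters the state is written out as
  the beginning of a fresh timeline.\<close>

definition rebase_loop :: com where
  "rebase_loop =
     WHILE BNe (V vx) (N 0) DO (
       (IF BEq (Bin Mod (V vx) (N 2)) (N 0) THEN SKIP ELSE (
          Write aV (V vy \<oplus> V vk \<oplus> V vk \<oplus> V vk \<ominus> V vf) (Arr aV (V vy \<oplus> V vk \<oplus> V vk \<oplus> V vf \<ominus> V vm));;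
          vf ::= V vf \<oplus> N 1));;
       vx ::= Bin Div (V vx) (N 2);; vm ::= V vm \<oplus> N 1)"

lemma mv_rebase_loop [simp]: "mv rebase_loop = {22, 26, 27}" "ma rebase_loop = {14}"
  by (auto simp: rebase_loop_def)

definition rebase :: com where
  "rebase = vf ::= N 1;; vm ::= N 0;;
     rebase_loop;;
     vy ::= V vy \<oplus> V vk \<oplus> V vk;; vj ::= N 0;; vx ::= V vg"

lemma mv_rebase [simp]: "mv rebase = {21, 22, 26, 27, 32}" "ma rebase = {14}"
  by (auto simp: rebase_def)

text \<open>The slots read lie below \<open>y + 2 * k\<close> and those written do not, so the two
  timelines cannot interfere. A set bit \<open>vm\<close> met after \<open>c\<close> entries is
  \<open>xs ! c\<close>, and together with \<open>vf = c + 1\<close> it determines the slot to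
  read.\<close>

lemma rebase_wp:
  assumes v: "vv s vk = k" "vv s vy = y" "vv s vx = code xs"
    and xs: "sorted_wrt (<) xs" "length xs \<le> k" "\<And>p. p < length xs \<Longrightarrow> p + 2 \<le> xs ! p \<and> xs ! p \<le> k + 2 * Suc p"
    and y: "y + 4 * k < M"
  shows "wp rebase (\<lambda>t. vv t vy = y + 2 * k \<and> vv t vj = 0 \<and> vv t vx = vv s vg \<and>
    (\<forall>p < length xs. aa t aV (y + 3 * k - Suc p) = aa s aV (y + 2 * k - (xs ! p - Suc p))) \<and>
    clk t \<le> clk s + 18 * k + 12) s"
proof -
  have ok: "Suc 0 < W" "0 < W" "2 < W" using nM MW by auto
  have loop: "wp rebase_loop (\<lambda>t.
    (\<forall>p < length xs. aa t aV (y + 3 * k - Suc p) = aa s aV (y + 2 * k - (xs ! p - Suc p))) \<and>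
    clk t \<le> clk s + 18 * k + 9) s'"
    if s': "vv s' vf = 1" "vv s' vm = 0" "vv s' vx = code xs" "vv s' vy = y" "vv s' vk = k" "aa s' = aa s"
      "clk s' = clk s + 2" for s'
    unfolding rebase_loop_def
    apply (rule wp_While[where T = "clk s + 6 * (3 * k + 1) + 2" and I = "\<lambda>t. \<exists>c \<le> length xs.
      vv t vf = c + 1 \<and> vv t vx = code (map (\<lambda>x. x - vv t vm) (drop c xs)) \<and>
      (\<forall>x \<in> set (drop c xs). vv t vm \<le> x) \<and> vv t vm \<le> 3 * k + 1 \<and>
      (\<forall>p < c. aa t aV (y + 3 * k - Suc p) = aa s aV (y + 2 * k - (xs ! p - Suc p))) \<and>
      (\<forall>i < y + 2 * k. aa t aV i = aa s aV i) \<and> clk t \<le> clk s + 6 * vv t vm + 2"])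
    subgoal by (rule exI[of _ 0]) (simp add: s')
    subgoal using ok by auto
    subgoal premises a for t
    proof -
      note fr = frame_vv[OF a(2)] frame_aa[OF a(2)]
      obtain c where c: "c \<le> length xs" "vv t vf = c + 1"
        "vv t vx = code (map (\<lambda>x. x - vv t vm) (drop c xs))"
        "\<forall>x \<in> set (drop c xs). vv t vm \<le> x" "vv t vm \<le> 3 * k + 1"
        "\<forall>p < c. aa t aV (y + 3 * k - Suc p) = aa s aV (y + 2 * k - (xs ! p - Suc p))"
        "\<forall>i < y + 2 * k. aa t aV i = aa s aV i" "clk t \<le> clk s + 6 * vv t vm + 2"
        using a(1) by blast
      have so: "sorted_wrt (<) (drop c xs)" using xs(1) by (rule sorted_wrt_drop)
      have "vv t vx \<noteq> 0" using a(3) by simp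
      then have "drop c xs \<noteq> []" unfolding c(3) by auto
      then have cl: "c < length xs" by simp
      then have hd: "drop c xs = xs ! c # drop (Suc c) xs" by (simp add: Cons_nth_drop_Suc)
      have "vv t vm \<le> xs ! c" using c(4) hd by simp
      then have m: "vv t vm \<le> 3 * k" using xs(2) xs(3)[OF cl] cl by auto
      have mW: "Suc (vv t vm) < W" using m y MW by linarith
      show ?thesis
      proof (cases "even (vv t vx)")
        case True
        note e = code_even[OF so c(4) True[unfolded c(3)]]
        have "\<exists>c \<le> length xs. vv t vf = c + 1 \<and>
            vv t vx div 2 = code (map (\<lambda>x. x - Suc (vv t vm)) (drop c xs)) \<and>
            (\<forall>x \<in> set (drop c xs). Suc (vv t vm) \<le> x) \<and>
            (\<forall>p < c. aa t aV (y + 3 * k - Suc p) = aa s aV (y + 2 * k - (xs ! p - Suc p))) \<and>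
            (\<forall>i < y + 2 * k. aa t aV i = aa s aV i) \<and> clk t + 6 \<le> clk s + 6 * Suc (vv t vm) + 2"
          using c e by (intro exI[of _ c]) simp
        then show ?thesis using True mW m ok by (fastforce simp: wp_simps)
      next
        case False
        obtain ys where ys: "drop c xs = vv t vm # ys" "\<forall>y \<in> set ys. Suc (vv t vm) \<le> y"
          "vv t vx div 2 = code (map (\<lambda>x. x - Suc (vv t vm)) ys)"
          using code_odd[OF so c(4) False[unfolded c(3)]] c(3) by metis
        have ys': "ys = drop (Suc c) xs" "vv t vm = xs ! c" using ys(1) hd by auto
        have b: "c + 2 \<le> vv t vm" "vv t vm \<le> k + 2 * Suc c" "Suc c \<le> k"
          using xs(3)[OF cl] ys'(2) xs(2) cl by auto
        have i1: "y + k + k + k < W" "y + k + k + (c + 1) < W" "vv t vm \<le> y + k + k + (c + 1)"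
          "idx_ok 14 (y + k + k + k - (c + 1))" "idx_ok 14 (y + k + k + (c + 1) - vv t vm)" "y + k + k < W" "y + k < W"
          using b y MW by (auto simp: idx_ok_def narr_def)
        have e1: "y + k + k + k - (c + 1) = y + 3 * k - Suc c"
          "y + k + k + (c + 1) - vv t vm = y + 2 * k - (xs ! c - Suc c)"
          "y + 2 * k - (xs ! c - Suc c) < y + 2 * k"
          using b ys'(2) by auto
        define V' where "V' = (aa t aV)(y + 3 * k - Suc c := aa s aV (y + 2 * k - (xs ! c - Suc c)))"
        have "V' (y + 3 * k - Suc p) = aa s aV (y + 2 * k - (xs ! p - Suc p))" if "p < Suc c" for p
          using that c(6) b by (auto simp: V'_def less_Suc_eq)
        moreover have "V' i = aa s aV i" if "i < y + 2 * k" for i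
          using that c(7) b by (auto simp: V'_def)
        ultimately have V': "\<forall>p < Suc c. V' (y + 3 * k - Suc p) = aa s aV (y + 2 * k - (xs ! p - Suc p))"
          "\<forall>i < y + 2 * k. V' i = aa s aV i" by blast+
        have V'_eq: "V' = (aa t aV)(y + k + k + k - Suc c := aa t aV (Suc (y + k + k + c) - vv t vm))"
          unfolding V'_def using c(7) e1 by simp
        show ?thesis
        proof (rule wp_conseq[where P = "\<lambda>u. vv u vf = c + 2 \<and> vv u vx = vv t vx div 2 \<and>
            vv u vm = Suc (vv t vm) \<and> aa u aV = V' \<and> clk u \<le> clk t + 6"], goal_cases)
          case 1
          then show ?case using False mW m ok i1 b
            by (simp add: wp_simps odd_iff_mod_2_eq_one c(2) fr s' V'_eq)
        next
          case (2 u)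
          then show ?case
            using ys ys' cl c(8) m V' by (intro exI[of _ "Suc c"]) simp
        qed
      qed
    qed
    subgoal premises a for t
      using a(1,3) by auto
    done
  have ok': "y + k < W" "y + k + k < W" using y MW by auto
  show ?thesis
    unfolding rebase_def
    apply (simp add: wp_simps ok)
    apply (rule wp_conseq[OF loop]; (simp add: v; fail)?)
    subgoal premises q for t
      using q(1) ok ok' frame_vv[OF q(2)] by (simp add: wp_simps v)
    done
qed

text \<open>The row is rewritten in place. \<open>vt\<close> rescues the old value of the cell,
  which belongs to the row before the block and enters the timeline one character later.\<close>

definition scan_char :: "nat \<Rightarrow> nat \<Rightarrow> com" where
  "scan_char src dst =
     Write aV (V vy \<oplus> V vk \<oplus> V vj) (V vt);;
     vt ::= Arr dst (V vi);;
     vx ::= Arr aT (V vx \<otimes> V vK \<oplus> Arr aM (Arr src (V vi)));;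
     vj ::= V vj \<oplus> N 1;;
     Write dst (V vi) (Arr aV (V vy \<oplus> V vk \<oplus> V vj \<oplus> V ve \<ominus> Arr aTB (V vx)));;
     vi ::= V vi \<oplus> N 1"

definition scan_loop :: "nat \<Rightarrow> nat \<Rightarrow> com" where
  "scan_loop src dst = WHILE BLe (V vi) (V vn) DO (
     (IF BEq (V vj) (V vk) THEN rebase ELSE SKIP);; scan_char src dst)"

definition scan_text :: "nat \<Rightarrow> nat \<Rightarrow> com" where
  "scan_text src dst =
     vy ::= N 0;; vj ::= N 0;; vx ::= V vg;; vt ::= Arr dst (N 0);; Write dst (N 0) (N 0);; vi ::= N 1;;
     scan_loop src dst"

lemma mv_scan [simp]:
  "mv (scan_char src dst) = {20, 21, 25, 26}" "ma (scan_char src dst) = {14, dst}"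
  "mv (scan_loop src dst) = {20, 21, 22, 25, 26, 27, 32}" "ma (scan_loop src dst) = {14, dst}"
  "mv (scan_text src dst) = {20, 21, 22, 25, 26, 27, 32}" "ma (scan_text src dst) = {14, dst}"
  by (auto simp: scan_char_def scan_loop_def scan_text_def)

end

text \<open>Unrolling the recursion of \<open>sg\<close> through a block ends in a value of row
  \<open>q\<close> at some earlier text position. Only this moment is remembered, as an age; the
  value itself waits in the timeline \<open>T\<close>. After \<open>j\<close> characters the bits
  are bounded by \<open>j + 2 * p\<close>, however large the window starts are.\<close>

definition tracks :: "(nat \<Rightarrow> nat \<Rightarrow> nat) \<Rightarrow> nat \<Rightarrow> nat \<Rightarrow> nat \<Rightarrow> nat \<Rightarrow> nat \<Rightarrow> (nat \<Rightarrow> nat) \<Rightarrow> nat list \<Rightarrow> bool" where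
  "tracks g q p b j i T xs \<longleftrightarrow> length xs = p \<and> sorted_wrt (<) (0 # xs) \<and>
     (\<forall>u < p. u + 2 \<le> xs ! u \<and> xs ! u \<le> j + 2 * Suc u \<and> g (q + Suc u) i = T (b + j - (xs ! u - Suc u)))"

lemma tracks_start:
  assumes "\<And>u. u < p \<Longrightarrow> T (b - Suc u) = g (q + Suc u) i"
  shows "tracks g q p b 0 i T (start_state p)"
  using assms unfolding tracks_def start_state_def by (auto simp: sorted_wrt_iff_nth_less nth_Cons')

text \<open>The new slot \<open>b + j\<close> disturbs nothing: recorded ages are at least 1, so
  they refer to earlier slots. A match at the first position of the block refers to exactly this
  slot.\<close>

lemma tracks_step:
  assumes tr: "tracks g q p b j i T xs" and b: "p \<le> b"
    and m: "\<And>u. u < p \<Longrightarrow> odd (m div 2 ^ u) \<longleftrightarrow> mt u"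
    and g: "\<And>u. u < p \<Longrightarrow> g (q + Suc u) (Suc i) = (if mt u then g (q + u) i else g (q + Suc u) i)"
  shows "tracks g q p b (Suc j) (Suc i) (T(b + j := g q i)) (stepl 0 xs m)"
  unfolding tracks_def
proof (intro conjI allI impI)
  have l: "length xs = p" and so: "sorted_wrt (<) (0 # xs)" using tr by (auto simp: tracks_def)
  show "length (stepl 0 xs m) = p" using l by simp
  have x: "u + 2 \<le> xs ! u" "xs ! u \<le> j + 2 * Suc u" "g (q + Suc u) i = T (b + j - (xs ! u - Suc u))"
    if "u < p" for u using tr that by (auto simp: tracks_def)
  fix u assume u: "u < p"
  have n: "stepl 0 xs m ! u = (if mt u then (if u = 0 then 0 else xs ! (u - 1)) + 2 else xs ! u + 1)"
    using nth_stepl[of u xs 0 m] u l m by simp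
  show "u + 2 \<le> stepl 0 xs m ! u" "stepl 0 xs m ! u \<le> Suc j + 2 * Suc u"
    unfolding n using x[OF u] x[of "u - 1"] u by (cases u; auto)+
  show "g (q + Suc u) (Suc i) = (T(b + j := g q i)) (b + Suc j - (stepl 0 xs m ! u - Suc u))"
  proof (cases "mt u")
    case True
    show ?thesis
    proof (cases u)
      case 0
      then show ?thesis using n True g[OF u] by simp
    next
      case (Suc v)
      then show ?thesis using n True g[OF u] x[of v] u b by auto
    qed
  next
    case False
    then show ?thesis using n g[OF u] x[OF u] u b by auto
  qed
next
  have l: "length xs = p" and so: "sorted_wrt (<) (0 # xs)" using tr by (auto simp: tracks_def)
  have "0 < y" if y: "y \<in> set (stepl 0 xs m)" for y
  proof -
    obtain u where "u < p" "y = stepl 0 xs m ! u" using y l by (auto simp: in_set_conv_nth)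
    then show ?thesis using nth_stepl[of u xs 0 m] l by auto
  qed
  then show "sorted_wrt (<) (0 # stepl 0 xs m)" using sorted_stepl[OF so] by simp
qed

lemma tracks_last:
  assumes "tracks g q p b j i T xs" "0 < p" "p \<le> b"
  shows "last xs \<le> j + 2 * p" "last xs \<le> b + j + p" "p < last xs" "xs \<noteq> []" "g (q + p) i = T (b + j + p - last xs)"
proof -
  have l: "length xs = p" using assms by (simp add: tracks_def)
  then show ne: "xs \<noteq> []" using assms by auto
  have "last xs = xs ! (p - 1)" using l ne by (simp add: last_conv_nth)
  moreover have "p - 1 + 2 \<le> xs ! (p - 1)" "xs ! (p - 1) \<le> j + 2 * Suc (p - 1)"
    "g (q + Suc (p - 1)) i = T (b + j - (xs ! (p - 1) - Suc (p - 1)))"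
    using assms unfolding tracks_def by (metis diff_less zero_less_one)+
  ultimately show "last xs \<le> j + 2 * p" "last xs \<le> b + j + p" "p < last xs" "g (q + p) i = T (b + j + p - last xs)"
    using assms(2,3) by auto
qed

lemma tracks_code:
  assumes "tracks g q p b j i T xs" "0 < p" "p \<le> b" "j + 2 * p \<le> e"
  shows "code xs < 2 ^ Suc e"
proof -
  note l = tracks_last[OF assms(1-3)]
  have "code xs < 2 ^ Suc (last xs)"
    using code_bounds[of xs] assms(1) l(4) by (auto simp: tracks_def)
  also have "\<dots> \<le> 2 ^ Suc e" using l(1) assms(4) by (intro power_increasing) auto
  finally show ?thesis .
qed

context sized begin

lemma scan_text_wp:
  assumes S: "length S = n" and P: "length P = r"
    and v: "vv s vn = n" "vv s vk = k" "vv s vK = 2 ^ k" "vv s ve = p" "vv s vg = code (start_state p)"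
    and k: "1 \<le> k" "k \<le> r + 1" "16 ^ k \<le> 16 * (n + 1)" and p: "0 < p" "p \<le> k" "q + p \<le> r"
    and d: "dst \<noteq> 0" "src \<noteq> 0" "dst < narr" "src < narr" "dst \<noteq> aT" "dst \<noteq> aTB" "dst \<noteq> aM" "dst \<noteq> aV" "dst \<noteq> src" "src \<noteq> aV"
    and T: "step_table k (aa s aT)" and B: "topbit_table k (aa s aTB)"
    and mask: "\<And>i. i < n \<Longrightarrow> aa s src (Suc i) \<le> r \<and> aa s aM (aa s src (Suc i)) < 2 ^ k \<and>
       (\<forall>u < p. odd (aa s aM (aa s src (Suc i)) div 2 ^ u) \<longleftrightarrow> S ! i = P ! (q + u))"
    and row: "\<And>i. i \<le> n \<Longrightarrow> aa s dst i = sg S P q i"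
    and V0: "\<And>u. u < p \<Longrightarrow> aa s aV (k - Suc u) = 0"
  shows "wp (scan_text src dst) (\<lambda>t. (\<forall>i \<le> n. aa t dst i = sg S P (q + p) i) \<and>
    clk t \<le> clk s + 40 * n + 50) s"
proof -
  let ?g = "sg S P"
  have ok: "Suc 0 < W" "0 < W" "2 < W" "idx_ok dst 0" using nM MW d by (auto simp: idx_ok_def)
  have g0: "?g (q + p) 0 = 0" "\<And>u. ?g (q + Suc u) 0 = 0" using p by (cases "q + p") auto
  show ?thesis
    unfolding scan_text_def scan_loop_def
    apply (simp add: wp_simps ok)
    \<comment> \<open>Below \<open>vi\<close> the row already belongs to prefix
      \<open>q + p\<close>, from \<open>vi\<close> on still to \<open>q\<close>. Each character
      saves 32 units of time, which pay for a rebase of at most \<open>18 * k + 12\<close> steps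
      every \<open>k\<close> characters. The base \<open>vy\<close> advances by \<open>2 * k\<close>
      in the same period, so the timeline has length O(n).\<close>
    apply (rule wp_While[where T = "clk s + 40 * (n + 1) + 8" and I = "\<lambda>t. 1 \<le> vv t vi \<and> vv t vi \<le> n + 1 \<and>
      (\<exists>xs. tracks ?g q p (vv t vy + k) (vv t vj) (vv t vi - 1) (aa t aV) xs \<and> vv t vx = code xs) \<and>
      vv t vj \<le> k \<and> vv t vy + 2 * vv t vj \<le> 2 * (vv t vi - 1) \<and>
      vv t vt = ?g q (vv t vi - 1) \<and> (\<forall>u < vv t vi. aa t dst u = ?g (q + p) u) \<and>
      (\<forall>u. vv t vi \<le> u \<longrightarrow> u \<le> n \<longrightarrow> aa t dst u = ?g q u) \<and>
      clk t + 32 * vv t vj \<le> clk s + 40 * vv t vi + 7"])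
    subgoal
      using d row V0 g0 v p tracks_start[of p "aa s aV" k ?g q 0]
      by (auto simp: intro!: exI[of _ "start_state p"])
    subgoal by simp
    subgoal premises a for t
    proof -
      note fr = frame_vv[OF a(2)] frame_aa[OF a(2)]
      define i where "i = vv t vi - 1"
      have i: "vv t vi = Suc i" "i < n" using a(1,3) by (auto simp: i_def fr v)
      obtain xs where xs: "tracks ?g q p (vv t vy + k) (vv t vj) i (aa t aV) xs" "vv t vx = code xs"
        using a(1) unfolding i_def by blast
      have inv: "vv t vj \<le> k" "vv t vy + 2 * vv t vj \<le> 2 * i" "vv t vt = ?g q i"
        "\<And>u. u < Suc i \<Longrightarrow> aa t dst u = ?g (q + p) u" "\<And>u. Suc i \<le> u \<Longrightarrow> u \<le> n \<Longrightarrow> aa t dst u = ?g q u"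
        "clk t + 32 * vv t vj \<le> clk s + 40 * Suc i + 7"
        using a(1) i(1) by auto
      show ?thesis
      proof (rule wp_SeqI[where P = "\<lambda>u. \<exists>xs. tracks ?g q p (vv u vy + k) (vv u vj) i (aa u aV) xs \<and>
          vv u vx = code xs \<and> vv u vj < k \<and> vv u vy + 2 * vv u vj \<le> 2 * i \<and>
          clk u + 32 * vv u vj \<le> clk t + 32 * vv t vj + 2"], goal_cases)
        case 1
        show ?case
        proof (cases "vv t vj = k")
          case True
          have y: "vv t vy + 2 * k \<le> 2 * i" using inv True by simp
          have "wp rebase (\<lambda>u. \<exists>xs. tracks ?g q p (vv u vy + k) (vv u vj) i (aa u aV) xs \<and>
            vv u vx = code xs \<and> vv u vj < k \<and> vv u vy + 2 * vv u vj \<le> 2 * i \<and>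
            clk u + 32 * vv u vj \<le> clk t + 32 * vv t vj + 2) (tick (tick t))"
            apply (rule wp_conseq[OF rebase_wp[of _ k "vv t vy" xs]])
            subgoal by (simp add: fr v)
            subgoal by simp
            subgoal by (simp add: xs)
            subgoal using xs(1) by (simp add: tracks_def)
            subgoal using xs(1) p by (simp add: tracks_def)
            subgoal using xs(1) True by (simp add: tracks_def)
            subgoal using y i nM k rn by auto
            subgoal premises w for u
            proof -
              have "tracks ?g q p (vv u vy + k) (vv u vj) i (aa u aV) (start_state p)"
              proof -
                have e: "vv u vy + k = vv t vy + 3 * k" "vv u vj = 0" using w(1) by simp_all
                have l: "length xs = p" using xs(1) by (simp add: tracks_def)
                have 1: "\<forall>h < p. aa u aV (vv t vy + 3 * k - Suc h) = aa t aV (vv t vy + 2 * k - (xs ! h - Suc h))"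
                  using w(1) l by simp
                have 2: "\<forall>h < p. ?g (q + Suc h) i = aa t aV (vv t vy + k + k - (xs ! h - Suc h))"
                  using xs(1) True unfolding tracks_def by blast
                show ?thesis unfolding e
                proof (rule tracks_start)
                  fix h assume "h < p"
                  then show "aa u aV (vv t vy + 3 * k - Suc h) = ?g (q + Suc h) i"
                    using 1 2 by (simp add: mult_2 add.assoc)
                qed
              qed
              then show ?thesis using w(1) y k True v fr by (intro exI[of _ "start_state p"]) simp
            qed
            done
          then show ?thesis using True by (simp add: wp_simps fr v)
        next
          case False
          then show ?thesis using inv xs by (auto simp: wp_simps fr v)
        qed
      next
        case (2 u)
        note fu = frame_vv[OF 2(2)] frame_aa[OF 2(2)]
        obtain xs where xs: "tracks ?g q p (vv u vy + k) (vv u vj) i (aa u aV) xs"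
          "vv u vx = code xs" "vv u vj < k" "vv u vy + 2 * vv u vj \<le> 2 * i"
          "clk u + 32 * vv u vj \<le> clk t + 32 * vv t vj + 2"
          using 2(1) by blast
        define m where "m = aa s aM (aa s src (Suc i))"
        have m: "aa s src (Suc i) \<le> r" "m < 2 ^ k" "\<And>u. u < p \<Longrightarrow> odd (m div 2 ^ u) \<longleftrightarrow> S ! i = P ! (q + u)"
          using mask[OF i(2)] by (auto simp: m_def)
        define ys where "ys = stepl 0 xs m"
        define V' where "V' = (aa u aV)(vv u vy + k + vv u vj := ?g q i)"
        have ys: "tracks ?g q p (vv u vy + k) (Suc (vv u vj)) (Suc i) V' ys"
          unfolding V'_def ys_def by (rule tracks_step[OF xs(1) _ m(3)]) (use p in auto)
        \<comment> \<open>Fewer than \<open>k\<close> characters have passed since the last rebase,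
          so the largest bit is at most \<open>3 * k - 1\<close> and the code is a valid table
          index.\<close>
        have c1: "code xs < 2 ^ (3 * k)"
          using tracks_code[OF xs(1) p(1), of "3 * k - 1"] xs(3) p(2) k(1) by simp
        have so: "sorted_wrt (<) xs" "sorted_wrt (<) ys" using xs(1) ys by (auto simp: tracks_def)
        have tab: "aa s aT (code xs * 2 ^ k + m) = code ys"
          using T c1 m(2) stepg_code[OF so(1), of 0 0 m] unfolding step_table_def ys_def by simp
        have pk: "p \<le> vv u vy + k" using p by simp
        note l = tracks_last[OF ys p(1) pk]
        have l3: "last ys \<le> 3 * k" using l(1) xs(3) p(2) by simp
        have top: "aa s aTB (code ys) = last ys" by (rule topbit_code[OF B so(2) l(4) l3])
        have idx: "code xs * 2 ^ k + m < 16 ^ k"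
        proof -
          have "code xs * 2 ^ k + m < Suc (code xs) * 2 ^ k" using m(2) by simp
          also have "\<dots> \<le> 2 ^ (3 * k) * 2 ^ k" using c1 by (intro mult_le_mono1) simp
          finally show ?thesis by (simp add: pow16[symmetric] pow8[symmetric])
        qed
        have idx2: "code ys < 16 ^ k"
        proof -
          have "code ys < 2 ^ Suc (3 * k)" by (rule tracks_code[OF ys p(1) pk]) (use xs(3) p(2) in simp)
          also have "\<dots> \<le> 2 ^ (4 * k)" using k(1) by (intro power_increasing) auto
          finally show ?thesis by (simp add: power_mult)
        qed
        have iok: "idx_ok 14 (vv u vy + k + vv u vj)" "idx_ok dst (Suc i)" "idx_ok src (Suc i)"
          "idx_ok 13 (aa s src (Suc i))" "idx_ok 11 (code xs * 2 ^ k + m)" "idx_ok 12 (code ys)"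
          "vv u vy + k < W" "vv u vy + k + vv u vj < W" "code xs * 2 ^ k < W" "code xs * 2 ^ k + m < W"
          "Suc (vv u vj) < W" "Suc (vv u vy + k + vv u vj) < W" "Suc (vv u vy + k + vv u vj + p) < W" "Suc (Suc i) < W"
          "idx_ok 14 (Suc (vv u vy + k + vv u vj + p) - last ys)"
          using m(1) idx idx2 xs(3,4) i(2) k p rn nM MW d by (auto simp: idx_ok_def narr_def)
        have fs: "vv u vi = Suc i" "vv u vt = ?g q i" "vv u vk = k" "vv u vK = 2 ^ k" "vv u ve = p" "vv u vn = n"
          "aa u src = aa s src" "aa u aM = aa s aM" "aa u aT = aa s aT" "aa u aTB = aa s aTB" "aa u dst = aa t dst"
          using d i inv by (auto simp: fu fr v)
        show ?case
        proof (rule wp_conseq[where P = "\<lambda>w. vv w vi = Suc (Suc i) \<and> vv w vt = ?g q (Suc i) \<and> vv w vx = code ys \<and>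
            vv w vj = Suc (vv u vj) \<and> aa w aV = V' \<and> aa w dst = (aa t dst)(Suc i := ?g (q + p) (Suc i)) \<and> clk w \<le> clk u + 6"],
            goal_cases)
          case 1
          then show ?case
            using iok l(2) ok inv(5)[of "Suc i"] i(2) l(5)
            by (simp add: scan_char_def wp_simps fs d d(5-10)[THEN not_sym] m_def[symmetric] tab top xs(2) V'_def)
        next
          case (2 w)
          note fw = frame_vv[OF 2(2)] frame_aa[OF 2(2)]
          then show ?case
            using 2(1) ys xs inv i(2) by (auto simp: fw less_Suc_eq intro!: exI[of _ ys])
        qed
      qed
    qed
    subgoal premises a for t
    proof -
      have "vv t vi = n + 1" using a(1,3) frame_vv[OF a(2)] by (simp add: v)
      then show ?thesis using a(1) by simp
    qed
    done
qed

section \<open>Windows for the whole pattern\<close>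

definition do_block :: "nat \<Rightarrow> nat \<Rightarrow> com" where
  "do_block src dst =
     ve ::= V vr \<ominus> V vq;; (IF BLt (V vk) (V ve) THEN ve ::= V vk ELSE SKIP);;
     set_masks;; scan_text src dst;; clear_masks;; vq ::= V vq \<oplus> V ve"

definition windows :: "nat \<Rightarrow> nat \<Rightarrow> com" where
  "windows src dst = init_row dst;; vq ::= N 0;; WHILE BLt (V vq) (V vr) DO do_block src dst"

lemma mv_windows [simp]:
  "mv (do_block src dst) = {20, 21, 22, 23, 24, 25, 26, 27, 28, 29, 30, 31, 32}" "ma (do_block src dst) = {13, 14, dst}"
  "mv (windows src dst) = {20, 21, 22, 23, 24, 25, 26, 27, 28, 29, 30, 31, 32}" "ma (windows src dst) = {13, 14, dst}"
  by (auto simp: do_block_def windows_def)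

lemma idf_le: "idf Q x \<le> r"
  and idf_image: "x \<in> Q ` {..<r} \<Longrightarrow> idf Q x < r \<and> Q (idf Q x) = x"
proof -
  have *: "idf Q x < r \<and> Q (idf Q x) = x" if "p < r" "Q p = x" for p
    using that LeastI[of "\<lambda>p. Q p = x" p] Least_le[of "\<lambda>p. Q p = x" p]
    unfolding idf_def by auto
  then show "x \<in> Q ` {..<r} \<Longrightarrow> idf Q x < r \<and> Q (idf Q x) = x" by auto
  show "idf Q x \<le> r" by (cases "\<exists>p < r. Q p = x") (use * less_imp_le in blast, auto simp: idf_def)
qed

text \<open>Comparing identifiers is faithful as soon as one of the characters occurs in the
  dictionary, although foreign characters are confused with each other. In the masks one side always
  comes from the pattern.\<close>

lemma idf_eq_iff:
  assumes "y \<in> Q ` {..<r}"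
  shows "idf Q y = idf Q x \<longleftrightarrow> x = y"
proof
  assume eq: "idf Q y = idf Q x"
  have "x \<in> Q ` {..<r}"
    using idf_image[OF assms] eq unfolding idf_def by (auto split: if_splits)
  then show "x = y" using idf_image[OF assms] idf_image[of x Q] eq by metis
qed simp

lemma do_block_wp:
  assumes S: "length S = n" and P: "length P = r"
    and v: "vv s vn = n" "vv s vr = r" "vv s vk = k" "vv s vK = 2 ^ k" "vv s vq = q"
    and k: "1 \<le> k" "k \<le> r + 1" "16 ^ k \<le> 16 * (n + 1)" and q: "q < r"
    and d: "dst \<noteq> 0" "src \<noteq> 0" "dst < narr" "src < narr" "dst \<noteq> aT" "dst \<noteq> aTB" "dst \<noteq> aM" "dst \<noteq> aV" "dst \<noteq> src" "src \<noteq> aV" "src \<noteq> aM" "dst \<noteq> aIP"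
    and T: "step_table k (aa s aT)" and B: "topbit_table k (aa s aTB)"
    and Q: "\<And>i. i < r \<Longrightarrow> P ! i \<in> Q ` {..<r}"
    and IP: "\<And>i. i < r \<Longrightarrow> aa s aIP i = idf Q (P ! i)"
    and IS: "\<And>i. i < n \<Longrightarrow> aa s src (Suc i) = idf Q (S ! i)"
    and M0: "\<And>c. c \<le> r \<Longrightarrow> aa s aM c = 0"
    and row: "\<And>i. i \<le> n \<Longrightarrow> aa s dst i = sg S P q i"
  shows "wp (do_block src dst) (\<lambda>t. vv t vq = min (q + k) r \<and> (\<forall>c \<le> r. aa t aM c = 0) \<and>
    (\<forall>i \<le> n. aa t dst i = sg S P (min (q + k) r) i) \<and> clk t \<le> clk s + 40 * n + 10 * k + 65) s"
proof -
  define p where "p = min k (r - q)"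
  have p: "0 < p" "p \<le> k" "q + p \<le> r" "q + p = min (q + k) r" using q k by (auto simp: p_def)
  have IPr: "aa s aIP i < r" if "i < r" for i using IP[OF that] idf_image[OF Q[OF that]] by simp
  have ok: "r < W" "q + p < W" using rn p nM MW by auto
  show ?thesis
    unfolding do_block_def
  proof (subst wp_Seq, subst wp_Assign, intro conjI, goal_cases)
    case 2
    show ?case
    proof (rule wp_SeqI[where P = "\<lambda>t. vv t ve = p \<and> clk t \<le> clk s + 3"], goal_cases)
      case 1
      then show ?case using v q by (auto simp: wp_simps p_def)
    next
      case (2 t)
      note ft = frame_vv[OF 2(2)] frame_aa[OF 2(2)]
      show ?case
        apply (simp only: wp_Seq)
        apply (rule wp_conseq[OF set_masks_wp[of _ p k q]])
        subgoal using 2(1) by simp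
        apply (simp_all add: ft v)[2]
        subgoal by (rule p(2))
        subgoal by (rule p(3))
        subgoal by (rule k(2))
        subgoal by (rule k(3))
        subgoal using IPr by (simp add: ft)
        subgoal using M0 by (simp add: ft)
        subgoal premises a for u
        proof -
          note fu = frame_vv[OF a(2)] frame_aa[OF a(2)]
          have M: "aa u aM c = pmask (aa s aIP) q p c" if "c \<le> r" for c using a(1) that by (simp add: ft)
          show ?thesis
            apply (simp only: wp_Seq)
            apply (rule wp_conseq[OF scan_text_wp[OF S P, of _ k p q dst src]])
            apply (simp_all add: fu ft v)[3]
            subgoal using 2(1) by (simp add: fu)
            subgoal using a(1) by simp
            subgoal by (rule k(1))
            subgoal by (rule k(2))
            subgoal by (rule k(3))
            subgoal by (rule p(1))
            subgoal by (rule p(2))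
            subgoal by (rule p(3))
            subgoal by (rule d(1))
            subgoal by (rule d(2))
            subgoal by (rule d(3))
            subgoal by (rule d(4))
            subgoal by (rule d(5))
            subgoal by (rule d(6))
            subgoal by (rule d(7))
            subgoal by (rule d(8))
            subgoal by (rule d(9))
            subgoal by (rule d(10))
            subgoal using T by (simp add: fu ft)
            subgoal using B by (simp add: fu ft)
            subgoal premises i for i
            proof -
              have e: "aa u src (Suc i) = idf Q (S ! i)" using IS[OF i] d by (simp add: fu ft)
              have "pmask (aa s aIP) q p (idf Q (S ! i)) < 2 ^ k"
                using pmask_less[of "aa s aIP" q p "idf Q (S ! i)"] power_increasing[OF p(2), of "2::nat"]
                by linarith
              moreover have "aa s aIP (q + h) = idf Q (S ! i) \<longleftrightarrow> S ! i = P ! (q + h)" if "h < p" for h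
                using IP[of "q + h"] Q[of "q + h"] idf_eq_iff[of "P ! (q + h)" Q "S ! i"] that p(3) by auto
              ultimately show ?thesis
                unfolding e using M[OF idf_le] idf_le pmask_bit[of _ p "aa s aIP" q "idf Q (S ! i)"] by simp
            qed
            subgoal using row d by (simp add: fu ft)
            subgoal using a(1) by simp
            subgoal premises b for w
            proof -
              note fw = frame_vv[OF b(2)] frame_aa[OF b(2)]
              show ?thesis
                apply (simp only: wp_Seq)
                apply (rule wp_conseq[OF clear_masks_wp[of _ p q]])
                subgoal using 2(1) by (simp add: fw fu)
                subgoal by (simp add: fw fu ft v)
                subgoal by (rule p(3))
                subgoal using IPr d(12)[THEN not_sym] by (simp add: fw fu ft)
                subgoal using M d(7)[THEN not_sym] d(12)[THEN not_sym] by (simp add: fw fu ft)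
                subgoal premises c for x
                proof -
                  note fx = frame_vv[OF c(2)] frame_aa[OF c(2)]
                  show ?thesis using a(1) b(1) c(1) 2(1) p ok d
                    by (simp add: wp_simps fx fw fu ft v)
                qed
                done
            qed
            done
        qed
        done
    qed
  qed (use v q ok in simp)
qed

definition windows_time :: "nat \<Rightarrow> nat" where
  "windows_time k = (r div k + 1) * (40 * n + 10 * k + 66) + 3 * n + 12"

lemma windows_wp:
  assumes S: "length S = n" and P: "length P = r"
    and v: "vv s vn = n" "vv s vr = r" "vv s vk = k" "vv s vK = 2 ^ k"
    and k: "1 \<le> k" "k \<le> r + 1" "16 ^ k \<le> 16 * (n + 1)"
    and d: "dst \<noteq> 0" "src \<noteq> 0" "dst < narr" "src < narr" "dst \<noteq> aT" "dst \<noteq> aTB" "dst \<noteq> aM" "dst \<noteq> aV" "dst \<noteq> src" "src \<noteq> aV" "src \<noteq> aM" "dst \<noteq> aIP"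
    and T: "step_table k (aa s aT)" and B: "topbit_table k (aa s aTB)"
    and Q: "\<And>i. i < r \<Longrightarrow> P ! i \<in> Q ` {..<r}"
    and IP: "\<And>i. i < r \<Longrightarrow> aa s aIP i = idf Q (P ! i)"
    and IS: "\<And>i. i < n \<Longrightarrow> aa s src (Suc i) = idf Q (S ! i)"
    and M0: "\<And>c. c \<le> r \<Longrightarrow> aa s aM c = 0"
  shows "wp (windows src dst) (\<lambda>t. (\<forall>c \<le> r. aa t aM c = 0) \<and>
    (\<forall>i \<le> n. aa t dst i = sg S P r i) \<and> clk t \<le> clk s + windows_time k) s"
proof -
  have ok: "0 < W" using nM MW by auto
  let ?B = "40 * n + 10 * k + 66"
  show ?thesis
    unfolding windows_def
    apply (simp only: wp_Seq)
    apply (rule wp_conseq[OF init_row_wp])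
    subgoal by (rule v(1))
    subgoal by (rule d(1))
    subgoal by (rule d(3))
    subgoal premises a for t
    proof -
      note ft = frame_vv[OF a(2)] frame_aa[OF a(2)]
      show ?thesis
        apply (simp add: wp_simps ok)
        apply (rule wp_While[where T = "clk s + (r div k + 1) * ?B + 3 * n + 9" and I = "\<lambda>t.
          (\<forall>c \<le> r. aa t aM c = 0) \<and> (\<forall>i \<le> n. aa t dst i = sg S P (vv t vq) i) \<and>
          (\<exists>u \<le> r div k + 1. vv t vq = min (k * u) r \<and> clk t \<le> clk s + u * ?B + 3 * n + 9)"])
        subgoal using a(1) M0 d(7)[THEN not_sym] by (auto simp: ft intro!: exI[of _ 0])
        subgoal premises p for u
        proof -
          obtain x where x: "x \<le> r div k + 1" "clk u \<le> clk s + x * ?B + 3 * n + 9" using p(1) by blast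
          have "x * ?B \<le> (r div k + 1) * ?B" using x(1) by (intro mult_le_mono1)
          then show ?thesis using x(2) by (intro conjI) (simp, linarith)
        qed
        subgoal premises p for u
        proof -
          note fu = frame_vv[OF p(2)] frame_aa[OF p(2)]
          obtain x where x: "x \<le> r div k + 1" "vv u vq = min (k * x) r" "clk u \<le> clk s + x * ?B + 3 * n + 9"
            using p(1) by blast
          have q: "vv u vq < r" using p(3) by (simp add: fu ft v)
          then have qx: "vv u vq = k * x" "k * x < r" using x(2) by auto
          then have "x \<le> r div k" using k(1) by (simp add: less_eq_div_iff_mult_less_eq mult.commute less_imp_le)
          then have x': "x + 1 \<le> r div k + 1" by simp
          show ?thesis
            apply (rule wp_conseq[OF do_block_wp[OF S P, of _ k "vv u vq" dst src Q]])
            apply (simp_all add: fu ft v)[4]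
            subgoal by simp
            subgoal by (rule k(1))
            subgoal by (rule k(2))
            subgoal by (rule k(3))
            subgoal by (rule q)
            subgoal by (rule d(1))
            subgoal by (rule d(2))
            subgoal by (rule d(3))
            subgoal by (rule d(4))
            subgoal by (rule d(5))
            subgoal by (rule d(6))
            subgoal by (rule d(7))
            subgoal by (rule d(8))
            subgoal by (rule d(9))
            subgoal by (rule d(10))
            subgoal by (rule d(11))
            subgoal by (rule d(12))
            subgoal using T d(5)[THEN not_sym] by (simp add: fu ft)
            subgoal using B d(6)[THEN not_sym] by (simp add: fu ft)
            subgoal by (rule Q)
            subgoal using IP d(12)[THEN not_sym] by (simp add: fu ft)
            subgoal using IS d(9-11) d(9)[THEN not_sym] by (simp add: fu ft)
            using p(1) apply simp_all[2]
            subgoal premises b for w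
              using b(1) x x' qx by (auto simp: add.commute intro!: exI[of _ "x + 1"])
            done
        qed
        subgoal premises p for u
        proof -
          note fu = frame_vv[OF p(2)] frame_aa[OF p(2)]
          obtain x where x: "x \<le> r div k + 1" "vv u vq = min (k * x) r" "clk u \<le> clk s + x * ?B + 3 * n + 9"
            using p(1) by blast
          have "x * ?B \<le> (r div k + 1) * ?B" using x(1) by (intro mult_le_mono1)
          then have "clk u + 1 \<le> clk s + windows_time k" using x(3) unfolding windows_time_def by linarith
          moreover have "vv u vq = r" using x(2) p(3) by (simp add: fu ft v)
          ultimately show ?thesis using p(1) by simp
        qed
        done
    qed
    done
qed

end

section \<open>Tables of longest common subsequences\<close>

context sized begin

text \<open>This is diagonal -1: a prefix of length \<open>u - 1\<close> has no subsequence of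
  length \<open>u\<close>, so every threshold is the default \<open>n + 1\<close> except at
  \<open>u = 0\<close>.\<close>

definition init_R :: com where
  "init_R = Write aR (N 0) (N 0);; vi ::= N 1;;
     WHILE BLe (V vi) (V vn) DO (Write aR (V vi) (V vn \<oplus> N 1);; vi ::= V vi \<oplus> N 1)"

definition find_char :: "nat \<Rightarrow> com" where
  "find_char t = WHILE BAnd (BLt (V vj) (V vh)) (BNe (Arr t (V vj)) (V vx)) DO vj ::= V vj \<oplus> N 1"

text \<open>The row of diagonal \<open>d\<close> overwrites that of diagonal \<open>d - 1\<close>. The search for the next match never
  returns to an earlier position of the second string within a row.\<close>

definition next_row :: "nat \<Rightarrow> nat \<Rightarrow> com" where
  "next_row s t = vp ::= N 1;;
     WHILE BLe (V vp \<oplus> V vg) (V vn) DO (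
       vx ::= Arr s (V vp \<oplus> V vg);; vh ::= Arr aR (V vp);; vj ::= Arr aR (V vp \<ominus> N 1) \<oplus> N 1;;
       find_char t;;
       (IF BLt (V vj) (V vh) THEN Write aR (V vp) (V vj) ELSE SKIP);;
       vp ::= V vp \<oplus> N 1)"

text \<open>The first diagonal \<open>d\<close> on which the last threshold, that of
  \<open>n - d\<close> characters, does not exceed \<open>n\<close> is \<open>n - lcs\<close>. The
  value must be known before the tables are laid out, as \<open>l + 1\<close> is their row length;
  therefore only one row is kept here and the rows are computed again in
  \<open>fill_table\<close>.\<close>

definition lcs_length :: "nat \<Rightarrow> nat \<Rightarrow> com" where
  "lcs_length s t = init_R;; vg ::= N 0;; next_row s t;;
     (WHILE BLt (V vn) (Arr aR (V vn \<ominus> V vg)) DO (vg ::= V vg \<oplus> N 1;; next_row s t));;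
     vD ::= V vg;; vl ::= V vn \<ominus> V vg"

definition copy_row :: "nat \<Rightarrow> com" where
  "copy_row f = vi ::= N 0;;
     WHILE BLe (V vi) (V vl) DO (Write f (V vt \<oplus> V vi) (Arr aR (V vi));; vi ::= V vi \<oplus> N 1)"

definition fill_table :: "nat \<Rightarrow> nat \<Rightarrow> nat \<Rightarrow> com" where
  "fill_table s t f = init_R;; vg ::= N 0;; vt ::= N 0;;
     WHILE BLe (V vg) (V vD) DO (
       next_row s t;; copy_row f;; vt ::= V vt \<oplus> V vl \<oplus> N 1;; vg ::= V vg \<oplus> N 1)"

lemma mv_tables [simp]:
  "mv init_R = {20}" "ma init_R = {17}" "mv (find_char t) = {21}" "ma (find_char t) = {}"
  "mv (next_row s t) = {21, 24, 26, 28}" "ma (next_row s t) = {17}"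
  "mv (lcs_length s t) = {14, 15, 20, 21, 23, 24, 26, 28}" "ma (lcs_length s t) = {17}"
  "mv (copy_row f) = {20}" "ma (copy_row f) = {f}"
  "mv (fill_table s t f) = {20, 21, 23, 24, 25, 26, 28}" "ma (fill_table s t f) = {17, f}"
  by (auto simp: init_R_def find_char_def next_row_def lcs_length_def copy_row_def fill_table_def)

lemma init_R_wp:
  assumes "vv s vn = n"
  shows "wp init_R (\<lambda>t. aa t aR 0 = 0 \<and> (\<forall>i. 1 \<le> i \<longrightarrow> i \<le> n \<longrightarrow> aa t aR i = n + 1) \<and> clk t \<le> clk s + 3 * n + 6) s"
proof -
  have ok: "Suc 0 < W" "0 < W" "idx_ok 17 0" using nM MW by (auto simp: idx_ok_def narr_def)
  show ?thesis
    unfolding init_R_def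
    apply (simp add: wp_simps ok)
    apply (rule wp_While[where T = "clk s + 3 * n + 5" and I = "\<lambda>t. 1 \<le> vv t vi \<and> vv t vi \<le> n + 1 \<and>
      aa t aR 0 = 0 \<and> (\<forall>i. 1 \<le> i \<longrightarrow> i < vv t vi \<longrightarrow> aa t aR i = n + 1) \<and> clk t \<le> clk s + 3 * vv t vi"])
    apply simp_all[2]
    subgoal premises p for t
      using p(1,3) assms nM MW frame_vv[OF p(2)]
      by (auto simp: wp_simps idx_ok_def narr_def less_Suc_eq)
    subgoal premises p for t
      using p(1,3) assms frame_vv[OF p(2)] by auto
    done
qed

lemma find_char_wp:
  assumes v: "vv s vh = h" "vv s vx = x" "vv s vj = j" and h: "h \<le> n + 1" "j \<le> n + 2" and t: "t \<noteq> 0" "t < narr"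
  shows "wp (find_char t) (\<lambda>u. j \<le> vv u vj \<and> vv u vj \<le> max j h \<and>
    (\<forall>i. j \<le> i \<longrightarrow> i < vv u vj \<longrightarrow> aa s t i \<noteq> x) \<and> (vv u vj < h \<longrightarrow> aa s t (vv u vj) = x) \<and>
    clk u + 2 * j \<le> clk s + 2 * vv u vj + 1) s"
  unfolding find_char_def
proof (rule wp_While[where T = "clk s + 2 * (n + 2)" and I = "\<lambda>u. j \<le> vv u vj \<and> vv u vj \<le> max j h \<and>
    (\<forall>i. j \<le> i \<longrightarrow> i < vv u vj \<longrightarrow> aa s t i \<noteq> x) \<and> clk u + 2 * j \<le> clk s + 2 * vv u vj"], goal_cases)
  case (2 u)
  note fr = frame_vv[OF 2(2)]
  show ?case
    using 2(1) v h t nM MW by (auto simp: idx_ok_def fr)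
next
  case (3 u)
  note fr = frame_vv[OF 3(2)] frame_aa[OF 3(2)]
  show ?case using 3(1,3) v h nM MW by (auto simp: wp_simps fr less_Suc_eq)
next
  case (4 u)
  note fr = frame_vv[OF 4(2)] frame_aa[OF 4(2)]
  show ?case using 4(1,3) v by (auto simp: fr)
qed (use v in auto)

lemma next_row_wp:
  assumes XY: "length X = n" "length Y = n" "str s a X" "str s b Y"
    and v: "vv s vn = n" "vv s vg = d" and d: "d \<le> n"
    and ab: "a \<noteq> 0" "a < narr" "b \<noteq> 0" "b < narr" "a \<noteq> aR" "b \<noteq> aR"
    and R0: "aa s aR 0 = 0" and R: "\<And>u. 1 \<le> u \<Longrightarrow> u \<le> n - d \<Longrightarrow> aa s aR u = FF X Y u (u + d - 1)"
  shows "wp (next_row a b) (\<lambda>t. (\<forall>u \<le> n - d. aa t aR u = FF X Y u (u + d)) \<and> clk t \<le> clk s + 11 * n + 15) s"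
proof -
  have ok: "Suc 0 < W" "0 < W" using nM MW by auto
  have FFn: "FF X Y u i \<le> n + 1" for u i using FF_le[of X Y u i] XY by simp
  show ?thesis
    unfolding next_row_def
    apply (simp add: wp_simps ok)
    \<comment> \<open>Overwriting is harmless: entry \<open>vp - 1\<close> is needed from the new
      diagonal and entry \<open>vp\<close> from the old one. The search is charged to the growth
      from entry \<open>vp - 1\<close> to entry \<open>vp\<close> of the new diagonal, and these
      charges telescope to at most \<open>n + 1\<close>.\<close>
    apply (rule wp_While[where T = "clk s + 11 * n + 14" and I = "\<lambda>t. 1 \<le> vv t vp \<and> vv t vp \<le> n - d + 1 \<and>
      (\<forall>u < vv t vp. aa t aR u = FF X Y u (u + d)) \<and>
      (\<forall>u. vv t vp \<le> u \<longrightarrow> u \<le> n - d \<longrightarrow> aa t aR u = FF X Y u (u + d - 1)) \<and>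
      clk t \<le> clk s + 2 * aa t aR (vv t vp - 1) + 8 * vv t vp"])
    subgoal using R0 R by (auto simp: less_Suc_eq)
    subgoal premises p for t
    proof -
      note fr = frame_vv[OF p(2)] frame_aa[OF p(2)]
      have "aa t aR (vv t vp - 1) \<le> n + 1" using p(1) FFn by (auto simp: less_Suc_eq)
      then show ?thesis using p(1) v d nM MW by (auto simp: fr)
    qed
    subgoal premises p for t
    proof -
      note fr = frame_vv[OF p(2)] frame_aa[OF p(2)]
      define q where "q = vv t vp - 1"
      have q: "vv t vp = Suc q" "Suc q + d \<le> n" using p(1,3) by (auto simp: q_def fr v)
      have Rq: "aa t aR q = FF X Y q (q + d)" and Rs: "aa t aR (Suc q) = FF X Y (Suc q) (q + d)"
        using p(1) q by auto
      have x: "aa s a (Suc (q + d)) = X ! (q + d)" using XY q by (simp add: str_def)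
      have iok: "idx_ok 17 (Suc q)" "idx_ok 17 q" "idx_ok a (Suc (q + d))" "Suc (q + d) < W" "Suc q < W" "Suc (Suc q) < W"
        "Suc (FF X Y q (q + d)) < W"
        using q ab FFn[of q "q + d"] nM MW by (auto simp: idx_ok_def narr_def)
      have mono: "FF X Y q (q + d) \<le> FF X Y (Suc q) (Suc (q + d))"
        using FF_diag_mono[of 1 1 X Y q "q + d"] by simp
      show ?thesis
        apply (simp add: wp_simps iok ok q fr v ab x Rq Rs)
        apply (rule wp_conseq[OF find_char_wp[of _ "FF X Y (Suc q) (q + d)" "X ! (q + d)" "Suc (FF X Y q (q + d))" b]])
        apply simp_all[3]
        subgoal by (rule FFn)
        subgoal using FFn by simp
        subgoal by (rule ab)
        subgoal by (rule ab)
        subgoal premises a for u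
        proof -
          note fu = frame_vv[OF a(2)] frame_aa[OF a(2)]
          let ?l = "FF X Y q (q + d)" and ?h = "FF X Y (Suc q) (q + d)" and ?j = "vv u vj"
          have Yj: "aa s b j' = Y ! (j' - 1)" if "?l < j'" "j' < ?h" for j'
            using that XY FFn[of "Suc q" "q + d"] strD[of s b Y j'] by auto
          have j: "Suc ?l \<le> ?j" "?j \<le> max (Suc ?l) ?h" "\<And>i. Suc ?l \<le> i \<Longrightarrow> i < ?j \<Longrightarrow> aa s b i \<noteq> X ! (q + d)"
            "?j < ?h \<Longrightarrow> aa s b ?j = X ! (q + d)" "clk u + 2 * Suc ?l \<le> clk t + 2 * ?j + 5"
            using a(1) ab by (auto simp: fr)
          define F where "F = FF X Y (Suc q) (Suc (q + d))"
          have F: "F = (if ?j < ?h then ?j else ?h)" "?j \<le> Suc F"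
          proof -
            show F: "F = (if ?j < ?h then ?j else ?h)"
            proof (cases "?j < ?h")
              case True
              have "F = ?j" unfolding F_def
                by (rule FF_Suc_match) (use True j Yj q XY in auto)
              then show ?thesis using True by simp
            next
              case False
              have "F = ?h" unfolding F_def
              proof (rule FF_Suc_nomatch)
                fix i assume "?l < i" "i < ?h"
                then show "Y ! (i - 1) \<noteq> X ! (q + d)" using False j(3)[of i] Yj[of i] by auto
              qed (use q XY in auto)
              then show ?thesis using False by simp
            qed
            show "?j \<le> Suc F"
              using j(2) F mono unfolding F_def[symmetric] by (auto split: if_splits)
          qed
          have c: "clk u + 2 * ?l \<le> clk t + 2 * F + 5" using j(5) F(2) by simp
          have lF: "?l \<le> F" using mono by (simp add: F_def)
          have inv: "clk t \<le> clk s + 2 * ?l + 8 * Suc q" using p(1) q Rq by simp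
          show ?thesis
          proof (cases "?j < ?h")
            case True
            then show ?thesis
              using F c lF inv p(1) q iok ok
              by (auto simp: wp_simps fu fr F_def[symmetric] less_Suc_eq)
          next
            case False
            then show ?thesis
              using F c lF inv p(1) q iok ok Rs
              by (auto simp: wp_simps fu fr F_def[symmetric] less_Suc_eq)
          qed
        qed
        done
    qed
    subgoal premises p for t
    proof -
      note fr = frame_vv[OF p(2)] frame_aa[OF p(2)]
      have e: "vv t vp = Suc (n - d)" using p(1,3) d by (auto simp: fr v)
      have "aa t aR (n - d) \<le> n + 1" using p(1) e FFn by simp
      then show ?thesis using p(1) e by auto
    qed
    done
qed

lemma lcs_length_wp:
  assumes XY: "length X = n" "length Y = n" "str s a X" "str s b Y"
    and v: "vv s vn = n"
    and ab: "a \<noteq> 0" "a < narr" "b \<noteq> 0" "b < narr" "a \<noteq> aR" "b \<noteq> aR"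
  shows "wp (lcs_length a b) (\<lambda>t. vv t vl = lcs X Y \<and> vv t vD = n - lcs X Y \<and>
    clk t \<le> clk s + (n - lcs X Y + 1) * (11 * n + 20) + 3 * n + 15) s"
proof -
  have ok: "Suc 0 < W" "0 < W" "n < W" using nM MW by auto
  let ?D = "n - lcs X Y"
  have strs: "str t a X" "str t b Y" if "aa t a = aa s a" "aa t b = aa s b" for t
    using that XY by (auto simp: str_def)
  have ll: "lcs X Y \<le> n" using lcs_le[of X Y] XY by simp
  show ?thesis
    unfolding lcs_length_def
    apply (simp only: wp_Seq)
    apply (rule wp_conseq[OF init_R_wp[OF v]])
    subgoal premises a for t
    proof -
      note ft = frame_vv[OF a(2)] frame_aa[OF a(2)]
      show ?thesis
        apply (simp add: wp_simps ok)
        apply (rule wp_conseq[OF next_row_wp[OF XY(1,2), of _ a b 0]])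
        subgoal by (rule strs) (use ab in \<open>simp_all add: ft\<close>)
        subgoal by (rule strs) (use ab in \<open>simp_all add: ft\<close>)
        subgoal by (simp add: ft v)
        apply simp_all[2]
        subgoal by (rule ab)
        subgoal by (rule ab)
        subgoal by (rule ab)
        subgoal by (rule ab)
        subgoal by (rule ab)
        subgoal by (rule ab)
        subgoal using a(1) by simp
        subgoal using a(1) XY by (simp add: FF_inf)
        subgoal premises b for u
        proof -
          note fu = frame_vv[OF b(2)] frame_aa[OF b(2)]
          show ?thesis
            apply (simp only: wp_Seq)
            apply (rule wp_While[where T = "clk s + (?D + 1) * (11 * n + 20) + 3 * n + 10" and I = "\<lambda>t.
              vv t vg \<le> ?D \<and> (\<forall>u \<le> n - vv t vg. aa t aR u = FF X Y u (u + vv t vg)) \<and>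
              clk t \<le> clk s + (vv t vg + 1) * (11 * n + 20) + 3 * n + 10"])
            subgoal using a(1) b(1) by (simp add: fu)
            subgoal premises p for t
            proof -
              note fr = frame_vv[OF p(2)] frame_aa[OF p(2)]
              have "(vv t vg + 1) * (11 * n + 20) \<le> (?D + 1) * (11 * n + 20)" using p(1) by (intro mult_le_mono1) simp
              moreover have "bsafe (BLt (V vn) (Arr aR (V vn \<ominus> V vg))) t"
                using p(1) ok nM MW by (auto simp: fr fu ft v idx_ok_def narr_def)
              ultimately show ?thesis using p(1) by linarith
            qed
            subgoal premises p for t
            proof -
              note fr = frame_vv[OF p(2)] frame_aa[OF p(2)]
              have g: "vv t vg \<le> n" using p(1) by auto
              have "n < aa t aR (n - vv t vg)" using p(3) by (simp add: fr fu ft v)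
              then have "\<not> FF X Y (n - vv t vg) n \<le> n" using p(1) g by simp
              then have "\<not> n - vv t vg \<le> lcs X Y"
                using FF_iff[of n Y X "n - vv t vg" n] XY cs_lcs[of X n Y n] by simp
              then have lt: "vv t vg < ?D" by simp
              then have W1: "Suc (vv t vg) < W" using ok by simp
              show ?thesis
                apply (simp add: wp_simps ok W1)
                apply (rule wp_conseq[OF next_row_wp[OF XY(1,2), of _ a b "Suc (vv t vg)"]])
                subgoal by (rule strs) (use ab in \<open>simp_all add: fr fu ft\<close>)
                subgoal by (rule strs) (use ab in \<open>simp_all add: fr fu ft\<close>)
                subgoal by (simp add: fr fu ft v)
                subgoal by simp
                subgoal using lt by simp
                subgoal by (rule ab)
                subgoal by (rule ab)
                subgoal by (rule ab)
                subgoal by (rule ab)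
                subgoal by (rule ab)
                subgoal by (rule ab)
                using p(1) apply simp_all[2]
                subgoal premises w for x
                  using p(1) w(1) lt frame_vv[OF w(2)] by simp
                done
            qed
            subgoal premises p for t
            proof -
              note fr = frame_vv[OF p(2)] frame_aa[OF p(2)]
              have g: "vv t vg \<le> n" using p(1) by auto
              have "aa t aR (n - vv t vg) \<le> n" using p(3) by (simp add: fr fu ft v)
              then have "FF X Y (n - vv t vg) n \<le> n" using p(1) g by simp
              then have "n - vv t vg \<le> lcs X Y"
                using FF_iff[of n Y X "n - vv t vg" n] XY cs_lcs[of X n Y n] by simp
              then have "vv t vg = ?D" using p(1) by auto
              then show ?thesis using p(1) ok ll by (simp add: wp_simps fr fu ft v)
            qed
            done
        qed
        done
    qed
    done
qed

lemma copy_row_wp: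
  assumes v: "vv s vl = l" "vv s vt = c" and f: "f \<noteq> 0" "f < narr" "f \<noteq> aR" and l: "l \<le> n" "c + l < M"
  shows "wp (copy_row f) (\<lambda>t. (\<forall>i \<le> l. aa t f (c + i) = aa s aR i) \<and>
    (\<forall>i < c. aa t f i = aa s f i) \<and> clk t \<le> clk s + 3 * l + 6) s"
proof -
  have ok: "Suc 0 < W" "0 < W" using nM MW by auto
  show ?thesis
    unfolding copy_row_def
    apply (simp add: wp_simps ok)
    apply (rule wp_While[where T = "clk s + 3 * l + 4" and I = "\<lambda>t. vv t vi \<le> l + 1 \<and>
      (\<forall>i < vv t vi. aa t f (c + i) = aa s aR i) \<and> (\<forall>i < c. aa t f i = aa s f i) \<and>
      clk t \<le> clk s + 3 * vv t vi + 1"])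
    apply simp_all[2]
    subgoal premises p for t
      using p(1,3) v f l nM MW frame_vv[OF p(2)] frame_aa[OF p(2)]
      by (auto simp: wp_simps idx_ok_def narr_def less_Suc_eq)
    subgoal premises p for t
      using p(1,3) v frame_vv[OF p(2)] by auto
    done
qed

text \<open>Diagonals are stored one after another, each cut off at \<open>l\<close> because there
  are no longer common subsequences.\<close>

definition is_table :: "nat list \<Rightarrow> nat list \<Rightarrow> nat \<Rightarrow> nat \<Rightarrow> (nat \<Rightarrow> nat) \<Rightarrow> bool" where
  "is_table X Y l D F \<longleftrightarrow> (\<forall>d \<le> D. \<forall>u \<le> l. F (d * (l + 1) + u) = FF X Y u (u + d))"

lemma fill_table_wp:
  assumes XY: "length X = n" "length Y = n" "str s a X" "str s b Y"
    and v: "vv s vn = n" "vv s vl = l" "vv s vD = n - l" and l: "l \<le> n" "(l + 1) * (n - l + 1) \<le> M"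
    and ab: "a \<noteq> 0" "a < narr" "b \<noteq> 0" "b < narr" "a \<noteq> aR" "b \<noteq> aR"
    and f: "f \<noteq> 0" "f < narr" "f \<noteq> aR" "f \<noteq> a" "f \<noteq> b"
  shows "wp (fill_table a b f) (\<lambda>t. is_table X Y l (n - l) (aa t f) \<and>
    clk t \<le> clk s + (n - l + 1) * (14 * n + 25) + 3 * n + 15) s"
proof -
  have ok: "Suc 0 < W" "0 < W" "n < W" using nM MW by auto
  let ?D = "n - l"
  have strs: "str t a X" "str t b Y" if "aa t a = aa s a" "aa t b = aa s b" for t
    using that XY by (auto simp: str_def)
  show ?thesis
    unfolding fill_table_def
    apply (simp only: wp_Seq)
    apply (rule wp_conseq[OF init_R_wp[OF v(1)]])
    subgoal premises a for t
    proof -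
      note ft = frame_vv[OF a(2)] frame_aa[OF a(2)]
      show ?thesis
        apply (simp add: wp_simps ok)
        apply (rule wp_While[where T = "clk s + (?D + 1) * (14 * n + 25) + 3 * n + 10" and I = "\<lambda>t.
          vv t vg \<le> ?D + 1 \<and> vv t vt = vv t vg * (l + 1) \<and> aa t aR 0 = 0 \<and>
          (\<forall>u. 1 \<le> u \<longrightarrow> u \<le> n - vv t vg \<longrightarrow> aa t aR u = FF X Y u (u + vv t vg - 1)) \<and>
          (\<forall>d < vv t vg. \<forall>u \<le> l. aa t f (d * (l + 1) + u) = FF X Y u (u + d)) \<and>
          clk t \<le> clk s + vv t vg * (14 * n + 25) + 3 * n + 10"])
        subgoal using a(1) XY by (simp add: FF_inf)
        subgoal premises p for t
        proof -
          have "vv t vg * (14 * n + 25) \<le> (?D + 1) * (14 * n + 25)" using p(1) by (intro mult_le_mono1) simp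
          then show ?thesis using p(1) by (intro conjI) (simp, linarith)
        qed
        subgoal premises p for t
        proof -
          note fr = frame_vv[OF p(2)] frame_aa[OF p(2)]
          have g: "vv t vg \<le> ?D" using p(3) by (simp add: fr ft v)
          then have gn: "vv t vg \<le> n" "l \<le> n - vv t vg" "Suc (vv t vg) < W" using l nM MW by auto
          have c: "vv t vg * (l + 1) + (l + 1) \<le> M"
          proof -
            have "(vv t vg + 1) * (l + 1) \<le> (?D + 1) * (l + 1)" using g by (intro mult_le_mono1) simp
            then show ?thesis using l(2) by (simp add: algebra_simps)
          qed
          have gt: "vv t vt = vv t vg * (l + 1)" using p(1) by blast
          show ?thesis
            apply (simp only: wp_Seq)
            apply (rule wp_conseq[OF next_row_wp[OF XY(1,2), of _ a b "vv t vg"]])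
            subgoal by (rule strs) (use ab f in \<open>simp_all add: fr ft\<close>)
            subgoal by (rule strs) (use ab f in \<open>simp_all add: fr ft\<close>)
            subgoal by (simp add: fr ft v)
            subgoal by simp
            subgoal by (rule gn)
            subgoal by (rule ab)
            subgoal by (rule ab)
            subgoal by (rule ab)
            subgoal by (rule ab)
            subgoal by (rule ab)
            subgoal by (rule ab)
            using p(1) apply simp_all[2]
            subgoal premises b for u
            proof -
              note fu = frame_vv[OF b(2)] frame_aa[OF b(2)]
              show ?thesis
                apply (simp only: wp_Seq)
                apply (rule wp_conseq[OF copy_row_wp[of _ l "vv t vg * (l + 1)" f]])
                subgoal by (simp add: fu fr ft v)
                subgoal using gt by (simp add: fu)
                subgoal by (rule f)
                subgoal by (rule f)
                subgoal by (rule f)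
                subgoal by (rule l)
                subgoal using c by simp
                subgoal premises w for x
                proof -
                  note fx = frame_vv[OF w(2)] frame_aa[OF w(2)]
                  have old: "aa x f (d * (l + 1) + i) = FF X Y i (i + d)" if "d < vv t vg" "i \<le> l" for d i
                  proof -
                    have "d * (l + 1) + i < (d + 1) * (l + 1)" using that(2) by simp
                    also have "\<dots> \<le> vv t vg * (l + 1)" using that(1) by (intro mult_le_mono1) simp
                    finally have "aa x f (d * (l + 1) + i) = aa u f (d * (l + 1) + i)" using w(1) by blast
                    then show ?thesis using p(1) that f by (simp add: fu)
                  qed
                  have new: "aa x f (vv t vg * (l + 1) + i) = FF X Y i (i + vv t vg)" if "i \<le> l" for i
                    using w(1) b(1) that gn(2) by simp
                  have r: "aa x aR i = FF X Y i (i + vv t vg)" if "i \<le> n - vv t vg" for i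
                    using b(1) f(3)[THEN not_sym] that by (simp add: fx)
                  have ot: "vv x vt = vv t vg * (l + 1)" "vv x vl = l" "vv x vg = vv t vg"
                    using gt by (simp_all add: fx fu fr ft v)
                  have Wc: "vv t vg * (l + 1) + l + 1 < W" "vv t vg * (l + 1) + l < W" using c MW by auto
                  have cl: "clk x + 3 \<le> clk s + (vv t vg + 1) * (14 * n + 25) + 3 * n + 10"
                    using w(1) b(1) p(1) l(1) by (simp add: algebra_simps)
                  have nx: "\<forall>d < Suc (vv t vg). \<forall>i \<le> l. aa x f (d * (l + 1) + i) = FF X Y i (i + d)"
                    using old new by (auto simp: less_Suc_eq)
                  show ?thesis
                    using nx r cl Wc ot g gn ok by (simp add: wp_simps)
                qed
                done
            qed
            done
        qed
        subgoal premises p for t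
        proof -
          note fr = frame_vv[OF p(2)] frame_aa[OF p(2)]
          have "vv t vg = Suc ?D" using p(1,3) by (simp add: fr ft v)
          then show ?thesis using p(1) by (simp add: is_table_def)
        qed
        done
    qed
    done
qed

end

section \<open>Combining prefixes, windows and suffixes\<close>

abbreviation (input) "vbest \<equiv> (40::nat)"
abbreviation (input) "vbs \<equiv> (41::nat)"
abbreviation (input) "vbd \<equiv> (42::nat)"
abbreviation (input) "vbf \<equiv> (43::nat)"
abbreviation (input) "vcs \<equiv> (44::nat)"
abbreviation (input) "vcd \<equiv> (45::nat)"
abbreviation (input) "vcf \<equiv> (46::nat)"

text \<open>The shorter suffix selects the table, since only its diagonals are bounded by
  \<open>D\<close>. A length \<open>t\<close> on a diagonal beyond \<open>D\<close> is below the
  length guaranteed by \<open>cs_lower\<close>, and the test succeeds without a lookup.\<close>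

definition suffix_test :: "nat \<Rightarrow> nat \<Rightarrow> com" where
  "suffix_test fr gr = ve ::= V vn \<ominus> V vi;; vm ::= V vn \<ominus> V vj;;
     (IF BLe (V ve) (V vm) THEN
       (IF BLe (V vp) (V ve) THEN
         (IF BLt (V vD) (V ve \<ominus> V vp) THEN vf ::= N 1 ELSE
           (IF BLe (Arr fr ((V ve \<ominus> V vp) \<otimes> (V vl \<oplus> N 1) \<oplus> V vp)) (V vm) THEN vf ::= N 1 ELSE SKIP))
        ELSE SKIP)
      ELSE
       (IF BLe (V vp) (V vm) THEN
         (IF BLt (V vD) (V vm \<ominus> V vp) THEN vf ::= N 1 ELSE
           (IF BLe (Arr gr ((V vm \<ominus> V vp) \<otimes> (V vl \<oplus> N 1) \<oplus> V vp)) (V ve) THEN vf ::= N 1 ELSE SKIP))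
        ELSE SKIP))"

definition lower_suffix :: "nat \<Rightarrow> nat \<Rightarrow> com" where
  "lower_suffix fr gr = vf ::= N 0;;
     WHILE BEq (V vf) (N 0) DO (
       suffix_test fr gr;; (IF BEq (V vf) (N 0) THEN vp ::= V vp \<ominus> N 1 ELSE SKIP))"

definition advance :: "nat \<Rightarrow> com" where
  "advance ay = WHILE BAnd (BLe (V vj) (V vn)) (BLe (Arr ay (V vj)) (V vh)) DO vj ::= V vj \<oplus> N 1"

definition update_best :: "nat \<Rightarrow> com" where
  "update_best fl =
     (IF BLt (V vbest) (V vt \<oplus> V vp \<oplus> N 1) THEN
       (vbest ::= V vt \<oplus> V vp \<oplus> N 1;; vbs ::= V vt;; vbd ::= V vg;; vbf ::= N fl;; vcs ::= V vp;;
        (IF BLe (V ve) (V vm) THEN (vcf ::= N fl;; vcd ::= V ve \<ominus> V vp)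
         ELSE (vcf ::= N (1 - fl);; vcd ::= V vm \<ominus> V vp)))
      ELSE SKIP)"

definition scan_pair :: "nat \<Rightarrow> nat \<Rightarrow> nat \<Rightarrow> nat \<Rightarrow> com" where
  "scan_pair ay fr gr fl = advance ay;;
     (IF BLe (V vj) (V vn) THEN (lower_suffix fr gr;; update_best fl) ELSE SKIP)"

definition scan_entry :: "nat \<Rightarrow> nat \<Rightarrow> nat \<Rightarrow> nat \<Rightarrow> nat \<Rightarrow> com" where
  "scan_entry ay f fr gr fl =
       (IF BLt (V vg) (V vx) THEN
         (vt ::= V vx \<ominus> V vg \<ominus> N 1;;
          (IF BLe (V vt) (V vl) THEN
            (vh ::= Arr f (V vq \<oplus> V vt);;
             (IF BLe (V vh) (V vn) THEN scan_pair ay fr gr fl ELSE SKIP))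
           ELSE SKIP))
        ELSE SKIP)"

text \<open>On a fixed diagonal, moving the first window end to the right lengthens the prefix part
  and raises its threshold. Hence the earliest admissible window of the second string moves right as
  well, and the longest suffix part can only shrink: \<open>vj\<close> and \<open>vp\<close> each
  move in one direction.\<close>

definition scan_diag :: "nat \<Rightarrow> nat \<Rightarrow> nat \<Rightarrow> nat \<Rightarrow> nat \<Rightarrow> nat \<Rightarrow> com" where
  "scan_diag ax ay f fr gr fl = vj ::= N 0;; vp ::= V vl;; vi ::= N 0;;
     WHILE BLe (V vi) (V vn) DO (
       vx ::= Arr ax (V vi);;
       scan_entry ay f fr gr fl;;
       vi ::= V vi \<oplus> N 1)"

definition scan_all :: "nat \<Rightarrow> nat \<Rightarrow> nat \<Rightarrow> nat \<Rightarrow> nat \<Rightarrow> nat \<Rightarrow> com" where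
  "scan_all ax ay f fr gr fl = vg ::= N 0;; vq ::= N 0;;
     WHILE BLe (V vg) (V vD) DO (
       scan_diag ax ay f fr gr fl;; vq ::= V vq \<oplus> V vl \<oplus> N 1;; vg ::= V vg \<oplus> N 1)"

lemma mv_scan_all [simp]:
  "mv (suffix_test fr gr) = {22, 27, 29}" "ma (suffix_test fr gr) = {}"
  "mv (lower_suffix fr gr) = {22, 24, 27, 29}" "ma (lower_suffix fr gr) = {}"
  "mv (advance ay) = {21}" "ma (advance ay) = {}"
  "mv (update_best fl) = {40, 41, 42, 43, 44, 45, 46}" "ma (update_best fl) = {}"
  "mv (scan_pair ay fr gr fl) = {21, 22, 24, 27, 29, 40, 41, 42, 43, 44, 45, 46}" "ma (scan_pair ay fr gr fl) = {}"
  "mv (scan_entry ay f fr gr fl) = {21, 22, 24, 25, 27, 28, 29, 40, 41, 42, 43, 44, 45, 46}" "ma (scan_entry ay f fr gr fl) = {}"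
  "mv (scan_diag ax ay f fr gr fl) = {20, 21, 22, 24, 25, 26, 27, 28, 29, 40, 41, 42, 43, 44, 45, 46}"
  "ma (scan_diag ax ay f fr gr fl) = {}"
  "mv (scan_all ax ay f fr gr fl) = {20, 21, 22, 23, 24, 25, 26, 27, 28, 29, 30, 40, 41, 42, 43, 44, 45, 46}"
  "ma (scan_all ax ay f fr gr fl) = {}"
  by (auto simp: suffix_test_def lower_suffix_def advance_def update_best_def scan_pair_def scan_entry_def scan_diag_def scan_all_def)

text \<open>One proof serves both orders of the strings. \<open>K\<close> is left abstract because
  the records of both passes must satisfy one and the same predicate, stated for \<open>A\<close>
  and \<open>B\<close> in fixed order. A suffix found through \<open>gr\<close>, the table for the
  exchanged order, carries the opposite flag.\<close>

locale scanning = sized W M Z n r for W M Z n r :: nat +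
  fixes X Y P :: "nat list" and l :: nat and ax ay f fr gr fl :: nat
    and K :: "nat \<Rightarrow> nat \<Rightarrow> nat \<Rightarrow> nat \<Rightarrow> nat \<Rightarrow> nat \<Rightarrow> bool"
  assumes X: "length X = n" and Y: "length Y = n" and P: "length P = r" and l: "l = lcs X Y"
    and lM: "(l + 1) * (n - l + 1) \<le> M"
    and ids: "0 < ax" "0 < ay" "0 < f" "0 < fr" "0 < gr" "ax < narr" "ay < narr" "f < narr" "fr < narr" "gr < narr"
    and fl: "fl \<le> 1"
    and K: "\<And>e e' s d s2 d2. \<lbrakk>e \<le> n; e' \<le> n; s + d + 1 = sg X P r e; FF X Y s (s + d) < sg Y P r e';
        d \<le> n - l; s \<le> l; s2 \<le> l; d2 \<le> n - l; s2 + d2 = n - e; FF (rev X) (rev Y) s2 (s2 + d2) \<le> n - e'\<rbrakk>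
      \<Longrightarrow> K fl s d fl s2 d2"
    and K': "\<And>e e' s d s2 d2. \<lbrakk>e \<le> n; e' \<le> n; s + d + 1 = sg X P r e; FF X Y s (s + d) < sg Y P r e';
        d \<le> n - l; s \<le> l; s2 \<le> l; d2 \<le> n - l; s2 + d2 = n - e'; FF (rev Y) (rev X) s2 (s2 + d2) \<le> n - e\<rbrakk>
      \<Longrightarrow> K fl s d (1 - fl) s2 d2"
begin

abbreviation "D \<equiv> n - l"

abbreviation suf :: "nat \<Rightarrow> nat \<Rightarrow> nat \<Rightarrow> bool" where
  "suf t e e' \<equiv> cs (rev X) (rev Y) t (n - e) (n - e')"

definition env :: "st \<Rightarrow> bool" where
  "env s \<longleftrightarrow> vv s vn = n \<and> vv s vl = l \<and> vv s vD = D \<and>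
     (\<forall>i \<le> n. aa s ax i = sg X P r i) \<and> (\<forall>i \<le> n. aa s ay i = sg Y P r i) \<and>
     is_table X Y l D (aa s f) \<and> is_table (rev X) (rev Y) l D (aa s fr) \<and> is_table (rev Y) (rev X) l D (aa s gr)"

lemma env_frame:
  assumes "env s" "frame c s t" "ma c = {}" "10 \<notin> mv c" "14 \<notin> mv c" "15 \<notin> mv c"
  shows "env t"
  using assms unfolding env_def frame_def by auto

lemma env_tick [simp]: "env (tick t) = env t"
  by (simp add: env_def)

lemma ln: "l \<le> n" using lcs_le[of X Y] X l by simp

lemma tab_idx: "d \<le> D \<Longrightarrow> u \<le> l \<Longrightarrow> d * (l + 1) + u < M"
proof -
  assume a: "d \<le> D" "u \<le> l"
  have "d * (l + 1) + u < (d + 1) * (l + 1)" using a by simp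
  also have "\<dots> \<le> (D + 1) * (l + 1)" using a by (intro mult_le_mono1) simp
  also have "\<dots> \<le> M" using lM by (simp only: mult.commute)
  finally show ?thesis .
qed

lemma lower_rev:
  assumes "a \<le> n" "b \<le> n" shows "cs (rev X) (rev Y) (min a b - D) a b"
  using cs_lower[of "rev X" n "rev Y" a b] assms X Y l by (simp add: lcs_rev)

lemma suf_le: "suf t e e' \<Longrightarrow> t \<le> l"
  using cs_lcs[of "rev X" n "rev Y" n t] cs_mono[of "rev X" "rev Y" t "n - e" "n - e'" t n n] X Y l
  by (simp add: lcs_rev)

lemma suffix_test_wp:
  assumes env: "env s" and v: "vv s vi = e" "vv s vj = e'" "vv s vp = t" "vv s vf = 0"
    and e: "e \<le> n" "e' \<le> n" "t \<le> l"
  shows "wp (suffix_test fr gr) (\<lambda>u. vv u ve = n - e \<and> vv u vm = n - e' \<and>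
     vv u vf = (if suf t e e' then 1 else 0) \<and> clk u \<le> clk s + 7) s"
proof -
  note E = env[unfolded env_def]
  have ok: "Suc 0 < W" "n < W" "Suc l < W" "n - e < W" "n - e' < W" using ln nM MW by auto
  let ?a = "n - e" and ?b = "n - e'"
  have W1: "(?a - t) * Suc l + t < W" "(?a - t) * Suc l < W" "idx_ok fr ((?a - t) * Suc l + t)"
      "aa s fr ((?a - t) * Suc l + t) = FF (rev X) (rev Y) t ?a" if h: "t \<le> ?a" "?a - t \<le> D"
  proof -
    have i: "(?a - t) * Suc l + t < M" using tab_idx[OF h(2) e(3)] by simp
    then show "(?a - t) * Suc l + t < W" "(?a - t) * Suc l < W" using MW by linarith+
    show "idx_ok fr ((?a - t) * Suc l + t)" using i ids by (simp add: idx_ok_def)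
    have "is_table (rev X) (rev Y) l D (aa s fr)" using E by blast
    then have "aa s fr ((?a - t) * (l + 1) + t) = FF (rev X) (rev Y) t (t + (?a - t))"
      using h(2) e(3) unfolding is_table_def by blast
    then show "aa s fr ((?a - t) * Suc l + t) = FF (rev X) (rev Y) t ?a" unfolding le_add_diff_inverse[OF h(1)] by simp
  qed
  have W2: "(?b - t) * Suc l + t < W" "(?b - t) * Suc l < W" "idx_ok gr ((?b - t) * Suc l + t)"
      "aa s gr ((?b - t) * Suc l + t) = FF (rev Y) (rev X) t ?b" if h: "t \<le> ?b" "?b - t \<le> D"
  proof -
    have i: "(?b - t) * Suc l + t < M" using tab_idx[OF h(2) e(3)] by simp
    then show "(?b - t) * Suc l + t < W" "(?b - t) * Suc l < W" using MW by linarith+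
    show "idx_ok gr ((?b - t) * Suc l + t)" using i ids by (simp add: idx_ok_def)
    have "is_table (rev Y) (rev X) l D (aa s gr)" using E by blast
    then have "aa s gr ((?b - t) * (l + 1) + t) = FF (rev Y) (rev X) t (t + (?b - t))"
      using h(2) e(3) unfolding is_table_def by blast
    then show "aa s gr ((?b - t) * Suc l + t) = FF (rev Y) (rev X) t ?b" unfolding le_add_diff_inverse[OF h(1)] by simp
  qed
  have S1: "suf t e e' \<longleftrightarrow> FF (rev X) (rev Y) t ?a \<le> ?b"
    using FF_iff[of ?b "rev Y" "rev X" t ?a] Y by simp
  have S2: "suf t e e' \<longleftrightarrow> FF (rev Y) (rev X) t ?b \<le> ?a"
    using FF_iff[of ?a "rev X" "rev Y" t ?b] X cs_sym[of "rev X" "rev Y" t ?a ?b] by simp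
  have S3: "\<not> suf t e e'" if "\<not> t \<le> ?a \<or> \<not> t \<le> ?b" using cs_le that by blast
  have S4: "suf t e e'" if "t + D \<le> min ?a ?b"
    by (rule cs_mono[OF lower_rev[of ?a ?b]]) (use that in auto)
  have En: "vv s vn = n" "vv s vl = l" "vv s vD = D" using E by blast+
  note sm = wp_simps ok v e En suffix_test_def
  show ?thesis
  proof (cases "?a \<le> ?b")
    case ab: True
    show ?thesis
    proof (cases "t \<le> ?a")
      case ta: True
      show ?thesis
      proof (cases "D < ?a - t")
        case True
        then have "suf t e e'" using ab by (intro S4) simp
        then show ?thesis using ab ta True by (simp add: sm)
      next
        case False
        then have "?a - t \<le> D" by simp
        note w = W1[OF ta this]
        show ?thesis using ab ta False w S1 by (simp add: sm del: mult_Suc_right)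
      qed
    next
      case False
      then have "\<not> suf t e e'" by (intro S3) simp
      then show ?thesis using ab False by (simp add: sm)
    qed
  next
    case ab: False
    show ?thesis
    proof (cases "t \<le> ?b")
      case ta: True
      show ?thesis
      proof (cases "D < ?b - t")
        case True
        then have "suf t e e'" using ab by (intro S4) simp
        then show ?thesis using ab ta True by (simp add: sm)
      next
        case False
        then have "?b - t \<le> D" by simp
        note w = W2[OF ta this]
        show ?thesis using ab ta False w S2 by (simp add: sm del: mult_Suc_right)
      qed
    next
      case False
      then have "\<not> suf t e e'" by (intro S3) simp
      then show ?thesis using ab False by (simp add: sm)
    qed
  qed
qed

lemma lower_suffix_wp:
  assumes env: "env s" and v: "vv s vi = e" "vv s vj = e'" "vv s vp \<le> l" and e: "e \<le> n" "e' \<le> n"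
    and up: "\<And>t. vv s vp < t \<Longrightarrow> \<not> suf t e e'"
  shows "wp (lower_suffix fr gr) (\<lambda>u. vv u ve = n - e \<and> vv u vm = n - e' \<and> vv u vp \<le> vv s vp \<and>
     suf (vv u vp) e e' \<and> (\<forall>t. vv u vp < t \<longrightarrow> \<not> suf t e e') \<and> clk u + 10 * vv u vp \<le> clk s + 10 * vv s vp + 11) s"
proof -
  have ok: "Suc 0 < W" "0 < W" using nM MW by auto
  show ?thesis
    unfolding lower_suffix_def
    apply (simp add: wp_simps ok)
    \<comment> \<open>Every failed test lowers \<open>vp\<close> and is paid for by the potential
      \<open>10 * vp\<close>, which spreads the cost over the whole diagonal.\<close>
    apply (rule wp_While[where T = "clk s + 10 * vv s vp + 10" and I = "\<lambda>u. vv u vp \<le> vv s vp \<and>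
      (\<forall>t. vv u vp < t \<longrightarrow> \<not> suf t e e') \<and>
      (if vv u vf = 0 then clk u + 10 * vv u vp \<le> clk s + 10 * vv s vp + 1
       else vv u ve = n - e \<and> vv u vm = n - e' \<and> suf (vv u vp) e e' \<and> clk u + 10 * vv u vp \<le> clk s + 10 * vv s vp + 10)"])
    subgoal using up by simp
    subgoal using ok by (auto split: if_splits)
    subgoal premises p for u
    proof -
      note fu = frame_vv[OF p(2)] frame_aa[OF p(2)]
      have f0: "vv u vf = 0" using p(3) by simp
      have pl: "vv u vp \<le> l" using p(1) v by auto
      have pW: "vv u vp < W" using pl ln nM MW by auto
      have eu: "env u" by (rule env_frame[OF _ p(2), simplified]) (use env in \<open>simp add: env_def\<close>)
      show ?thesis
        apply (simp only: wp_Seq)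
        apply (rule wp_conseq[OF suffix_test_wp[of _ e e' "vv u vp"]])
        subgoal using eu by simp
        apply (simp_all add: fu v)[2]
        subgoal by simp
        subgoal using f0 by simp
        subgoal by (rule e)
        subgoal by (rule e)
        subgoal by (rule pl)
        subgoal premises q for w
        proof (cases "suf (vv u vp) e e'")
          case True
          then show ?thesis using q(1) p(1) f0 ok frame_vv[OF q(2)] by (simp add: wp_simps)
        next
          case False
          \<comment> \<open>The empty suffix part always passes the test, so the loop ends at 0 at
            the latest and the subtraction is safe.\<close>
          then have p0: "vv u vp \<noteq> 0" by (intro notI) simp
          have "\<not> suf t e e'" if "vv u vp - 1 < t" for t
            using that False p(1) p0 by (cases "t = vv u vp") auto
          moreover obtain x where "vv u vp = Suc x" using p0 by (cases "vv u vp") auto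
          ultimately show ?thesis using False q(1) p(1) f0 ok pW frame_vv[OF q(2)] by (simp add: wp_simps)
        qed
        done
    qed
    subgoal premises p for u
      using p(1,3) by simp
    done
qed

lemma advance_wp:
  assumes env: "env s" and v: "vv s vh = h" "vv s vj \<le> n + 1" and h: "h \<le> n"
    and below: "\<And>j. j < vv s vj \<Longrightarrow> sg Y P r j \<le> h"
  shows "wp (advance ay) (\<lambda>u. vv s vj \<le> vv u vj \<and> vv u vj \<le> n + 1 \<and> (\<forall>j < vv u vj. sg Y P r j \<le> h) \<and>
    (vv u vj \<le> n \<longrightarrow> h < sg Y P r (vv u vj)) \<and> clk u + 2 * vv s vj \<le> clk s + 2 * vv u vj + 1) s"
  unfolding advance_def
proof (rule wp_While[where T = "clk s + 2 * (n + 1)" and I = "\<lambda>u. vv s vj \<le> vv u vj \<and> vv u vj \<le> n + 1 \<and>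
    (\<forall>j < vv u vj. sg Y P r j \<le> h) \<and> clk u + 2 * vv s vj \<le> clk s + 2 * vv u vj"], goal_cases)
  case (2 u)
  note fr = frame_vv[OF 2(2)]
  show ?case
    using 2(1) v h ids env nM MW by (auto simp: idx_ok_def fr env_def)
next
  case (3 u)
  note fr = frame_vv[OF 3(2)] frame_aa[OF 3(2)]
  show ?case using 3(1,3) v h env nM MW by (auto simp: wp_simps fr env_def less_Suc_eq)
next
  case (4 u)
  note fr = frame_vv[OF 4(2)] frame_aa[OF 4(2)]
  show ?case using 4(1,3) v env by (auto simp: fr env_def)
qed (use v below in auto)

text \<open>The value 0 means that nothing was found. Otherwise it is one more than the length
  outside the pattern, so that adding \<open>r\<close> gives the content of output cell 0.\<close>

definition best_ok :: "st \<Rightarrow> bool" where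
  "best_ok s \<longleftrightarrow> vv s vbest = 0 \<or> (vv s vbest = vv s vbs + vv s vcs + 1 \<and>
     K (vv s vbf) (vv s vbs) (vv s vbd) (vv s vcf) (vv s vcs) (vv s vcd))"

lemma best_ok_tick [simp]: "best_ok (tick s) = best_ok s"
  by (simp add: best_ok_def)

lemma best_ok_frame:
  assumes "best_ok s" "frame c s t" "{40, 41, 42, 43, 44, 45, 46} \<inter> mv c = {}"
  shows "best_ok t"
  using assms unfolding best_ok_def frame_def by auto

lemma update_best_wp:
  assumes e: "e \<le> n" "e' \<le> n" "s + d + 1 = sg X P r e" "FF X Y s (s + d) < sg Y P r e'" "d \<le> D" "s \<le> l"
    and v: "vv u vt = s" "vv u vg = d" "vv u ve = n - e" "vv u vm = n - e'" "vv u vp = t"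
    and t: "suf t e e'" "\<And>t'. t < t' \<Longrightarrow> \<not> suf t' e e'" and b: "best_ok u"
  shows "wp (update_best fl) (\<lambda>x. best_ok x \<and> vv u vbest \<le> vv x vbest \<and> s + t + 1 \<le> vv x vbest \<and>
    clk x \<le> clk u + 9) u"
proof -
  have tl: "t \<le> l" using suf_le[OF t(1)] .
  have ok: "Suc 0 < W" "0 < W" "fl < W" "Suc 0 - fl < W" "n < W" "s + t + 1 < W" "s + t < W" "n - e < W" "n - e' < W"
    using ln nM MW fl tl e by auto
  have te: "t \<le> n - e" "t \<le> n - e'" using cs_le[OF t(1)] by auto
  \<comment> \<open>Maximality of \<open>t\<close> against the guaranteed length puts the recorded
    suffix on a diagonal at most \<open>D\<close> of the shorter side, where it can be traced
    later.\<close>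
  have lo: "min (n - e) (n - e') - D \<le> t"
    using lower_rev[of "n - e" "n - e'"] t(2) by (meson diff_le_self not_le)
  have d1: "n - e - t \<le> D" if "n - e \<le> n - e'" using lo that by (simp add: min_def)
  have d2: "n - e' - t \<le> D" if "\<not> n - e \<le> n - e'" using lo that by (simp add: min_def)
  have k1: "K fl s d fl t (n - e - t)" if "n - e \<le> n - e'"
    by (rule K[of e e']) (use e te d1[OF that] tl t(1) FF_iff[of "n - e'" "rev Y" "rev X" t "n - e"] Y in auto)
  have k2: "K fl s d (Suc 0 - fl) t (n - e' - t)" if "\<not> n - e \<le> n - e'"
    using K'[of e e' s d t "n - e' - t"] e te d2[OF that] tl t(1) FF_iff[of "n - e" "rev X" "rev Y" t "n - e'"] X
      cs_sym[of "rev X" "rev Y"] by simp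
  show ?thesis
    unfolding update_best_def
    using ok te k1 k2 b by (auto simp: wp_simps v best_ok_def)
qed

text \<open>The value \<open>m\<close> bounds all solutions whose first window ends at \<open>e\<close> and whose prefix lies on
  diagonal \<open>d\<close>.\<close>

definition covered :: "nat \<Rightarrow> nat \<Rightarrow> nat \<Rightarrow> bool" where
  "covered d e m \<longleftrightarrow> (\<forall>s e' t. s + d + 1 = sg X P r e \<longrightarrow> s \<le> l \<longrightarrow> e' \<le> n \<longrightarrow>
     FF X Y s (s + d) < sg Y P r e' \<longrightarrow> suf t e e' \<longrightarrow> s + t + 1 \<le> m)"

lemma covered_mono: "covered d e m \<Longrightarrow> m \<le> m' \<Longrightarrow> covered d e m'"
  unfolding covered_def by (meson order_trans)

lemma scan_pair_wp:
  assumes env: "env u" and v: "vv u vi = e" "vv u vj \<le> n + 1" "vv u vp \<le> l" "vv u vh = FF X Y s (s + d)" "vv u vt = s" "vv u vg = d"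
    and e: "e \<le> n" "s + d + 1 = sg X P r e" "d \<le> D" "s \<le> l" "FF X Y s (s + d) \<le> n"
    and below: "\<And>j. j < vv u vj \<Longrightarrow> sg Y P r j \<le> FF X Y s (s + d)"
    and up: "\<And>t. vv u vp < t \<Longrightarrow> \<not> suf t e (vv u vj)" and b: "best_ok u"
  shows "wp (scan_pair ay fr gr fl) (\<lambda>x. vv u vj \<le> vv x vj \<and> vv x vj \<le> n + 1 \<and> vv x vp \<le> vv u vp \<and> best_ok x \<and>
    vv u vbest \<le> vv x vbest \<and> covered d e (vv x vbest) \<and> (\<forall>t. vv x vp < t \<longrightarrow> \<not> suf t e (vv x vj)) \<and>
    (\<forall>j < vv x vj. sg Y P r j \<le> FF X Y s (s + d)) \<and>
    clk x + 2 * vv u vj + 10 * vv x vp \<le> clk u + 2 * vv x vj + 10 * vv u vp + 22) u"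
proof -
  let ?h = "FF X Y s (s + d)"
  have sufm: "\<not> suf t e j" if "vv u vp < t" "vv u vj \<le> j" for t j
    using up[OF that(1)] that(2) by (meson cs_mono diff_le_mono2 order_refl)
  show ?thesis
    unfolding scan_pair_def
    apply (simp only: wp_Seq)
    apply (rule wp_conseq[OF advance_wp[OF env v(4,2) e(5) below]])
    subgoal by assumption
    subgoal premises p for w
    proof -
      note fw = frame_vv[OF p(2)] frame_aa[OF p(2)]
      have ew: "env w" by (rule env_frame[OF env p(2)]) auto
      have bw: "best_ok w" by (rule best_ok_frame[OF b p(2)]) auto
      show ?thesis
      proof (cases "vv w vj \<le> n")
        case False
        then have "\<not> (FF X Y s (s + d) < sg Y P r e')" if "e' \<le> n" for e'
          using p(1) that by (auto simp: not_less)
        \<comment> \<open>No window of the second string starts late enough for this threshold, so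
          there is nothing to cover.\<close>
        then have "covered d e m" for m using e(2) unfolding covered_def by (metis add_right_cancel)
        moreover have "vv w vp \<le> vv u vp" "\<forall>t. vv w vp < t \<longrightarrow> \<not> suf t e (vv w vj)"
          using sufm p(1) by (auto simp: fw)
        ultimately show ?thesis using False p(1) bw ew by (simp add: wp_simps env_def best_ok_def fw)
      next
        case True
        have "wp (lower_suffix fr gr ;; update_best fl) (\<lambda>x. vv u vj \<le> vv x vj \<and> vv x vj \<le> n + 1 \<and> vv x vp \<le> vv u vp \<and> best_ok x \<and>
            vv u vbest \<le> vv x vbest \<and> covered d e (vv x vbest) \<and> (\<forall>t. vv x vp < t \<longrightarrow> \<not> suf t e (vv x vj)) \<and>
            (\<forall>j < vv x vj. sg Y P r j \<le> FF X Y s (s + d)) \<and>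
            clk x + 2 * vv u vj + 10 * vv x vp \<le> clk u + 2 * vv x vj + 10 * vv u vp + 22) (tick w)"
          apply (simp only: wp_Seq)
          apply (rule wp_conseq[OF lower_suffix_wp[of _ e "vv w vj"]])
          subgoal using ew by simp
          subgoal by (simp add: fw v)
          subgoal by simp
          subgoal using v by (simp add: fw)
          subgoal by (rule e)
          subgoal by (rule True)
          subgoal using sufm p(1) by (simp add: fw)
          subgoal premises q for x
          proof -
            note fx = frame_vv[OF q(2)] frame_aa[OF q(2)]
            have bx: "best_ok x" by (rule best_ok_frame[OF _ q(2)]) (use bw in simp_all)
            show ?thesis
              apply (rule wp_conseq[OF update_best_wp[of e "vv w vj" s d _ "vv x vp"]])
              subgoal by (rule e)
              subgoal by (rule True)
              subgoal by (rule e)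
              subgoal using p(1) True by simp
              subgoal by (rule e)
              subgoal by (rule e)
              apply (simp_all add: fx fw v)[2]
              using q(1) apply simp_all[2]
              subgoal by simp
              using q(1) apply simp_all[2]
              subgoal by (rule bx)
              subgoal premises z for y
              proof -
                note fy = frame_vv[OF z(2)] frame_aa[OF z(2)]
                have "covered d e (vv y vbest)"
                  unfolding covered_def
                proof (intro allI impI)
                  fix s' e' t assume a: "s' + d + 1 = sg X P r e" "s' \<le> l" "e' \<le> n" "FF X Y s' (s' + d) < sg Y P r e'" "suf t e e'"
                  have s': "s' = s" using a(1) e(2) by simp
                  \<comment> \<open>\<open>vj\<close> is the earliest admissible window end in the
                    second string, and an earlier end leaves at least as long a suffix.\<close>
                  have "vv w vj \<le> e'" using a(4) p(1) s' by (meson leD leI)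
                  then have "suf t e (vv w vj)" using a(5) by (rule_tac cs_mono[OF a(5)]) auto
                  then have "t \<le> vv x vp" using q(1) by (meson leI)
                  then show "s' + t + 1 \<le> vv y vbest" using z(1) s' by simp
                qed
                then show ?thesis
                  using z(1) q(1) p(1) by (simp add: fy fx fw)
              qed
              done
          qed
          done
        then show ?thesis using True ew by (simp add: wp_simps env_def)
      qed
    qed
    done
qed

lemma scan_diag_wp:
  assumes env: "env u" and v: "vv u vg = d" "vv u vq = d * (l + 1)" and d: "d \<le> D" and b: "best_ok u"
  shows "wp (scan_diag ax ay f fr gr fl) (\<lambda>x. best_ok x \<and> vv u vbest \<le> vv x vbest \<and>
    (\<forall>e \<le> n. covered d e (vv x vbest)) \<and> clk x \<le> clk u + 44 * (n + 1) + 10) u"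
proof -
  note E = env[unfolded env_def]
  have ok: "Suc 0 < W" "0 < W" using nM MW by auto
  have sgr: "sg X P r i \<le> n + 1" "sg Y P r i \<le> n + 1" if "i \<le> n" for i
    using sg_le[of X P r i] sg_le[of Y P r i] that by auto
  have suf0: "t \<le> l" if "cs (rev X) (rev Y) t n n" for t using suf_le[of t 0 0] that by simp
  have tabF: "aa t f (d * (l + 1) + s) = FF X Y s (s + d)" if "aa t f = aa u f" "s \<le> l" for t s
    using E that d unfolding is_table_def by simp
  show ?thesis
    unfolding scan_diag_def
    apply (simp add: wp_simps ok)
    \<comment> \<open>Positions passed by \<open>vj\<close> are justified by some earlier window end
      on this diagonal, not by the current one, for which there may be no usable table entry. The
      terms \<open>10 * vp\<close> and \<open>2 * vj\<close> amortise the two inner loops.\<close>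
    apply (rule wp_While[where T = "clk u + 44 * (n + 1) + 5" and I = "\<lambda>x. vv x vi \<le> n + 1 \<and>
      vv x vj \<le> n + 1 \<and> vv x vp \<le> l \<and> best_ok x \<and> vv u vbest \<le> vv x vbest \<and>
      (\<forall>e < vv x vi. covered d e (vv x vbest)) \<and>
      (\<forall>t. vv x vp < t \<longrightarrow> \<not> suf t (vv x vi - 1) (vv x vj)) \<and>
      (\<forall>j < vv x vj. \<exists>e < vv x vi. \<exists>s. s + d + 1 = sg X P r e \<and> sg Y P r j \<le> FF X Y s (s + d)) \<and>
      clk x + 10 * vv x vp \<le> clk u + 10 * l + 2 * vv x vj + 32 * vv x vi + 3"])
    subgoal using b suf0 E by (auto simp: best_ok_def not_le[symmetric])
    subgoal using ln by auto
    subgoal premises p for t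
    proof -
      note ft = frame_vv[OF p(2)] frame_aa[OF p(2)]
      have et: "env t" using env by (simp add: env_def ft)
      note Et = et[unfolded env_def]
      define e where "e = vv t vi"
      have e: "e \<le> n" "vv t vi = e" using p(3) Et by (auto simp: e_def)
      define b where "b = sg X P r e"
      have bb: "aa t ax e = b" "b \<le> n + 1" using Et e sgr by (auto simp: b_def)
      have inv: "vv t vj \<le> n + 1" "vv t vp \<le> l" "best_ok t" "vv u vbest \<le> vv t vbest" "\<And>e'. e' < e \<Longrightarrow> covered d e' (vv t vbest)"
        "\<And>t'. vv t vp < t' \<Longrightarrow> \<not> suf t' (e - 1) (vv t vj)"
        "\<And>j. j < vv t vj \<Longrightarrow> \<exists>e' < e. \<exists>s. s + d + 1 = sg X P r e' \<and> sg Y P r j \<le> FF X Y s (s + d)"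
        "clk t + 10 * vv t vp \<le> clk u + 10 * l + 2 * vv t vj + 32 * e + 3"
        using p(1) e(2) by auto
      have sufm: "\<not> suf t' e j" if "vv t vp < t'" "vv t vj \<le> j" for t' j
        using inv(6)[OF that(1)] that(2) by (meson cs_mono diff_le_mono2 diff_le_self order_refl)
      define Q where "Q = (\<lambda>x. vv x vj \<le> n + 1 \<and> vv x vp \<le> l \<and> best_ok x \<and> vv u vbest \<le> vv x vbest \<and>
        (\<forall>e' \<le> e. covered d e' (vv x vbest)) \<and> (\<forall>t. vv x vp < t \<longrightarrow> \<not> suf t e (vv x vj)) \<and>
        (\<forall>j < vv x vj. \<exists>e' \<le> e. \<exists>s. s + d + 1 = sg X P r e' \<and> sg Y P r j \<le> FF X Y s (s + d)) \<and>
        clk x + 10 * vv x vp + 2 \<le> clk u + 10 * l + 2 * vv x vj + 32 * Suc e + 3)"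
      have skip: "Q x" if "covered d e (vv t vbest)" "vv x = (vv t)(vx := z, vt := z', vh := z'') \<or> vv x = (vv t)(vx := z, vt := z') \<or> vv x = (vv t)(vx := z)"
          "clk x \<le> clk t + 8" for x z z' z''
      proof -
        have xe: "vv x vj = vv t vj" "vv x vp = vv t vp" "vv x vbest = vv t vbest" "best_ok x"
          using that(2) inv(3) by (auto simp: best_ok_def)
        have "\<forall>e' \<le> e. covered d e' (vv t vbest)" using inv(5) that(1) by (auto simp: le_less)
        moreover have "\<exists>e' \<le> e. \<exists>s. s + d + 1 = sg X P r e' \<and> sg Y P r j \<le> FF X Y s (s + d)" if "j < vv t vj" for j
          using inv(7)[OF that] less_imp_le by blast
        ultimately show ?thesis unfolding Q_def xe using inv sufm that(3) xe(4) by auto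
      qed
      have iok: "idx_ok ax e" "Suc e < W" "b < W" "b - d < W" using e(1) ids bb nM MW by (auto simp: idx_ok_def)
      have main: "wp (vx ::= Arr ax (V vi);; scan_entry ay f fr gr fl) Q (tick t)"
      proof (cases "d < b")
        case False
        have "covered d e m" for m using False unfolding covered_def b_def by auto
        then show ?thesis using False iok e bb by (simp add: scan_entry_def wp_simps ft v) (rule skip, auto)
      next
        case db: True
        define s where "s = b - d - 1"
        have s: "s + d + 1 = b" and sb: "b - Suc d = s" "Suc 0 \<le> b - d" using db by (auto simp: s_def)
        show ?thesis
        proof (cases "s \<le> l")
          case False
          have "covered d e m" for m using False s unfolding covered_def b_def by auto
          then show ?thesis using False db iok e bb ok Et
            by (simp add: scan_entry_def wp_simps ft v sb) (rule skip, auto)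
        next
          case sl: True
          have F: "aa t f (d * (l + 1) + s) = FF X Y s (s + d)" by (rule tabF[OF _ sl]) (simp add: ft)
          have iF: "idx_ok f (d * (l + 1) + s)" "d * (l + 1) + s < W"
            using tab_idx[OF d sl] ids MW by (auto simp: idx_ok_def)
          show ?thesis
          proof (cases "FF X Y s (s + d) \<le> n")
            case False
            have "covered d e m" for m
              unfolding covered_def
            proof (intro allI impI)
              fix s' e' t' assume a: "s' + d + 1 = sg X P r e" "e' \<le> n" "FF X Y s' (s' + d) < sg Y P r e'"
              then have "s' = s" using s by (simp add: b_def)
              then show "s' + t' + 1 \<le> m" using a False sgr(2)[of e'] by simp
            qed
            then show ?thesis using False sl db iok e bb ok Et iF F
              by (simp add: scan_entry_def wp_simps ft v sb) (rule skip, auto)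
          next
            case Fn: True
            define t0 where "t0 = t\<lparr>vv := (vv t)(vx := b, vt := s, vh := FF X Y s (s + d)), clk := Suc (Suc (Suc (Suc (Suc (Suc (Suc (clk t)))))))\<rparr>"
            have "wp (scan_pair ay fr gr fl) Q t0"
              apply (rule wp_conseq[OF scan_pair_wp[of _ e s d]])
              subgoal using et by (simp add: env_def t0_def)
              subgoal using e by (simp add: t0_def)
              using inv apply (simp_all add: t0_def)[2]
              apply (simp_all add: t0_def)[2]
              subgoal by (simp add: t0_def ft v)
              subgoal by (rule e)
              subgoal using s by (simp add: b_def)
              subgoal by (rule d)
              subgoal by (rule sl)
              subgoal by (rule Fn)
              subgoal premises q for j
              proof -
                obtain e' s' where e': "e' < e" "s' + d + 1 = sg X P r e'" "sg Y P r j \<le> FF X Y s' (s' + d)"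
                  using inv(7)[of j] q by (auto simp: t0_def)
                \<comment> \<open>Window starts are monotone, hence \<open>s'\<close> is at most
                  \<open>s\<close>; monotonicity of thresholds along the diagonal then transfers the
                  justification from \<open>e'\<close> to the current end.\<close>
                have "sg X P r e' \<le> b" unfolding b_def by (rule sg_mono) (use e' e X P in auto)
                then have "FF X Y s' (s' + d) \<le> FF X Y (s' + (s - s')) (s' + d + (s - s'))" by (intro FF_diag_mono) auto
                moreover have "s' + (s - s') = s" "s' + d + (s - s') = s + d" using e'(2) s \<open>sg X P r e' \<le> b\<close> by auto
                ultimately show ?thesis using e'(3) by simp
              qed
              subgoal using sufm by (simp add: t0_def)
              subgoal using inv(3) by (simp add: t0_def best_ok_def)
              subgoal premises q for x
              proof -
                have q1: "vv t vj \<le> vv x vj" "vv x vj \<le> n + 1" "vv x vp \<le> vv t vp" "best_ok x" "vv t vbest \<le> vv x vbest"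
                  "covered d e (vv x vbest)" "\<forall>t. vv x vp < t \<longrightarrow> \<not> suf t e (vv x vj)"
                  "\<forall>j < vv x vj. sg Y P r j \<le> FF X Y s (s + d)"
                  "clk x + 2 * vv t vj + 10 * vv x vp \<le> clk t + 7 + 2 * vv x vj + 10 * vv t vp + 22"
                  using q(1) by (auto simp: t0_def)
                have "\<forall>e' \<le> e. covered d e' (vv x vbest)"
                  using inv(5) q1(5,6) covered_mono by (metis le_less)
                moreover have "\<exists>e' \<le> e. \<exists>s. s + d + 1 = sg X P r e' \<and> sg Y P r j \<le> FF X Y s (s + d)" if "j < vv x vj" for j
                  using q1(8) that s by (intro exI[of _ e] conjI exI[of _ s]) (auto simp: b_def)
                ultimately show ?thesis unfolding Q_def using q1 inv by auto
              qed
              done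
            then show ?thesis using Fn sl db iok e bb ok Et iF F
              by (simp add: scan_entry_def wp_simps ft v sb t0_def tick_def)
          qed
        qed
      qed
      have fin: "wp (vi ::= V vi \<oplus> N 1) (\<lambda>x. vv x vi \<le> n + 1 \<and>
        vv x vj \<le> n + 1 \<and> vv x vp \<le> l \<and> best_ok x \<and> vv u vbest \<le> vv x vbest \<and>
        (\<forall>e < vv x vi. covered d e (vv x vbest)) \<and>
        (\<forall>t. vv x vp < t \<longrightarrow> \<not> suf t (vv x vi - 1) (vv x vj)) \<and>
        (\<forall>j < vv x vj. \<exists>e < vv x vi. \<exists>s. s + d + 1 = sg X P r e \<and> sg Y P r j \<le> FF X Y s (s + d)) \<and>
        clk x + 10 * vv x vp \<le> clk u + 10 * l + 2 * vv x vj + 32 * vv x vi + 3) x"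
        if "Q x" "vv x vi = e" for x
        using that iok ok e unfolding Q_def by (simp add: wp_simps best_ok_def less_Suc_eq_le)
      show ?thesis
      proof (subst wp_Seq, subst wp_Assign, intro conjI, goal_cases)
        case 1
        then show ?case using main unfolding wp_Seq wp_Assign by blast
      next
        case 2
        have "wp (scan_entry ay f fr gr fl) Q ((tick t)\<lparr>vv := (vv (tick t))(vx := ev (Arr ax (V vi)) (tick t)), clk := clk (tick t) + 1\<rparr>)"
          using main unfolding wp_Seq wp_Assign by blast
        then show ?case
          unfolding wp_Seq
        proof (rule wp_conseq, goal_cases)
          case (1 x)
          then show ?case using fin[of x] e frame_vv[OF 1(2), of vi] by simp
        qed
      qed
    qed
    subgoal premises p for t
    proof -
      note ft = frame_vv[OF p(2)] frame_aa[OF p(2)]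
      have "vv t vi = n + 1" using p(1,3) E by (auto simp: ft)
      then show ?thesis using p(1) ln by (auto simp: less_Suc_eq_le)
    qed
    done
qed

lemma scan_all_wp:
  assumes env: "env u" and b: "best_ok u"
  shows "wp (scan_all ax ay f fr gr fl) (\<lambda>x. best_ok x \<and> vv u vbest \<le> vv x vbest \<and>
    (\<forall>d \<le> D. \<forall>e \<le> n. covered d e (vv x vbest)) \<and> clk x \<le> clk u + (D + 1) * (44 * (n + 1) + 16) + 4) u"
proof -
  note E = env[unfolded env_def]
  have ok: "Suc 0 < W" "0 < W" using nM MW by auto
  let ?B = "44 * (n + 1) + 16"
  show ?thesis
    unfolding scan_all_def
    apply (simp add: wp_simps ok)
    apply (rule wp_While[where T = "clk u + (D + 1) * ?B + 3" and I = "\<lambda>x. vv x vg \<le> D + 1 \<and>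
      vv x vq = vv x vg * (l + 1) \<and> best_ok x \<and> vv u vbest \<le> vv x vbest \<and>
      (\<forall>d < vv x vg. \<forall>e \<le> n. covered d e (vv x vbest)) \<and> clk x \<le> clk u + vv x vg * ?B + 3"])
    subgoal using b by (simp add: best_ok_def)
    subgoal premises p for t
    proof -
      have "vv t vg * ?B \<le> (D + 1) * ?B" using p(1) by (intro mult_le_mono1) simp
      then show ?thesis using p(1) by (intro conjI) (simp, linarith)
    qed
    subgoal premises p for t
    proof -
      note ft = frame_vv[OF p(2)] frame_aa[OF p(2)]
      have et: "env t" using env by (simp add: env_def ft)
      have g: "vv t vg \<le> D" using p(3) E by (simp add: ft)
      have c: "vv t vg * (l + 1) + l < M" by (rule tab_idx[OF g]) simp
      show ?thesis
        apply (simp only: wp_Seq)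
        apply (rule wp_conseq[OF scan_diag_wp[of _ "vv t vg"]])
        subgoal using et by simp
        subgoal by simp
        subgoal using p(1) by simp
        subgoal by (rule g)
        subgoal using p(1) by simp
        subgoal premises q for x
        proof -
          note fx = frame_vv[OF q(2)] frame_aa[OF q(2)]
          have ot: "vv x vl = l" "vv x vg = vv t vg" "vv x vq = vv t vg * (l + 1)"
            using p(1) E by (simp_all add: fx ft)
          have "\<forall>d < Suc (vv t vg). \<forall>e \<le> n. covered d e (vv x vbest)"
            using q(1) p(1) covered_mono by (metis less_Suc_eq tick_simps(1))
          moreover have "vv u vbest \<le> vv x vbest" "best_ok x" "clk x + 3 \<le> clk u + (vv t vg + 1) * ?B + 3"
            using q(1) p(1) by auto
          moreover have "vv t vg * (l + 1) + l < W" "vv t vg * (l + 1) + l + 1 < W" "Suc (vv t vg) < W"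
            using c MW g ln nM by auto
          ultimately show ?thesis using ot g ok by (simp add: wp_simps best_ok_def)
        qed
        done
    qed
    subgoal premises p for t
    proof -
      note ft = frame_vv[OF p(2)] frame_aa[OF p(2)]
      have "vv t vg = D + 1" using p(1,3) E by (simp add: ft)
      then show ?thesis using p(1) by (simp add: less_Suc_eq_le)
    qed
    done
qed

end

section \<open>Reconstruction\<close>

text \<open>Equal thresholds on adjacent diagonals mean that the last character of the prefix is
  dispensable; otherwise \<open>FF_trace\<close> says that it is matched. On diagonal 0 every
  character is matched. Characters are found from the back but go directly to their final index
  \<open>vp\<close>.\<close>

definition trace :: "nat \<Rightarrow> nat \<Rightarrow> nat \<Rightarrow> com" where
  "trace f a u = vq ::= V vg \<otimes> (V vl \<oplus> N 1);;
     WHILE BLt (N 0) (V vp) DO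
       (IF BEq (V vg) (N 0) THEN (Write u (V vp) (Arr a (V vp \<oplus> V vg));; vp ::= V vp \<ominus> N 1)
        ELSE (IF BEq (Arr f (V vq \<ominus> (V vl \<oplus> N 1) \<oplus> V vp)) (Arr f (V vq \<oplus> V vp))
          THEN (vg ::= V vg \<ominus> N 1;; vq ::= V vq \<ominus> (V vl \<oplus> N 1))
          ELSE (Write u (V vp) (Arr a (V vp \<oplus> V vg));; vp ::= V vp \<ominus> N 1)))"

lemma mv_trace [simp]: "mv (trace f a u) = {23, 24, 30}" "ma (trace f a u) = {u}"
  by (auto simp: trace_def)

context sized begin

lemma trace_wp:
  assumes XY: "length X = n" "length Y = n" and a: "str s a X" and tab: "is_table X Y l (n - l) (aa s f)"
    and l: "l \<le> n" "(l + 1) * (n - l + 1) \<le> M" and v: "vv s vl = l" "vv s vg = d0" "vv s vp = s0"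
    and sd: "s0 \<le> l" "d0 \<le> n - l" "FF X Y s0 (s0 + d0) \<le> n"
    and ids: "f \<noteq> 0" "a \<noteq> 0" "u \<noteq> 0" "f < narr" "a < narr" "u < narr" "u \<noteq> f" "u \<noteq> a"
  shows "wp (trace f a u) (\<lambda>t. (\<exists>Z. length Z = s0 \<and> subseq Z (take (s0 + d0) X) \<and>
      subseq Z (take (FF X Y s0 (s0 + d0)) Y) \<and> (\<forall>i < s0. aa t u (Suc i) = Z ! i)) \<and> clk t \<le> clk s + 5 * n + 2) s"
proof -
  have idx: "d * (l + 1) + i < M" if "d \<le> n - l" "i \<le> l" for d i
  proof -
    have "d * (l + 1) + i < (d + 1) * (l + 1)" using that by simp
    also have "\<dots> \<le> (n - l + 1) * (l + 1)" using that by (intro mult_le_mono1) simp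
    finally show ?thesis using l(2) by (simp only: mult.commute less_le_trans)
  qed
  have ok: "Suc 0 < W" "0 < W" "Suc l < W" "d0 + d0 * l < W" using idx[OF sd(2), of 0] l(1) nM MW by auto
  let ?J = "FF X Y s0 (s0 + d0)"
  \<comment> \<open>The invariant is a continuation: whatever common subsequence of the remaining
    length fits the current prefix and threshold can be followed by the characters already written.
    Each round lowers \<open>vp + vg\<close>, at 5 steps per round.\<close>
  define I where "I = (\<lambda>t :: st. vv t vp \<le> s0 \<and> vv t vg \<le> d0 \<and> vv t vq = vv t vg * (l + 1) \<and>
     FF X Y (vv t vp) (vv t vp + vv t vg) \<le> n \<and>
     (\<forall>Z. length Z = vv t vp \<longrightarrow> subseq Z (take (vv t vp + vv t vg) X) \<longrightarrow>
        subseq Z (take (FF X Y (vv t vp) (vv t vp + vv t vg)) Y) \<longrightarrow>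
        subseq (Z @ map (aa t u) [Suc (vv t vp)..<Suc s0]) (take (s0 + d0) X) \<and>
        subseq (Z @ map (aa t u) [Suc (vv t vp)..<Suc s0]) (take ?J Y)) \<and>
     clk t + 5 * (vv t vp + vv t vg) \<le> clk s + 5 * (s0 + d0) + 1)"
  show ?thesis
    unfolding trace_def
    apply (simp add: wp_simps ok v)
    apply (rule wp_While[where T = "clk s + 5 * (s0 + d0) + 1" and I = I])
    subgoal using sd by (simp add: I_def v)
    subgoal using ok by (simp add: I_def)
    subgoal premises p for t
    proof -
      note ft = frame_vv[OF p(2)] frame_aa[OF p(2)]
      note inv = p(1)[unfolded I_def]
      define d where "d = vv t vg"
      obtain q where q: "vv t vp = Suc q" using p(3) by (cases "vv t vp") auto
      have b: "Suc q \<le> s0" "d \<le> d0" "vv t vq = d * (l + 1)" "FF X Y (Suc q) (Suc q + d) \<le> n"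
        using inv q by (auto simp: d_def)
      have qd: "Suc (q + d) \<le> n" "q + d < length X" using b sd l XY by auto
      have cl: "clk t + 5 * (Suc q + d) \<le> clk s + 5 * (s0 + d0) + 1" using inv q by (simp add: d_def)
      have H: "subseq (Z @ map (aa t u) [Suc (Suc q)..<Suc s0]) (take (s0 + d0) X) \<and>
          subseq (Z @ map (aa t u) [Suc (Suc q)..<Suc s0]) (take ?J Y)"
        if "length Z = Suc q" "subseq Z (take (Suc q + d) X)" "subseq Z (take (FF X Y (Suc q) (Suc q + d)) Y)" for Z
        using inv q that by (simp add: d_def)
      have x: "aa t a (Suc (q + d)) = X ! (q + d)"
        using a qd ids XY by (simp add: ft str_def)
      have take: "I (t\<lparr>aa := (aa t)(u := (aa t u)(Suc q := X ! (q + d))), vv := (vv t)(vp := q), clk := c\<rparr>)"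
        if ne: "FF X Y (Suc q) (Suc (q + d)) \<noteq> FF X Y (Suc q) (q + d)" and c: "c \<le> clk t + 5" for c
      proof -
        let ?j = "FF X Y (Suc q) (Suc (q + d))"
        note tr = FF_trace[OF qd(2) ne]
        have W: "map ((aa t u)(Suc q := X ! (q + d))) [Suc q..<Suc s0] = X ! (q + d) # map (aa t u) [Suc (Suc q)..<Suc s0]"
          using b(1) by (simp add: upt_rec[of "Suc q"])
        have "subseq (Z @ X ! (q + d) # map (aa t u) [Suc (Suc q)..<Suc s0]) (take (s0 + d0) X) \<and>
          subseq (Z @ X ! (q + d) # map (aa t u) [Suc (Suc q)..<Suc s0]) (take ?J Y)"
          if Z: "length Z = q" "subseq Z (take (q + d) X)" "subseq Z (take (FF X Y q (q + d)) Y)" for Z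
        proof -
          have 1: "subseq (Z @ [X ! (q + d)]) (take (Suc q + d) X)"
            using Z(2) qd by (simp add: take_Suc_conv_app_nth)
          obtain j where j: "?j = Suc j" using tr(1) by (cases ?j) auto
          have "subseq Z (take j Y)" by (rule subseq_take[OF _ Z(3)]) (use tr(1) j in simp)
          then have 2: "subseq (Z @ [X ! (q + d)]) (take ?j Y)"
            using tr(2,3) j by (simp add: take_Suc_conv_app_nth)
          show ?thesis using H[of "Z @ [X ! (q + d)]"] 1 2 Z(1) by simp
        qed
        moreover have "FF X Y q (q + d) \<le> n" using tr(1,2) XY by simp
        ultimately show ?thesis using b cl c unfolding I_def by (simp add: W d_def[symmetric] del: upt_Suc)
      qed
      have iok: "idx_ok u (Suc q)" "idx_ok a (Suc (q + d))" "Suc q + d < W" "Suc (q + d) < W" "Suc q < W" "d < W"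
        using b sd qd l ids nM MW by (auto simp: idx_ok_def)
      show ?thesis
      proof (cases "d = 0")
        case True
        have "FF X Y (Suc q) q = length Y + 1" by (rule FF_inf) simp
        then have ne: "FF X Y (Suc q) (Suc (q + d)) \<noteq> FF X Y (Suc q) (q + d)" using b(4) XY True by simp
        show ?thesis using take[OF ne, of "Suc (Suc (Suc (Suc (clk t))))"] iok ok x True
          by (simp add: wp_simps q d_def[symmetric] tick_def)
      next
        case False
        then obtain d' where d': "d = Suc d'" by (cases d) auto
        have t1: "aa t f (d * (l + 1) + Suc q) = FF X Y (Suc q) (Suc q + d)"
          "aa t f (d' * (l + 1) + Suc q) = FF X Y (Suc q) (Suc q + d')"
        proof -
          have af: "aa t f = aa s f" using ids(7)[THEN not_sym] by (simp add: ft)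
          have "Suc q \<le> l" "d \<le> n - l" "d' \<le> n - l" using b sd d' by auto
          then show "aa t f (d * (l + 1) + Suc q) = FF X Y (Suc q) (Suc q + d)"
            "aa t f (d' * (l + 1) + Suc q) = FF X Y (Suc q) (Suc q + d')"
            using tab unfolding is_table_def af by blast+
        qed
        have t2: "d * (l + 1) + Suc q < M" "d' * (l + 1) + Suc q < M" by (rule idx; use b sd d' in simp)+
        have t3: "d * (l + 1) - Suc l + Suc q = d' * (l + 1) + Suc q" "d * (l + 1) - Suc l = d' * (l + 1)" by (simp_all add: d')
        have iok2: "idx_ok f (d * (l + 1) + Suc q)" "idx_ok f (d' * (l + 1) + Suc q)" "d * (l + 1) + Suc q < W"
          "d' * (l + 1) + Suc q < W" "Suc l \<le> d * (l + 1)" "d * (l + 1) < W"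
          using t2 ids MW by (auto simp: idx_ok_def d')
        have vq': "vv t vq = d * (l + 1)" by (rule b(3))
        show ?thesis
        proof (cases "FF X Y (Suc q) (Suc q + d') = FF X Y (Suc q) (Suc q + d)")
          case True
          have "I (t\<lparr>vv := (vv t)(vg := d', vq := d' * (l + 1)), clk := Suc (Suc (Suc (Suc (Suc (clk t)))))\<rparr>)"
          proof -
            have "subseq (Z @ map (aa t u) [Suc (Suc q)..<Suc s0]) (take (s0 + d0) X) \<and>
              subseq (Z @ map (aa t u) [Suc (Suc q)..<Suc s0]) (take ?J Y)"
              if "length Z = Suc q" "subseq Z (take (Suc q + d') X)" "subseq Z (take (FF X Y (Suc q) (Suc q + d')) Y)" for Z
              by (rule H) (use that True d' subseq_take[of "Suc q + d'" "Suc q + d"] in auto)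
            then show ?thesis using b cl d' True unfolding I_def by (simp add: q del: upt_Suc)
          qed
          then show ?thesis using True iok iok2 ok t1 t3
            by (simp add: wp_simps q vq' d_def[symmetric] tick_def d' ft v del: mult_Suc_right mult_Suc)
        next
          case ne: False
          have "FF X Y (Suc q) (Suc (q + d)) \<noteq> FF X Y (Suc q) (q + d)" using ne d' by simp
          from take[OF this, of "Suc (Suc (Suc (Suc (Suc (clk t)))))"] show ?thesis using ne False iok iok2 ok t1 t3 x d'
            by (simp add: wp_simps q vq' d_def[symmetric] tick_def ft v del: mult_Suc_right mult_Suc)
        qed
      qed
    qed
    subgoal premises p for t
    proof -
      note inv = p(1)[unfolded I_def]
      let ?Z = "map (aa t u) [Suc 0..<Suc s0]"
      have p0: "vv t vp = 0" using p(3) by simp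
      have "subseq ?Z (take (s0 + d0) X) \<and> subseq ?Z (take ?J Y)"
        using inv p0 by (auto simp del: upt_Suc dest: spec[of _ "[]"])
      moreover have "?Z ! i = aa t u (Suc i)" if "i < s0" for i using that by (simp del: upt_Suc add: nth_map)
      moreover have "clk t \<le> clk s + 5 * n + 1"
      proof -
        have "clk t + 5 * (vv t vp + vv t vg) \<le> clk s + 5 * (s0 + d0) + 1" using inv by blast
        moreover have "s0 + d0 \<le> n" using sd(1,2) l(1) by linarith
        ultimately show ?thesis by simp
      qed
      ultimately show ?thesis by (auto intro!: exI[of _ ?Z] simp del: upt_Suc)
    qed
    done
qed

end

text \<open>The data recorded for the best solution: the flags say whether the prefix (the suffix) is to be
  found in the table of \<open>A\<close> against \<open>B\<close> or in that of \<open>B\<close> against \<open>A\<close>.\<close>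

definition record_ok :: "nat list \<Rightarrow> nat list \<Rightarrow> nat list \<Rightarrow> nat \<Rightarrow> nat \<Rightarrow> nat \<Rightarrow> nat \<Rightarrow> nat \<Rightarrow> nat \<Rightarrow> bool" where
  "record_ok A B P fl s d gl t d' \<longleftrightarrow> (let n = length A; l = lcs A B; r = length P in
     s \<le> l \<and> d \<le> n - l \<and> t \<le> l \<and> d' \<le> n - l \<and>
     (\<exists>e e'. e \<le> n \<and> e' \<le> n \<and> 0 < sg A P r e \<and> 0 < sg B P r e' \<and>
       (if fl = 0 then s + d + 1 = sg A P r e \<and> FF A B s (s + d) < sg B P r e'
        else s + d + 1 = sg B P r e' \<and> FF B A s (s + d) < sg A P r e) \<and>
       (if gl = 0 then t + d' = n - e \<and> FF (rev A) (rev B) t (t + d') \<le> n - e'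
        else t + d' = n - e' \<and> FF (rev B) (rev A) t (t + d') \<le> n - e)))"

lemma record_ok_candidate:
  assumes rec: "record_ok A B P fl s d gl t d'" and n: "length A = n" "length B = n"
    and Z: "if fl = 0 then subseq Z (take (s + d) A) \<and> subseq Z (take (FF A B s (s + d)) B)
      else subseq Z (take (s + d) B) \<and> subseq Z (take (FF B A s (s + d)) A)"
    and Y: "if gl = 0 then subseq Y (take (t + d') (rev A)) \<and> subseq Y (take (FF (rev A) (rev B) t (t + d')) (rev B))
      else subseq Y (take (t + d') (rev B)) \<and> subseq Y (take (FF (rev B) (rev A) t (t + d')) (rev A))"
  shows "ic_candidate A B P (Z @ P @ rev Y)"
proof -
  obtain e e' where e: "e \<le> n" "e' \<le> n" "0 < sg A P (length P) e" "0 < sg B P (length P) e'"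
    "if fl = 0 then s + d + 1 = sg A P (length P) e \<and> FF A B s (s + d) < sg B P (length P) e'
        else s + d + 1 = sg B P (length P) e' \<and> FF B A s (s + d) < sg A P (length P) e"
    "if gl = 0 then t + d' = n - e \<and> FF (rev A) (rev B) t (t + d') \<le> n - e'
        else t + d' = n - e' \<and> FF (rev B) (rev A) t (t + d') \<le> n - e"
    using rec n unfolding record_ok_def Let_def by auto
  have "subseq Z (take (sg A P (length P) e - 1) A) \<and> subseq Z (take (sg B P (length P) e' - 1) B)"
  proof (cases "fl = 0")
    case True
    then have "sg A P (length P) e - 1 = s + d" "FF A B s (s + d) \<le> sg B P (length P) e' - 1" using e(5) by auto
    then show ?thesis using Z True by (auto intro: subseq_take[rotated])
  next
    case False
    then have "sg B P (length P) e' - 1 = s + d" "FF B A s (s + d) \<le> sg A P (length P) e - 1" using e(5) by auto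
    then show ?thesis using Z False by (auto intro: subseq_take[rotated])
  qed
  moreover have "subseq Y (take (n - e) (rev A)) \<and> subseq Y (take (n - e') (rev B))"
  proof (cases "gl = 0")
    case True
    then show ?thesis using Y e(6) by (auto intro: subseq_take[rotated])
  next
    case False
    then show ?thesis using Y e(6) by (auto intro: subseq_take[rotated])
  qed
  ultimately show ?thesis using e n by (intro ic_candidateI[of A n B e e' P]) auto
qed

section \<open>Optimality of the recorded value\<close>

definition pair_cover :: "nat list \<Rightarrow> nat list \<Rightarrow> nat list \<Rightarrow> nat \<Rightarrow> bool" where
  "pair_cover X Y P m \<longleftrightarrow> (let n = length X; l = lcs X Y; r = length P in
     \<forall>d \<le> n - l. \<forall>e \<le> n. \<forall>s e' t. s + d + 1 = sg X P r e \<longrightarrow> s \<le> l \<longrightarrow> e' \<le> n \<longrightarrow>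
     FF X Y s (s + d) < sg Y P r e' \<longrightarrow> cs (rev X) (rev Y) t (n - e) (n - e') \<longrightarrow> s + t + 1 \<le> m)"

text \<open>A prefix part that omits more than n - lcs characters of the shorter prefix lies on no
  stored diagonal. \<open>cs_lower\<close> provides a longer one that does, and bounding that one
  suffices. The assumption \<open>le\<close> makes the prefix of \<open>X\<close> the shorter
  one.\<close>

lemma pair_cover_split:
  assumes n: "length X = n" "length Y = n" and c: "pair_cover X Y P m"
    and e: "e \<le> n" "e' \<le> n" "0 < sg X P (length P) e" "0 < sg Y P (length P) e'"
    and le: "sg X P (length P) e \<le> sg Y P (length P) e'"
    and s: "cs X Y s (sg X P (length P) e - 1) (sg Y P (length P) e' - 1)"
    and t: "cs (rev X) (rev Y) t (n - e) (n - e')"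
  shows "s + t + 1 \<le> m"
proof -
  let ?i = "sg X P (length P) e - 1" and ?j = "sg Y P (length P) e' - 1" and ?D = "n - lcs X Y"
  have ij: "?i \<le> n" "?j \<le> n" "?i \<le> ?j"
    using sg_le[of X P "length P" e] sg_le[of Y P "length P" e'] e le by auto
  define z where "z = max s (?i - ?D)"
  have "cs X Y (?i - ?D) ?i ?j" using cs_lower[OF n ij(1,2)] ij(3) by (simp add: min_def)
  then have z: "cs X Y z ?i ?j" using s by (simp add: z_def max_def)
  have zi: "z \<le> ?i" using cs_le[OF z] by simp
  have zl: "z \<le> lcs X Y" using cs_lcs[of X n Y n z] cs_mono[OF z, of z n n] ij n by simp
  have d: "?i - z \<le> ?D" by (auto simp: z_def)
  have iz: "z + (?i - z) = ?i" using zi by simp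
  have "FF X Y z (z + (?i - z)) \<le> ?j" unfolding iz using z FF_iff[of ?j Y X z ?i] ij n by simp
  then have "FF X Y z (z + (?i - z)) < sg Y P (length P) e'" using e(4) by linarith
  moreover have "z + (?i - z) + 1 = sg X P (length P) e" using zi e(3) by simp
  ultimately have "z + t + 1 \<le> m"
    using c d e zl t n unfolding pair_cover_def Let_def by blast
  then show ?thesis by (simp add: z_def)
qed

text \<open>Which pass covers a candidate depends on the string with the earlier window start, as
  its prefix must index the table.\<close>

lemma cover_candidate:
  assumes n: "length A = n" "length B = n" and c: "pair_cover A B P m" "pair_cover B A P m"
    and Z: "ic_candidate A B P Z"
  shows "length Z + 1 \<le> length P + m"
proof -
  obtain s t e f where *: "ic_split A B P s t e f" "length Z = s + length P + t"
    using ic_candidate_split[OF Z] by blast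
  note sp = *(1)[unfolded ic_split_def n]
  have "s + t + 1 \<le> m"
  proof (cases "sg A P (length P) e \<le> sg B P (length P) f")
    case True
    then show ?thesis using pair_cover_split[OF n c(1)] sp by blast
  next
    case False
    then show ?thesis
      using pair_cover_split[OF n(2,1) c(2), of f e s t] sp cs_sym[of A B] cs_sym[of "rev A" "rev B"] by simp
  qed
  then show ?thesis using *(2) by simp
qed

section \<open>Writing the solution\<close>

definition emit_prefix :: com where
  "emit_prefix = vi ::= N 1;;
     WHILE BLe (V vi) (V vbs) DO (Write 0 (V vi) (Arr aU (V vi));; vi ::= V vi \<oplus> N 1)"

definition emit_pattern :: com where
  "emit_pattern = vi ::= N 0;;
     WHILE BLt (V vi) (V vr) DO (Write 0 (V vbs \<oplus> V vi \<oplus> N 1) (Arr aP (V vi));; vi ::= V vi \<oplus> N 1)"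

text \<open>The suffix was traced in the reversed strings and is therefore written out from its
  end.\<close>

definition emit_suffix :: com where
  "emit_suffix = vi ::= N 0;;
     WHILE BLt (V vi) (V vcs) DO (
       Write 0 (V vbs \<oplus> V vr \<oplus> V vi \<oplus> N 1) (Arr aUr (V vcs \<ominus> V vi));; vi ::= V vi \<oplus> N 1)"

text \<open>The output replaces the input in raw memory; the strings needed here are copies made at
  the start.\<close>

definition emit :: com where
  "emit = (IF BEq (V vbest) (N 0) THEN Write 0 (N 0) (N 0) ELSE (
     vg ::= V vbd;; vp ::= V vbs;;
     (IF BEq (V vbf) (N 0) THEN trace aF aA aU ELSE trace aG aB aU);;
     vg ::= V vcd;; vp ::= V vcs;;
     (IF BEq (V vcf) (N 0) THEN trace aFr aAr aUr ELSE trace aGr aBr aUr);;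
     Write 0 (N 0) (V vbest \<oplus> V vr);; emit_prefix;; emit_pattern;; emit_suffix))"

lemma mv_emit [simp]: "mv emit_prefix = {20}" "ma emit_prefix = {0}" "mv emit_pattern = {20}" "ma emit_pattern = {0}"
  "mv emit_suffix = {20}" "ma emit_suffix = {0}" "mv emit = {20, 23, 24, 30}" "ma emit = {0, 22, 23}"
  by (auto simp: emit_prefix_def emit_pattern_def emit_suffix_def emit_def)

definition result :: "st \<Rightarrow> nat list option" where
  "result s = (if aa s 0 0 = 0 then None else Some (map (aa s 0) [1..<aa s 0 0]))"

context sized begin

lemma emit_parts_wp:
  assumes v: "vv s vbs = length L" "vv s vr = r" "vv s vcs = length Y" and P: "length P = r"
    and U: "\<And>i. i < length L \<Longrightarrow> aa s aU (Suc i) = L ! i" "\<And>i. i < length Y \<Longrightarrow> aa s aUr (Suc i) = Y ! i"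
      "\<And>i. i < r \<Longrightarrow> aa s aP i = P ! i"
    and n: "length L + r + length Y \<le> n" and h: "aa s 0 0 = length L + r + length Y + 1"
  shows "wp (emit_prefix;; emit_pattern;; emit_suffix) (\<lambda>t. result t = Some (L @ P @ rev Y) \<and> clk t \<le> clk s + 3 * n + 9) s"
proof -
  have ok: "Suc 0 < W" "0 < W" "n < W" "n + 1 < W" "Suc n < Z" using nM MW nZ by auto
  have 1: "wp emit_prefix (\<lambda>t. (\<forall>i < length L. aa t 0 (Suc i) = L ! i) \<and> aa t 0 0 = aa s 0 0 \<and> clk t \<le> clk s + 3 * length L + 3) s"
    unfolding emit_prefix_def
    apply (simp add: wp_simps ok)
    apply (rule wp_While[where T = "clk s + 3 * length L + 3" and I = "\<lambda>t. 1 \<le> vv t vi \<and> vv t vi \<le> length L + 1 \<and>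
      (\<forall>i. Suc i < vv t vi \<longrightarrow> aa t 0 (Suc i) = L ! i) \<and> aa t 0 0 = aa s 0 0 \<and> clk t + 2 \<le> clk s + 3 * vv t vi"])
    apply simp_all[2]
    subgoal premises p for t
      using p(1,3) v U n ok nM MW frame_vv[OF p(2)] frame_aa[OF p(2)]
      by (cases "vv t vi") (auto simp: wp_simps idx_ok_def narr_def less_Suc_eq)
    subgoal premises p for t
      using p(1,3) v frame_vv[OF p(2)] by auto
    done
  have 2: "wp emit_pattern (\<lambda>t. (\<forall>i < r. aa t 0 (length L + i + 1) = P ! i) \<and>
      (\<forall>i \<le> length L. aa t 0 i = aa s' 0 i) \<and> clk t \<le> clk s' + 3 * r + 2) s'"
    if s': "vv s' vbs = length L" "vv s' vr = r" "aa s' aP = aa s aP" for s'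
    unfolding emit_pattern_def
    apply (simp add: wp_simps ok)
    apply (rule wp_While[where T = "clk s' + 3 * r + 1" and I = "\<lambda>t. vv t vi \<le> r \<and>
      (\<forall>i < vv t vi. aa t 0 (length L + i + 1) = P ! i) \<and> (\<forall>i \<le> length L. aa t 0 i = aa s' 0 i) \<and> clk t \<le> clk s' + 3 * vv t vi + 1"])
    apply simp_all[2]
    subgoal premises p for t
      using p(1,3) s' U n ok nM MW frame_vv[OF p(2)] frame_aa[OF p(2)]
      by (auto simp: wp_simps idx_ok_def narr_def less_Suc_eq)
    subgoal premises p for t
      using p(1,3) s' frame_vv[OF p(2)] by auto
    done
  have 3: "wp emit_suffix (\<lambda>t. (\<forall>i < length Y. aa t 0 (length L + r + i + 1) = Y ! (length Y - Suc i)) \<and>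
      (\<forall>i \<le> length L + r. aa t 0 i = aa s' 0 i) \<and> clk t \<le> clk s' + 3 * length Y + 2) s'"
    if s': "vv s' vbs = length L" "vv s' vr = r" "vv s' vcs = length Y" "aa s' aUr = aa s aUr" for s'
    unfolding emit_suffix_def
    apply (simp add: wp_simps ok)
    apply (rule wp_While[where T = "clk s' + 3 * length Y + 1" and I = "\<lambda>t. vv t vi \<le> length Y \<and>
      (\<forall>i < vv t vi. aa t 0 (length L + r + i + 1) = Y ! (length Y - Suc i)) \<and>
      (\<forall>i \<le> length L + r. aa t 0 i = aa s' 0 i) \<and> clk t \<le> clk s' + 3 * vv t vi + 1"])
    apply simp_all[2]
    subgoal premises p for t
    proof -
      have "aa s aUr (length Y - vv t vi) = Y ! (length Y - Suc (vv t vi))" if "vv t vi < length Y"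
        using U(2)[of "length Y - Suc (vv t vi)"] that by (simp add: Suc_diff_Suc)
      then show ?thesis
        using p(1,3) s' n ok nM MW frame_vv[OF p(2)] frame_aa[OF p(2)]
        by (auto simp: wp_simps idx_ok_def narr_def less_Suc_eq)
    qed
    subgoal premises p for t
      using p(1,3) s' frame_vv[OF p(2)] by auto
    done
  show ?thesis
    apply (simp only: wp_Seq)
    apply (rule wp_conseq[OF 1])
    subgoal premises a for t
    proof -
      note fa = frame_vv[OF a(2)] frame_aa[OF a(2)]
      show ?thesis
        apply (simp only: wp_Seq)
        apply (rule wp_conseq[OF 2])
        apply (simp_all add: fa v)[2]
        subgoal by (simp add: fa)
        subgoal premises b for u
        proof -
          note fb = frame_vv[OF b(2)] frame_aa[OF b(2)]
          show ?thesis
            apply (rule wp_conseq[OF 3])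
            apply (simp_all add: fb fa v)[3]
            subgoal by (simp add: fb fa)
            subgoal premises c for x
            proof -
              let ?O = "L @ P @ rev Y"
              have "aa x 0 (Suc i) = ?O ! i" if i: "i < length ?O" for i
              proof -
                consider "i < length L" | "length L \<le> i" "i < length L + r" | "length L + r \<le> i" by linarith
                then show ?thesis
                proof cases
                  case 1
                  then show ?thesis using a(1) b(1) c(1) by (simp add: nth_append)
                next
                  case 2
                  then obtain k where k: "i = length L + k" "k < r" by (metis add_less_cancel_left le_Suc_ex)
                  then show ?thesis using b(1) c(1) P by (simp add: nth_append)
                next
                  case 3
                  then obtain k where k: "i = length L + r + k" by (metis le_Suc_ex)
                  then have "k < length Y" using i P by simp
                  then show ?thesis using k c(1) P by (simp add: nth_append rev_nth)
                qed
              qed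
              moreover have h0: "aa x 0 0 = Suc (length ?O)" using a(1) b(1) c(1) h P by simp
              ultimately have "map (aa x 0) [1..<aa x 0 0] = ?O"
                by (intro nth_equalityI) (simp_all del: upt_Suc)
              then show ?thesis using a(1) b(1) c(1) n h0 by (simp add: result_def)
            qed
            done
        qed
        done
    qed
    done
qed

lemma emit_wp:
  assumes n: "length A = n" "length B = n" and P: "length P = r"
    and l: "l = lcs A B" "(l + 1) * (n - l + 1) \<le> M" and v: "vv s vl = l" "vv s vr = r"
    and str: "str s aA A" "str s aB B" "str s aAr (rev A)" "str s aBr (rev B)" "\<And>i. i < r \<Longrightarrow> aa s aP i = P ! i"
    and tab: "is_table A B l (n - l) (aa s aF)" "is_table B A l (n - l) (aa s aG)"
      "is_table (rev A) (rev B) l (n - l) (aa s aFr)" "is_table (rev B) (rev A) l (n - l) (aa s aGr)"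
    and best: "vv s vbest = 0 \<or> (vv s vbest = vv s vbs + vv s vcs + 1 \<and>
       record_ok A B P (vv s vbf) (vv s vbs) (vv s vbd) (vv s vcf) (vv s vcs) (vv s vcd))"
  shows "wp emit (\<lambda>t. (if vv s vbest = 0 then result t = None
      else \<exists>X. result t = Some X \<and> ic_candidate A B P X \<and> length X + 1 = r + vv s vbest) \<and> clk t \<le> clk s + 13 * n + 30) s"
proof (cases "vv s vbest = 0")
  case True
  have "idx_ok 0 0" "0 < W" using nM nZ MW by (auto simp: idx_ok_def narr_def)
  then show ?thesis using True by (simp add: emit_def wp_simps result_def)
next
  case False
  have ok: "Suc 0 < W" "0 < W" "idx_ok 0 0" using nM MW nZ by (auto simp: idx_ok_def narr_def)
  have ln: "l \<le> n" using lcs_le[of A B] n l by simp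
  let ?s = "vv s vbs" and ?d = "vv s vbd" and ?t = "vv s vcs" and ?c = "vv s vcd" and ?f = "vv s vbf" and ?g = "vv s vcf"
  have b: "vv s vbest = ?s + ?t + 1" and rec: "record_ok A B P ?f ?s ?d ?g ?t ?c" using best False by auto
  have b1: "?s \<le> l" "?d \<le> n - l" "?t \<le> l" "?c \<le> n - l" using rec n l by (auto simp: record_ok_def Let_def)
  have F: "if ?f = 0 then FF A B ?s (?s + ?d) \<le> n else FF B A ?s (?s + ?d) \<le> n"
    "if ?g = 0 then FF (rev A) (rev B) ?t (?t + ?c) \<le> n else FF (rev B) (rev A) ?t (?t + ?c) \<le> n"
  proof -
    obtain e e' where e: "e \<le> n" "e' \<le> n"
      "if ?f = 0 then ?s + ?d + 1 = sg A P r e \<and> FF A B ?s (?s + ?d) < sg B P r e'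
        else ?s + ?d + 1 = sg B P r e' \<and> FF B A ?s (?s + ?d) < sg A P r e"
      "if ?g = 0 then ?t + ?c = n - e \<and> FF (rev A) (rev B) ?t (?t + ?c) \<le> n - e'
        else ?t + ?c = n - e' \<and> FF (rev B) (rev A) ?t (?t + ?c) \<le> n - e"
      using rec n P unfolding record_ok_def Let_def by auto
    show "if ?f = 0 then FF A B ?s (?s + ?d) \<le> n else FF B A ?s (?s + ?d) \<le> n"
      using e(1,2,3) sg_le[of A P r e] sg_le[of B P r e'] by (auto split: if_splits)
    show "if ?g = 0 then FF (rev A) (rev B) ?t (?t + ?c) \<le> n else FF (rev B) (rev A) ?t (?t + ?c) \<le> n"
      using e(4) by (auto split: if_splits)
  qed
  let ?PX = "\<lambda>L. length L = ?s \<and> (if ?f = 0 then subseq L (take (?s + ?d) A) \<and> subseq L (take (FF A B ?s (?s + ?d)) B)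
      else subseq L (take (?s + ?d) B) \<and> subseq L (take (FF B A ?s (?s + ?d)) A))"
  let ?PY = "\<lambda>Y. length Y = ?t \<and> (if ?g = 0 then subseq Y (take (?t + ?c) (rev A)) \<and> subseq Y (take (FF (rev A) (rev B) ?t (?t + ?c)) (rev B))
      else subseq Y (take (?t + ?c) (rev B)) \<and> subseq Y (take (FF (rev B) (rev A) ?t (?t + ?c)) (rev A)))"
  have T1: "wp (IF BEq (V vbf) (N 0) THEN trace aF aA aU ELSE trace aG aB aU)
      (\<lambda>t. (\<exists>L. ?PX L \<and> (\<forall>i < ?s. aa t aU (Suc i) = L ! i)) \<and> clk t \<le> clk u + 5 * n + 3) u"
    if u: "vv u = (vv s)(vg := ?d, vp := ?s)" "aa u = aa s" for u
  proof (cases "?f = 0")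
    case True
    show ?thesis
      apply (simp add: wp_simps ok u True)
      apply (rule wp_conseq[OF trace_wp[of A B _ 2 l 18 ?d ?s 22]])
      using True F n str tab l ln v b1 by (simp_all add: u str_def narr_def)
  next
    case False
    show ?thesis
      apply (simp add: wp_simps ok u False)
      apply (rule wp_conseq[OF trace_wp[of B A _ 3 l 19 ?d ?s 22]])
      using False F n str tab l ln v b1 by (simp_all add: u str_def narr_def)
  qed
  have T2: "wp (IF BEq (V vcf) (N 0) THEN trace aFr aAr aUr ELSE trace aGr aBr aUr)
      (\<lambda>t. (\<exists>Y. ?PY Y \<and> (\<forall>i < ?t. aa t aUr (Suc i) = Y ! i)) \<and> clk t \<le> clk u + 5 * n + 3) u"
    if u: "vv u vcf = ?g" "vv u vg = ?c" "vv u vp = ?t" "vv u vl = l" "\<And>k. k \<noteq> aU \<Longrightarrow> aa u k = aa s k" for u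
  proof (cases "?g = 0")
    case True
    show ?thesis
      apply (simp add: wp_simps ok u True)
      apply (rule wp_conseq[OF trace_wp[of "rev A" "rev B" _ 4 l 20 ?c ?t 23]])
      using True F n str tab l ln v b1 by (simp_all add: u str_def narr_def)
  next
    case False
    show ?thesis
      apply (simp add: wp_simps ok u False)
      apply (rule wp_conseq[OF trace_wp[of "rev B" "rev A" _ 5 l 21 ?c ?t 23]])
      using False F n str tab l ln v b1 by (simp_all add: u str_def narr_def)
  qed
  show ?thesis
    unfolding emit_def
    apply (simp only: wp_If)
    apply (simp add: False ok wp_Seq wp_Assign)
    apply (rule wp_conseq[OF T1])
    apply simp_all[2]
    subgoal premises a for t
    proof -
      note fa = frame_vv[OF a(2)] frame_aa[OF a(2)]
      obtain L where L: "?PX L" "\<forall>i < ?s. aa t aU (Suc i) = L ! i" using a(1) by blast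
      show ?thesis
        apply (simp add: wp_Seq wp_Assign)
        apply (rule wp_conseq[OF T2])
        apply (simp_all add: fa)[3]
        subgoal using v by (simp add: fa)
        subgoal by (simp add: fa)
        subgoal premises c for x
        proof -
          note fc = frame_vv[OF c(2)] frame_aa[OF c(2)]
          obtain Y where Y: "?PY Y" "\<forall>i < ?t. aa x aUr (Suc i) = Y ! i" using c(1) by blast
          have cand: "ic_candidate A B P (L @ P @ rev Y)"
            by (rule record_ok_candidate[OF rec n]) (use L Y in auto)
          have len: "length L = ?s" "length Y = ?t" using L Y by auto
          have "length (L @ P @ rev Y) \<le> n"
            using cand n by (auto simp: ic_candidate_def common_subseq_def dest: list_emb_length)
          then have len': "?s + r + ?t \<le> n" using len P by simp
          then have bW: "vv s vbest + r < W" using b nM MW by simp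
          have "wp (emit_prefix;; emit_pattern;; emit_suffix) (\<lambda>u. result u = Some (L @ P @ rev Y) \<and> clk u \<le> clk x + 1 + 3 * n + 9)
              (x\<lparr>aa := (aa x)(0 := (aa x 0)(0 := vv s vbest + r)), clk := clk x + 1\<rparr>)"
            apply (rule wp_conseq[OF emit_parts_wp[of _ L Y P]])
            using L(2) Y(2) len len' v P str(5) b by (simp_all add: fc fa)
          then have "wp (emit_prefix;; emit_pattern;; emit_suffix) (\<lambda>t. (\<exists>X. result t = Some X \<and> ic_candidate A B P X \<and>
              length X + 1 = r + vv s vbest) \<and> clk t \<le> clk s + 13 * n + 30)
              (x\<lparr>aa := (aa x)(0 := (aa x 0)(0 := vv s vbest + r)), clk := clk x + 1\<rparr>)"
            by (rule wp_conseq) (use a(1) c(1) cand len b P in simp)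
          then show ?thesis
            by (simp add: wp_Seq wp_Write ok fc fa v bW)
        qed
        done
    qed
    done
qed

end

section \<open>The complete algorithm\<close>

text \<open>A cube grows at most by the factor 8 when \<open>m\<close> increases by one, far less
  than 256. With \<open>m = k - 1\<close> this bounds \<open>k ^ 3\<close> by \<open>r + 1\<close>,
  the inequality behind the cost of the dictionary.\<close>

lemma cube_le_power: "(m + 1) ^ 3 \<le> (256 :: nat) ^ m"
proof (induction m)
  case (Suc m)
  have "(Suc m + 1) ^ 3 \<le> (2 * (m + 1)) ^ 3" by (rule power_mono) auto
  also have "\<dots> = 8 * (m + 1) ^ 3" by (subst power_mult_distrib) simp
  also have "\<dots> \<le> 256 * 256 ^ m" using Suc by simp
  finally show ?case by simp
qed simp

context sized begin

definition phase_input :: com where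
  "phase_input = read_input;; choose_k;; sort_groups;; lookup aA aIA (N 1) (V vn \<oplus> N 1);;
     lookup aB aIB (N 1) (V vn \<oplus> N 1);; lookup aP aIP (N 0) (V vr)"

definition phase_windows :: com where
  "phase_windows = build_table;; build_topbit;; windows aIA aSA;; windows aIB aSB"

definition phase_tables :: com where
  "phase_tables = lcs_length aA aB;; fill_table aA aB aF;; fill_table aB aA aG;;
     fill_table aAr aBr aFr;; fill_table aBr aAr aGr"

definition phase_scan :: com where
  "phase_scan = vbest ::= N 0;; scan_all aSA aSB aF aFr aGr 0;; scan_all aSB aSA aG aGr aFr 1"

definition main_prog :: com where
  "main_prog = phase_input;; phase_windows;; phase_tables;; phase_scan;; emit"

lemma mv_phases [simp]:
  "mv phase_input = {10, 11, 12, 13, 20, 21, 22, 23, 24, 25, 26, 27, 28, 29}" "ma phase_input = {2,3,4,5,6,7,8,9,10}"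
  "mv phase_windows = {20, 21, 22, 23, 24, 25, 26, 27, 28, 29, 30, 31, 32}" "ma phase_windows = {11, 12, 13, 14, 15, 16}"
  "mv phase_tables = {14, 15, 20, 21, 23, 24, 25, 26, 28}" "ma phase_tables = {17, 18, 19, 20, 21}"
  "mv phase_scan = {20, 21, 22, 23, 24, 25, 26, 27, 28, 29, 30, 40, 41, 42, 43, 44, 45, 46}" "ma phase_scan = {}"
  by (auto simp: phase_input_def phase_windows_def phase_tables_def phase_scan_def)

lemma block_len_facts:
  assumes "block_len k"
  shows "1 \<le> k" "k \<le> r + 1" "k * k \<le> r + 1" "16 ^ k \<le> 16 * (n + 1)"
proof -
  show k1: "1 \<le> k" using assms by (simp add: block_len_def)
  obtain m where m: "k = Suc m" using k1 by (cases k) auto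
  have *: "m = 0 \<or> 256 ^ m \<le> r" using assms m by (auto simp: block_len_def)
  have "k ^ 3 \<le> r + 1" using cube_le_power[of m] * m by auto
  moreover have "k \<le> k * k" "k * k \<le> k * k * k" using k1 by simp_all
  ultimately show "k \<le> r + 1" "k * k \<le> r + 1" unfolding power3_eq_cube by linarith+
  have "(16::nat) ^ m \<le> 256 ^ m" by (rule power_mono) auto
  then show "16 ^ k \<le> 16 * (n + 1)" using * m rn by auto
qed

text \<open>The later phases need to know only that some common dictionary underlies all
  identifiers; hence the existential quantifier.\<close>

definition indexed :: "nat list \<Rightarrow> nat list \<Rightarrow> nat list \<Rightarrow> st \<Rightarrow> bool" where
  "indexed A B P t \<longleftrightarrow> (\<exists>Q. (\<forall>i < r. P ! i \<in> Q ` {..<r} \<and> aa t aIP i = idf Q (P ! i)) \<and>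
     (\<forall>i < n. aa t aIA (Suc i) = idf Q (A ! i) \<and> aa t aIB (Suc i) = idf Q (B ! i)))"

definition input_time :: "nat \<Rightarrow> nat" where
  "input_time k = 10 * n + 4 * r + r * (5 * (k * k) + 7) + (2 * n + r) * (search_time k + 4) + 24"

lemma phase_input_wp:
  assumes n: "length A = n" "length B = n" "length P = r"
    and mem: "\<And>i. i < 2 * n + r + 2 \<Longrightarrow> aa s 0 i = input_words A B P ! i"
  shows "wp phase_input (\<lambda>t. vv t vn = n \<and> vv t vr = r \<and> block_len (vv t vk) \<and> vv t vK = 2 ^ vv t vk \<and>
     str t aA A \<and> str t aB B \<and> str t aAr (rev A) \<and> str t aBr (rev B) \<and> (\<forall>i < r. aa t aP i = P ! i) \<and>
     indexed A B P t \<and> clk t \<le> clk s + input_time (vv t vk)) s"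
proof -
  have ok: "Suc 0 < W" "0 < W" "Suc n < W" using nM MW by auto
  show ?thesis
    unfolding phase_input_def
    apply (simp only: wp_Seq)
    apply (rule wp_conseq[OF read_input_wp[OF n mem]])
    subgoal by assumption
    subgoal premises a for t1
      apply (simp only: wp_Seq)
      apply (rule wp_conseq[OF choose_k_wp])
      subgoal using a(1) by simp
      subgoal premises b for t2
      proof -
        note f2 = frame_vv[OF b(2)] frame_aa[OF b(2)]
        define k where "k = vv t2 vk"
        note bl = block_len_facts[of k]
        have bk: "block_len k" "vv t2 vK = 2 ^ k" using b(1) by (auto simp: k_def)
        note bl = block_len_facts[OF bk(1)]
        show ?thesis
          apply (simp only: wp_Seq)
          apply (rule wp_conseq[OF sort_groups_wp[of _ k]])
          subgoal using a(1) by (simp add: f2)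
          subgoal by (simp add: k_def)
          subgoal by (rule bl)
          subgoal by (rule bl)
          subgoal premises c for t3
          proof -
            note f3 = frame_vv[OF c(2)] frame_aa[OF c(2)]
            let ?Q = "aa t3 aQ"
            have Q: "sorted_groups (k * k) ?Q r" "vv t3 vm = k * k" "P ! i \<in> ?Q ` {..<r}" if "i < r" for i
            proof -
              show "sorted_groups (k * k) ?Q r" "vv t3 vm = k * k" using c(1) by auto
              have "?Q ` {..<r} = aa t1 aQ ` {..<r}" using c(1) by (simp add: f2)
              then show "P ! i \<in> ?Q ` {..<r}" using a(1) that by force
            qed
            have vs: "vv t3 vk = k" "vv t3 vr = r" "vv t3 vn = n" "vv t3 vm = k * k" "sorted_groups (k * k) ?Q r"
              using a(1) c(1) by (auto simp: f3 f2 k_def[symmetric])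
            show ?thesis
              apply (simp only: wp_Seq)
              apply (rule wp_conseq[OF lookup_wp[of _ k "N 1" 1 aA aIA "V vn \<oplus> N 1" "n + 1"]])
              subgoal by (rule vs)
              subgoal by (rule vs)
              subgoal by (rule vs)
              subgoal by simp
              subgoal premises z for z
                using ok vs frame_vv[OF z] by simp
              subgoal by (rule bl)
              subgoal by (rule bl)
              apply simp_all[2]
              subgoal using ok by simp
              apply simp_all[2]
              apply (simp_all add: narr_def)[2]
              apply simp_all[2]
              subgoal by (rule vs)
              subgoal premises d for t4
              proof -
                note f4 = frame_vv[OF d(2)] frame_aa[OF d(2)]
                show ?thesis
                  apply (simp only: wp_Seq)
                  apply (rule wp_conseq[OF lookup_wp[of _ k "N 1" 1 aB aIB "V vn \<oplus> N 1" "n + 1"]])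
                  using vs apply (simp_all add: f4)[3]
                  subgoal by simp
                  subgoal premises z for z
                    using ok vs frame_vv[OF z] by (simp add: f4)
                  subgoal by (rule bl)
                  subgoal by (rule bl)
                  apply simp_all[2]
                  subgoal using ok by simp
                  apply simp_all[2]
                  apply (simp_all add: narr_def)[2]
                  apply simp_all[2]
                  subgoal using vs by (simp add: f4)
                  subgoal premises e for t5
                  proof -
                    note f5 = frame_vv[OF e(2)] frame_aa[OF e(2)]
                    show ?thesis
                      apply (rule wp_conseq[OF lookup_wp[of _ k "N 0" 0 aP aIP "V vr" r]])
                      using vs apply (simp_all add: f5 f4)[3]
                      subgoal by simp
                      subgoal premises z for z
                        using ok vs frame_vv[OF z] by (simp add: f5 f4)
                      subgoal by (rule bl)
                      subgoal by (rule bl)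
                      subgoal by simp
                      subgoal using rn by simp
                      subgoal using ok by simp
                      apply simp_all[2]
                      apply (simp_all add: narr_def)[2]
                      apply simp_all[2]
                      subgoal using vs by (simp add: f5 f4)
                      subgoal premises g for t6
                      proof -
                        note f6 = frame_vv[OF g(2)] frame_aa[OF g(2)]
                        have A: "aa t1 aA (Suc i) = A ! i" "aa t1 aB (Suc i) = B ! i" if "i < n" for i
                          using a(1) n that by (auto simp: str_def)
                        have "indexed A B P t6"
                          unfolding indexed_def
                        proof (intro exI[of _ ?Q] conjI allI impI)
                          fix i assume "i < r"
                          then show "P ! i \<in> ?Q ` {..<r}" by (rule Q)
                          show "aa t6 aIP i = idf ?Q (P ! i)"
                            using g(1) a(1) \<open>i < r\<close> by (simp add: f5 f4 f3 f2)
                        next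
                          fix i assume "i < n"
                          then show "aa t6 aIA (Suc i) = idf ?Q (A ! i)" "aa t6 aIB (Suc i) = idf ?Q (B ! i)"
                            using d(1) e(1) A by (simp_all add: f6 f5 f4 f3 f2)
                        qed
                        moreover have "vv t6 vk = k" "vv t6 vK = 2 ^ k" "vv t6 vn = n" "vv t6 vr = r"
                          using vs bk by (simp_all add: f6 f5 f4 f3)
                        moreover have "clk t6 \<le> clk s + input_time k"
                          using a(1) b(1) c(1) d(1) e(1) g(1) unfolding input_time_def by (simp add: algebra_simps)
                        moreover have "str t6 aA A" "str t6 aB B" "str t6 aAr (rev A)" "str t6 aBr (rev B)" "\<forall>i < r. aa t6 aP i = P ! i"
                          using a(1) by (simp_all add: str_def f6 f5 f4 f3 f2)
                        ultimately show ?thesis using bk by simp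
                      qed
                      done
                  qed
                  done
              qed
              done
          qed
          done
      qed
      done
    done
qed

definition phase_windows_time :: "nat \<Rightarrow> nat" where
  "phase_windows_time k = 16 ^ k * (24 * k + 13) + 2 * windows_time k + 9"

lemma phase_windows_wp:
  assumes n: "length A = n" "length B = n" "length P = r"
    and v: "vv s vn = n" "vv s vr = r" "vv s vk = k" "vv s vK = 2 ^ k" and k: "block_len k"
    and ix: "indexed A B P s" and M0: "\<And>c. aa s aM c = 0"
  shows "wp phase_windows (\<lambda>t. (\<forall>i \<le> n. aa t aSA i = sg A P r i) \<and> (\<forall>i \<le> n. aa t aSB i = sg B P r i) \<and>
     clk t \<le> clk s + phase_windows_time k) s"
proof -
  note bl = block_len_facts[OF k]
  obtain Q where Q: "\<And>i. i < r \<Longrightarrow> P ! i \<in> Q ` {..<r}" "\<And>i. i < r \<Longrightarrow> aa s aIP i = idf Q (P ! i)"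
    "\<And>i. i < n \<Longrightarrow> aa s aIA (Suc i) = idf Q (A ! i)" "\<And>i. i < n \<Longrightarrow> aa s aIB (Suc i) = idf Q (B ! i)"
    using ix unfolding indexed_def by blast
  show ?thesis
    unfolding phase_windows_def
    apply (simp only: wp_Seq)
    apply (rule wp_conseq[OF build_table_wp[OF v(4) bl(4)]])
    subgoal premises a for t1
    proof -
      note f1 = frame_vv[OF a(2)] frame_aa[OF a(2)]
      show ?thesis
        apply (simp only: wp_Seq)
        apply (rule wp_conseq[OF build_topbit_wp[OF _ bl(4,1)]])
        subgoal using v by (simp add: f1)
        subgoal premises b for t2
        proof -
          note f2 = frame_vv[OF b(2)] frame_aa[OF b(2)]
          show ?thesis
            apply (simp only: wp_Seq)
            apply (rule wp_conseq[OF windows_wp[OF n(1,3), of _ k aSA aIA Q]])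
            using v apply (simp_all add: f2 f1)[4]
            subgoal by (rule bl)
            subgoal by (rule bl)
            subgoal by (rule bl)
            apply simp_all[2]
            apply (simp_all add: narr_def)[2]
            apply simp_all[8]
            subgoal using a(1) by (simp add: f2)
            subgoal using b(1) by simp
            subgoal by (rule Q)
            using Q apply (simp_all add: f2 f1)[2]
            subgoal using M0 by (simp add: f2 f1)
            subgoal premises c for t3
            proof -
              note f3 = frame_vv[OF c(2)] frame_aa[OF c(2)]
              show ?thesis
                apply (rule wp_conseq[OF windows_wp[OF n(2,3), of _ k aSB aIB Q]])
                using v apply (simp_all add: f3 f2 f1)[4]
                subgoal by (rule bl)
                subgoal by (rule bl)
                subgoal by (rule bl)
                apply simp_all[2]
                apply (simp_all add: narr_def)[2]
                apply simp_all[8]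
                subgoal using a(1) by (simp add: f3 f2)
                subgoal using b(1) by (simp add: f3)
                subgoal by (rule Q)
                using Q apply (simp_all add: f3 f2 f1)[2]
                subgoal using c(1) by simp
                subgoal premises d for t4
                  using a(1) b(1) c(1) d(1) frame_aa[OF d(2)]
                  unfolding phase_windows_time_def by (simp add: algebra_simps)
                done
            qed
            done
        qed
        done
    qed
    done
qed

definition tables_time :: "nat \<Rightarrow> nat" where
  "tables_time D = (D + 1) * (67 * n + 120) + 15 * n + 75"

lemma phase_tables_wp:
  assumes n: "length A = n" "length B = n" and v: "vv s vn = n"
    and str: "str s aA A" "str s aB B" "str s aAr (rev A)" "str s aBr (rev B)"
    and M: "(lcs A B + 1) * (n - lcs A B + 1) \<le> M"
  defines "l \<equiv> lcs A B"
  shows "wp phase_tables (\<lambda>t. vv t vl = l \<and> vv t vD = n - l \<and>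
     is_table A B l (n - l) (aa t aF) \<and> is_table B A l (n - l) (aa t aG) \<and>
     is_table (rev A) (rev B) l (n - l) (aa t aFr) \<and> is_table (rev B) (rev A) l (n - l) (aa t aGr) \<and>
     clk t \<le> clk s + tables_time (n - l)) s"
proof -
  have ln: "l \<le> n" using lcs_le[of A B] n by (simp add: l_def)
  note M' = M[folded l_def]
  have rv: "length (rev A) = n" "length (rev B) = n" using n by auto
  show ?thesis
    unfolding phase_tables_def
    apply (simp only: wp_Seq)
    apply (rule wp_conseq[OF lcs_length_wp[OF n str(1,2) v]])
    subgoal by simp
    subgoal by (simp add: narr_def)
    subgoal by simp
    subgoal by (simp add: narr_def)
    apply simp_all[2]
    subgoal premises a for t1
    proof -
      note f1 = frame_vv[OF a(2)] frame_aa[OF a(2)]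
      have lv: "vv t1 vl = l" "vv t1 vD = n - l" "vv t1 vn = n" using a(1) v by (auto simp: l_def f1)
      show ?thesis
        apply (simp only: wp_Seq)
        apply (rule wp_conseq[OF fill_table_wp[OF n, of _ 2 3 l 18]])
        using str lv ln M' apply (simp_all add: str_def f1 narr_def)[18]
        subgoal premises b for t2
        proof -
          note f2 = frame_vv[OF b(2)] frame_aa[OF b(2)]
          show ?thesis
            apply (simp only: wp_Seq)
            apply (rule wp_conseq[OF fill_table_wp[OF n(2,1), of _ 3 2 l 19]])
            using str lv ln M' apply (simp_all add: str_def f2 f1 narr_def)[18]
            subgoal premises c for t3
            proof -
              note f3 = frame_vv[OF c(2)] frame_aa[OF c(2)]
              show ?thesis
                apply (simp only: wp_Seq)
                apply (rule wp_conseq[OF fill_table_wp[OF rv, of _ 4 5 l 20]])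
                using str lv ln M' apply (simp_all add: str_def f3 f2 f1 narr_def)[18]
                subgoal premises d for t4
                proof -
                  note f4 = frame_vv[OF d(2)] frame_aa[OF d(2)]
                  show ?thesis
                    apply (rule wp_conseq[OF fill_table_wp[OF rv(2,1), of _ 5 4 l 21]])
                    using str lv ln M' apply (simp_all add: str_def f4 f3 f2 f1 narr_def)[18]
                    subgoal premises e for t5
                    proof -
                      note f5 = frame_vv[OF e(2)] frame_aa[OF e(2)]
                      define x where "x = n - l + 1"
                      have "clk t5 \<le> clk s + tables_time (n - l)"
                        using a(1) b(1) c(1) d(1) e(1) unfolding tables_time_def l_def[symmetric] x_def[symmetric]
                        by (simp add: algebra_simps)
                      then show ?thesis using b(1) c(1) d(1) e(1) lv
                        by (simp add: f5 f4 f3 f2)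
                    qed
                    done
                qed
                done
            qed
            done
        qed
        done
    qed
    done
qed

lemma record_okI:
  assumes "s \<le> lcs A B" "d \<le> length A - lcs A B" "t \<le> lcs A B" "d' \<le> length A - lcs A B"
    "e \<le> length A" "e' \<le> length A" "0 < sg A P (length P) e" "0 < sg B P (length P) e'"
    "if fl = 0 then s + d + 1 = sg A P (length P) e \<and> FF A B s (s + d) < sg B P (length P) e'
     else s + d + 1 = sg B P (length P) e' \<and> FF B A s (s + d) < sg A P (length P) e"
    "if gl = 0 then t + d' = length A - e \<and> FF (rev A) (rev B) t (t + d') \<le> length A - e'
     else t + d' = length A - e' \<and> FF (rev B) (rev A) t (t + d') \<le> length A - e"
  shows "record_ok A B P fl s d gl t d'"
  using assms unfolding record_ok_def Let_def by blast

lemma scanning_AB: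
  assumes n: "length A = n" "length B = n" "length P = r" and M: "(lcs A B + 1) * (n - lcs A B + 1) \<le> M"
  shows "scanning W M Z n r A B P (lcs A B) aSA aSB aF aFr aGr 0 (record_ok A B P)"
    "scanning W M Z n r B A P (lcs A B) aSB aSA aG aGr aFr 1 (record_ok A B P)"
proof -
  show "scanning W M Z n r A B P (lcs A B) aSA aSB aF aFr aGr 0 (record_ok A B P)"
  proof (unfold_locales, goal_cases)
    case (17 e e' s d s2 d2)
    then show ?case using n by (intro record_okI[of _ A B _ _ _ e e']) auto
  next
    case (18 e e' s d s2 d2)
    then show ?case using n by (intro record_okI[of _ A B _ _ _ e e']) auto
  qed (use n M in \<open>auto simp: narr_def\<close>)
  show "scanning W M Z n r B A P (lcs A B) aSB aSA aG aGr aFr 1 (record_ok A B P)"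
  proof (unfold_locales, goal_cases)
    case (17 e e' s d s2 d2)
    \<comment> \<open>In the exchanged pass the end of the window in \<open>A\<close> is the second
      one, so the witnesses swap places.\<close>
    then show ?case using n lcs_sym[of B A] by (intro record_okI[of _ A B _ _ _ e' e]) auto
  next
    case (18 e e' s d s2 d2)
    then show ?case using n lcs_sym[of B A] by (intro record_okI[of _ A B _ _ _ e' e]) auto
  qed (use n M lcs_sym[of A B] in \<open>auto simp: narr_def\<close>)
qed

definition scan_time :: "nat \<Rightarrow> nat" where
  "scan_time D = 2 * ((D + 1) * (44 * (n + 1) + 16)) + 9"

lemma phase_scan_wp:
  assumes n: "length A = n" "length B = n" "length P = r" and M: "(lcs A B + 1) * (n - lcs A B + 1) \<le> M"
    and v: "vv s vn = n" "vv s vl = lcs A B" "vv s vD = n - lcs A B"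
    and S: "\<And>i. i \<le> n \<Longrightarrow> aa s aSA i = sg A P r i" "\<And>i. i \<le> n \<Longrightarrow> aa s aSB i = sg B P r i"
    and tab: "is_table A B (lcs A B) (n - lcs A B) (aa s aF)" "is_table B A (lcs A B) (n - lcs A B) (aa s aG)"
      "is_table (rev A) (rev B) (lcs A B) (n - lcs A B) (aa s aFr)" "is_table (rev B) (rev A) (lcs A B) (n - lcs A B) (aa s aGr)"
  shows "wp phase_scan (\<lambda>t. (vv t vbest = 0 \<or> (vv t vbest = vv t vbs + vv t vcs + 1 \<and>
       record_ok A B P (vv t vbf) (vv t vbs) (vv t vbd) (vv t vcf) (vv t vcs) (vv t vcd))) \<and>
     (\<forall>Z. ic_candidate A B P Z \<longrightarrow> length Z + 1 \<le> r + vv t vbest) \<and> clk t \<le> clk s + scan_time (n - lcs A B)) s"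
proof -
  have ok: "0 < W" using nM MW by auto
  interpret AB: scanning W M Z n r A B P "lcs A B" aSA aSB aF aFr aGr 0 "record_ok A B P"
    by (rule scanning_AB(1)[OF n M])
  interpret BA: scanning W M Z n r B A P "lcs A B" aSB aSA aG aGr aFr 1 "record_ok A B P"
    by (rule scanning_AB(2)[OF n M])
  have e1: "AB.env t" if "vv t vn = n" "vv t vl = lcs A B" "vv t vD = n - lcs A B" "aa t = aa s" for t
    unfolding AB.env_def using S tab that by simp
  have e2: "BA.env t" if "vv t vn = n" "vv t vl = lcs A B" "vv t vD = n - lcs A B" "aa t = aa s" for t
    unfolding BA.env_def using S tab that by simp
  have aeq: "aa u = aa t" if "frame c t u" "ma c = {}" for c u t
    using that by (auto simp: frame_def)
  show ?thesis
    unfolding phase_scan_def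
    apply (simp add: wp_Seq wp_Assign ok)
    apply (rule wp_conseq[OF AB.scan_all_wp])
    subgoal by (rule e1) (use v in simp_all)
    subgoal by (simp add: AB.best_ok_def)
    subgoal premises a for t
    proof -
      note fa = frame_vv[OF a(2)]
      show ?thesis
        \<comment> \<open>The second pass starts from the record of the first and never lowers it,
          so that its final value covers both orders.\<close>
        apply (rule wp_conseq[OF BA.scan_all_wp[unfolded One_nat_def]])
        subgoal by (rule e2) (use v aeq[OF a(2)] in \<open>simp_all add: fa\<close>)
        subgoal using a(1) by (simp add: AB.best_ok_def BA.best_ok_def)
        subgoal premises b for u
        proof -
          have c1: "pair_cover A B P (vv u vbest)"
            unfolding pair_cover_def Let_def
          proof (intro allI impI, goal_cases)
            case (1 d e s e' t')
            then have "AB.covered d e (vv u vbest)"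
              using a(1) b(1) AB.covered_mono n by blast
            then show ?case using 1 n unfolding AB.covered_def by simp
          qed
          have c2: "pair_cover B A P (vv u vbest)"
            unfolding pair_cover_def Let_def
          proof (intro allI impI, goal_cases)
            case (1 d e s e' t')
            then have "BA.covered d e (vv u vbest)"
              using b(1) n lcs_sym[of A B] by simp
            then show ?case using 1 n lcs_sym[of A B] unfolding BA.covered_def by simp
          qed
          define x where "x = n - lcs A B + 1"
          have "clk u \<le> clk s + scan_time (n - lcs A B)"
            using a(1) b(1) unfolding scan_time_def x_def[symmetric] x_def[symmetric, unfolded One_nat_def] by (simp add: algebra_simps)
          then show ?thesis
            using b(1) cover_candidate[OF n(1,2) c1 c2] n(3) by (simp add: BA.best_ok_def)
        qed
        done
    qed
    done
qed

definition total_time :: "nat \<Rightarrow> nat \<Rightarrow> nat" where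
  "total_time k D = input_time k + phase_windows_time k + tables_time D + scan_time D + 13 * n + 30"

lemma main_prog_wp:
  assumes n: "length A = n" "length B = n" "length P = r"
    and mem: "\<And>i. i < 2 * n + r + 2 \<Longrightarrow> aa s 0 i = input_words A B P ! i" and M0: "\<And>c. aa s aM c = 0"
    and M: "(lcs A B + 1) * (n - lcs A B + 1) \<le> M"
  shows "wp main_prog (\<lambda>t. is_STR_IC_LCS A B P (result t) \<and>
     (\<exists>k. block_len k \<and> clk t \<le> clk s + total_time k (n - lcs A B))) s"
proof -
  show ?thesis
    unfolding main_prog_def
    apply (simp only: wp_Seq)
    apply (rule wp_conseq[OF phase_input_wp[OF n mem]])
    subgoal by assumption
    subgoal premises a for t1
    proof -
      note f1 = frame_vv[OF a(2)] frame_aa[OF a(2)]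
      define k where "k = vv t1 vk"
      show ?thesis
        apply (simp only: wp_Seq)
        apply (rule wp_conseq[OF phase_windows_wp[OF n, of _ k]])
        using a(1) apply simp_all[2]
        subgoal by (simp add: k_def)
        using a(1) apply (simp_all add: k_def)[2]
        subgoal using a(1) by simp
        subgoal using M0 by (simp add: f1)
        subgoal premises b for t2
        proof -
          note f2 = frame_vv[OF b(2)] frame_aa[OF b(2)]
          show ?thesis
            apply (simp only: wp_Seq)
            apply (rule wp_conseq[OF phase_tables_wp[OF n(1,2)]])
            subgoal using a(1) by (simp add: f2)
            using a(1) apply (simp_all add: f2 str_def)[4]
            subgoal by (rule M)
            subgoal premises c for t3
            proof -
              note f3 = frame_vv[OF c(2)] frame_aa[OF c(2)]
              show ?thesis
                apply (simp only: wp_Seq)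
                apply (rule wp_conseq[OF phase_scan_wp[OF n M]])
                subgoal using a(1) by (simp add: f3 f2)
                using c(1) apply simp_all[2]
                using b(1) apply (simp_all add: f3)[2]
                using c(1) apply simp_all[4]
                subgoal premises d for t4
                proof -
                  note f4 = frame_vv[OF d(2)] frame_aa[OF d(2)]
                  show ?thesis
                    apply (rule wp_conseq[OF emit_wp[OF n refl M]])
                    subgoal using c(1) by (simp add: f4)
                    subgoal using a(1) by (simp add: f4 f3 f2)
                    using a(1) apply (simp_all add: f4 f3 f2 str_def)[4]
                    subgoal using a(1) by (simp add: f4 f3 f2)
                    using c(1) apply (simp_all add: f4)[4]
                    subgoal using d(1) by blast
                    subgoal premises e for t5
                    proof -
                      have opt: "length Z + 1 \<le> r + vv t4 vbest" if "ic_candidate A B P Z" for Z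
                        using d(1) that by blast
                      have rl: "r \<le> length Z" if "ic_candidate A B P Z" for Z
                        using that n by (auto simp: ic_candidate_def sublist_def)
                      have "is_STR_IC_LCS A B P (result t5)"
                      proof (cases "vv t4 vbest = 0")
                        case True
                        \<comment> \<open>Every candidate has at least \<open>r\<close> characters,
                          whereas the bound with \<open>vbest = 0\<close> would leave it
                          fewer.\<close>
                        have "\<not> ic_candidate A B P Z" for Z
                        proof
                          assume "ic_candidate A B P Z"
                          from opt[OF this] rl[OF this] True show False by simp
                        qed
                        then show ?thesis using e(1) True by (simp add: is_STR_IC_LCS_def)
                      next
                        case False
                        then obtain X where X: "result t5 = Some X" "ic_candidate A B P X" "length X + 1 = r + vv t4 vbest"
                          using e(1) by auto
                        have "length Z \<le> length X" if "ic_candidate A B P Z" for Z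
                          using opt[OF that] X(3) by simp
                        then show ?thesis using X by (simp add: is_STR_IC_LCS_def)
                      qed
                      moreover have "clk t5 \<le> clk s + total_time k (n - lcs A B)"
                        using a(1) b(1) c(1) d(1) e(1) unfolding total_time_def k_def[symmetric] by linarith
                      ultimately show ?thesis using a(1) by (auto simp: k_def)
                    qed
                    done
                qed
                done
            qed
            done
        qed
        done
    qed
    done
qed

end

section \<open>Resource bounds and the main theorem\<close>

text \<open>A product of two positive integers is at least their sum minus one. All arrays of linear
  size are thereby absorbed into the space bound.\<close>

lemma space_shape: "l \<le> n \<Longrightarrow> n + 1 \<le> (l + 1) * (n - l + 1)" for l n :: nat
proof -
  assume "l \<le> n"
  then obtain d where "n = l + d" using le_Suc_ex by blast
  then show ?thesis by simp
qed

context sized begin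

text \<open>All other costs reduce to n r/k and n (D + 1): r k^2 is at most n r/k since
  \<open>k ^ 3\<close> is at most \<open>n\<close>; n k is at most n r/k + n since
  \<open>k * k\<close> is at most \<open>r\<close> unless \<open>k = 1\<close>; and
  \<open>16 ^ k * k\<close> is at most \<open>16 * n\<close>.\<close>

lemma total_time_bound:
  assumes k: "block_len k" and n0: "0 < n"
  shows "real (total_time k D) \<le> 2000 * (real n * real r / real k + real n * (real D + 1))"
proof -
  define y where "y = real n * real r / real k"
  define z where "z = real n * (real D + 1)"
  obtain m where m: "k = Suc m" using k by (cases k) (auto simp: block_len_def)
  have *: "m = 0 \<or> 256 ^ m \<le> r" using k m by (auto simp: block_len_def)
  have p1: "256 ^ m \<le> n" using * rn n0 by auto
  have k3: "k ^ 3 \<le> n" using cube_le_power[of m] p1 m by simp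
  have k0: "0 < real k" "1 \<le> real k" using m by auto
  have n1: "1 \<le> real n" using n0 by simp
  have y0: "0 \<le> y" by (simp add: y_def)
  have zn: "real n \<le> z" using n1 by (simp add: z_def algebra_simps)
  have rn': "real r \<le> real n" using rn by simp
  have kn: "real k \<le> real n"
  proof -
    have "k \<le> k ^ 3" using m by (simp add: power3_eq_cube)
    then show ?thesis using k3 by linarith
  qed
  have nk: "real n * real k \<le> y + real n"
  proof -
    have "m = 0 \<or> k * k \<le> r"
    proof -
      have "k * k \<le> k ^ 3" using m by (simp add: power3_eq_cube)
      then show ?thesis using * cube_le_power[of m] m by (auto simp: power3_eq_cube)
    qed
    then show ?thesis
    proof
      assume "m = 0" then show ?thesis using y0 m by simp
    next
      assume "k * k \<le> r"
      then have "real k * real k \<le> real r" by (metis of_nat_le_iff of_nat_mult)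
      then have "real k \<le> real r / real k" using k0 by (simp add: field_simps)
      then have "real n * real k \<le> real n * (real r / real k)" by (intro mult_left_mono) auto
      then show ?thesis using n1 by (simp add: y_def)
    qed
  qed
  have rk2: "real r * (real k * real k) \<le> y"
  proof -
    have "real k ^ 3 \<le> real n" using k3 by (metis of_nat_le_iff of_nat_power)
    then have "real r * real k ^ 3 \<le> real r * real n" by (intro mult_left_mono) auto
    then show ?thesis using k0 by (simp add: y_def field_simps power3_eq_cube)
  qed
  have d1: "real (r div (k * k)) \<le> real r / (real k * real k)"
    using of_nat_div_le_of_nat[of r "k * k"] by simp
  have d2: "real (r div k) \<le> real r / real k"
    using of_nat_div_le_of_nat[of r k] by simp
  have st: "real n * real (search_time k) \<le> 36 * y + 39 * real n"
  proof -
    have "real (search_time k) = (real (r div (k * k)) + 1) * (4 * real k + 14) + 3"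
      by (simp add: search_time_def algebra_simps)
    also have "\<dots> \<le> (real r / (real k * real k) + 1) * (4 * real k + 14) + 3"
      using d1 by (intro add_right_mono mult_right_mono) auto
    also have "\<dots> \<le> (real r / (real k * real k) + 1) * (18 * real k) + 3"
      using k0 by (intro add_right_mono mult_left_mono) auto
    also have "\<dots> = 18 * (real r / real k) + 18 * real k + 3"
      using k0 by (simp add: field_simps)
    finally have "real n * real (search_time k) \<le> real n * (18 * (real r / real k) + 18 * real k + 3)"
      by (intro mult_left_mono) auto
    also have "\<dots> = 18 * y + 18 * (real n * real k) + 3 * real n" by (simp add: y_def algebra_simps)
    finally show ?thesis using nk n1 by linarith
  qed
  have rst: "real r * real (search_time k) \<le> 36 * y + 39 * real n"
    using st mult_right_mono[OF rn', of "real (search_time k)"] by linarith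
  have t1: "real (input_time k) \<le> 113 * y + 200 * real n"
  proof -
    have "real (input_time k) = 10 * real n + 4 * real r + 5 * (real r * (real k * real k)) + 7 * real r +
        2 * (real n * real (search_time k)) + real r * real (search_time k) + 8 * real n + 4 * real r + 24"
      unfolding input_time_def by (simp add: algebra_simps)
    then show ?thesis using rk2 st rst rn' n1 by linarith
  qed
  \<comment> \<open>Since 256 is 16 squared, \<open>n\<close> is at least the square of
    \<open>16 ^ m\<close>; one factor pays for the number of table entries and the other for the
    O(k) steps of each.\<close>
  have p16: "real (16 ^ k) * real k \<le> 16 * real n" "real (16 ^ k) \<le> 16 * real n"
  proof -
    have "Suc m \<le> 16 ^ m" by (induction m) auto
    then have "16 ^ m * Suc m \<le> 16 ^ m * 16 ^ m" by (intro mult_le_mono2)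
    also have "\<dots> = (256::nat) ^ m" by (simp flip: power_mult_distrib)
    finally have "16 ^ m * Suc m \<le> n" using p1 by linarith
    then have "16 ^ k * k \<le> 16 * n" using m by simp
    then show "real (16 ^ k) * real k \<le> 16 * real n" by (metis of_nat_le_iff of_nat_mult of_nat_numeral)
    moreover have "real (16 ^ k) * 1 \<le> real (16 ^ k) * real k" using k0 by (intro mult_left_mono) auto
    ultimately show "real (16 ^ k) \<le> 16 * real n" by linarith
  qed
  have wt: "real (windows_time k) \<le> 116 * y + 131 * real n"
  proof -
    have "real (windows_time k) = (real (r div k) + 1) * (40 * real n + 10 * real k + 66) + 3 * real n + 12"
      by (simp add: windows_time_def algebra_simps)
    also have "\<dots> \<le> (real r / real k + 1) * (40 * real n + 10 * real k + 66) + 3 * real n + 12"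
      using d2 by (intro add_right_mono mult_right_mono) auto
    also have "\<dots> \<le> (real r / real k + 1) * (116 * real n) + 3 * real n + 12"
      using kn n1 k0 by (intro add_right_mono mult_left_mono) auto
    also have "\<dots> = 116 * y + 119 * real n + 12" by (simp add: y_def algebra_simps)
    finally show ?thesis using n1 by linarith
  qed
  have t2: "real (phase_windows_time k) \<le> 232 * y + 900 * real n"
  proof -
    have "real (phase_windows_time k) = 24 * (real (16 ^ k) * real k) + 13 * real (16 ^ k) + 2 * real (windows_time k) + 9"
      unfolding phase_windows_time_def by (simp add: algebra_simps)
    then show ?thesis using p16 wt n1 by linarith
  qed
  have Dn: "real D + 1 \<le> z" using mult_right_mono[OF n1, of "real D + 1"] by (simp add: z_def)
  have t3: "real (tables_time D) \<le> 277 * z"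
  proof -
    have "real (tables_time D) = 67 * z + 120 * real D + 120 + 15 * real n + 75"
      unfolding tables_time_def by (simp add: z_def algebra_simps)
    then show ?thesis using Dn zn n1 by linarith
  qed
  have t4: "real (scan_time D) \<le> 217 * z"
  proof -
    have "real (scan_time D) = 88 * z + 120 * real D + 120 + 9"
      unfolding scan_time_def by (simp add: z_def algebra_simps)
    then show ?thesis using Dn zn n1 by linarith
  qed
  have "real (total_time k D) \<le> 113 * y + 200 * real n + (232 * y + 900 * real n) + 277 * z + 217 * z + 13 * real n + 30"
    unfolding total_time_def using t1 t2 t3 t4 by simp
  also have "\<dots> \<le> 2000 * y + 2000 * z" using y0 zn n1 by linarith
  finally show ?thesis unfolding y_def z_def distrib_left[symmetric] .
qed

text \<open>The inequality \<open>r < 256 ^ k\<close> says that log r is at most 8 k: blocks are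
  long enough for the claimed speedup, up to the factor 8.\<close>

lemma block_len_log:
  assumes "block_len k"
  shows "real n * real r / real k \<le> 8 * (real n * real r / log 2 (max 2 (real r)))"
proof -
  have k: "1 \<le> k" "r < 256 ^ k" using assms by (auto simp: block_len_def)
  have "(256::nat) ^ 1 \<le> 256 ^ k" by (rule power_increasing) (use k(1) in auto)
  then have "2 \<le> (256::nat) ^ k" unfolding power_one_right by linarith
  then have "max 2 r \<le> 256 ^ k" using k(2) by simp
  then have "real (max 2 r) \<le> real (256 ^ k)" by (simp only: of_nat_le_iff)
  then have "max 2 (real r) \<le> 256 ^ k" by (simp add: of_nat_max)
  then have "log 2 (max 2 (real r)) \<le> log 2 (256 ^ k)" by (intro log_mono) auto
  also have "\<dots> = real k * log 2 256" by (simp add: log_nat_power)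
  also have "log 2 (256::real) = 8"
    using log_pow_cancel[of "2::real" 8] by simp
  finally have l: "log 2 (max 2 (real r)) \<le> 8 * real k" by simp
  have l1: "1 \<le> log 2 (max 2 (real r))" by (simp add: le_log_iff)
  have "real n * real r * log 2 (max 2 (real r)) \<le> real n * real r * (8 * real k)"
    using l by (intro mult_left_mono) auto
  then show ?thesis using l1 k(1) by (simp add: field_simps)
qed

end

definition prologue :: "instr list" where
  "prologue = [Const (treg 0) 0, Load (treg 0) (treg 0), Const (treg 1) 3, Op Mul 0 (treg 0) (treg 1),
     Const (treg 1) 2, Op Add 0 0 (treg 1)]"

definition program :: "instr list" where
  "program = prologue @ ccom 6 sized.main_prog"

lemma word_size:
  assumes "16 * log 2 (real n + 2) \<le> real w"
  shows "(n + 2) ^ 16 \<le> (2::nat) ^ w"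
proof -
  have "real ((n + 2) ^ 16) = (real n + 2) ^ 16" by (simp add: add.commute)
  also have "\<dots> = (2 powr log 2 (real n + 2)) ^ 16" by simp
  also have "\<dots> = 2 powr (16 * log 2 (real n + 2))"
    by (subst powr_power) auto
  also have "\<dots> \<le> 2 powr real w" using assms by (intro powr_mono) auto
  also have "\<dots> = real (2 ^ w)" by (simp add: powr_realpow)
  finally show ?thesis by (simp only: of_nat_le_iff)
qed

lemma program_correct:
  assumes n: "length A = n" "length B = n" "length P = r" and rn: "r \<le> n"
    and w: "(n + 2) ^ 16 \<le> (2::nat) ^ w"
  defines "s \<equiv> init_config (input_words A B P)" and "l \<equiv> lcs A B"
  shows "terminates w program s \<and> is_STR_IC_LCS A B P (answer (final_config w program s)) \<and>
    (0 < n \<longrightarrow> real (run_time w program s) \<le> 20000 * real (length program) * time_bound n r l) \<and>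
    real (run_space w program s) \<le> 10000 * space_bound n l"
proof -
  define M where "M = 300 * ((l + 1) * (n - l + 1))"
  define Z where "Z = 3 * n + 2"
  define W where "W = (2::nat) ^ w"
  have ln: "l \<le> n" using lcs_le[of A B] n by (simp add: l_def)
  have S: "n + 1 \<le> (l + 1) * (n - l + 1)" by (rule space_shape[OF ln])
  \<comment> \<open>Addresses are bounded by a constant times the square of \<open>n + 2\<close>. As
    \<open>n + 2\<close> is at least 2, its 14th power swallows the constant 9603; together with the
    square this is the exponent 16.\<close>
  have big: "Z + narr * M < W"
  proof -
    have "(l + 1) * (n - l + 1) \<le> (n + 2) * (n + 2)" using ln by (intro mult_le_mono) auto
    then have "Z + narr * M \<le> 3 * (n + 2) + 9600 * ((n + 2) * (n + 2))" by (simp add: Z_def M_def narr_def)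
    also have "\<dots> \<le> 9603 * ((n + 2) * (n + 2))" by simp
    also have "\<dots> < 2 ^ 14 * ((n + 2) * (n + 2))" by simp
    also have "\<dots> \<le> (n + 2) ^ 14 * ((n + 2) * (n + 2))" by (intro mult_le_mono1 power_mono) auto
    also have "\<dots> = (n + 2) ^ (14 + 2)" unfolding power_add power2_eq_square ..
    also have "\<dots> = (n + 2) ^ 16" by (rule arg_cong[of _ _ "power _"]) simp
    finally show ?thesis using w by (simp add: W_def)
  qed
  have M0: "0 < M" by (simp add: M_def)
  have MW: "M < W" using big M0 by (simp add: narr_def)
  interpret ram W M Z w program by unfold_locales (use big M0 in \<open>auto simp: W_def\<close>)
  interpret sized W M Z n r
    by unfold_locales (use rn S MW in \<open>auto simp: M_def Z_def\<close>)
  let ?x = "input_words A B P"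
  have lx: "length ?x = 2 * n + r + 2" using n by (simp add: input_words_def)
  \<comment> \<open>All arrays start with zeros since the memory beyond the input does; the match
    masks depend on this.\<close>
  define s0 where "s0 = \<lparr>vv = (\<lambda>_. 0), aa = (\<lambda>k i. if k = 0 then mem s i else 0), clk = 0\<rparr>"
  have "wp main_prog (\<lambda>t. is_STR_IC_LCS A B P (result t) \<and>
     (\<exists>k. block_len k \<and> clk t \<le> clk s0 + total_time k (n - l))) s0"
    unfolding l_def
    by (rule main_prog_wp) (use n lx in \<open>auto simp: s0_def s_def init_config_def M_def l_def\<close>)
  then obtain t k where t: "big main_prog s0 t" "is_STR_IC_LCS A B P (result t)" "block_len k"
    "clk t \<le> total_time k (n - l)"
    by (auto simp: wp_def s0_def)
  define s1 where "s1 = exec w (Const (treg 0) 0) s"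
  define s2 where "s2 = exec w (Load (treg 0) (treg 0)) s1"
  define s3 where "s3 = exec w (Const (treg 1) 3) s2"
  define s4 where "s4 = exec w (Op Mul 0 (treg 0) (treg 1)) s3"
  define s5 where "s5 = exec w (Const (treg 1) 2) s4"
  define s6 where "s6 = exec w (Op Add 0 0 (treg 1)) s5"
  have pcs: "pc s = 0" "pc s1 = 1" "pc s2 = 2" "pc s3 = 3" "pc s4 = 4" "pc s5 = 5" "pc s6 = 6"
    by (simp_all add: s_def init_config_def s1_def s2_def s3_def s4_def s5_def s6_def)
  have code: "code_at program 0 prologue" "code_at program 6 (ccom 6 main_prog)"
  proof -
    have "code_at program 0 program" by (simp add: code_at_def)
    then have *: "code_at program 0 prologue \<and> code_at program (0 + length prologue) (ccom 6 main_prog)"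
      unfolding code_at_append[symmetric] program_def .
    have "length prologue = 6" by (simp add: prologue_def)
    with * show "code_at program 0 prologue" "code_at program 6 (ccom 6 main_prog)" by simp_all
  qed
  note code1 = code(1)[unfolded prologue_def code_at_Cons]
  have lim: "0 < limit" using M0 by (simp add: limit_def narr_def)
  have "reach 1 s s1" unfolding s1_def
    by (rule reach_instr[where c = "[]"]) (use code1 pcs in \<open>auto simp: code_at_Cons numeral_eq_Suc\<close>)
  moreover have "reach 1 s1 s2" unfolding s2_def
    by (rule reach_instr[where c = "[]"]) (use code1 pcs lim in \<open>auto simp: code_at_Cons numeral_eq_Suc s1_def\<close>)
  moreover have "reach 1 s2 s3" unfolding s3_def
    by (rule reach_instr[where c = "[]"]) (use code1 pcs in \<open>auto simp: code_at_Cons numeral_eq_Suc\<close>)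
  moreover have "reach 1 s3 s4" unfolding s4_def
    by (rule reach_instr[where c = "[]"]) (use code1 pcs in \<open>auto simp: code_at_Cons numeral_eq_Suc\<close>)
  moreover have "reach 1 s4 s5" unfolding s5_def
    by (rule reach_instr[where c = "[]"]) (use code1 pcs in \<open>auto simp: code_at_Cons numeral_eq_Suc\<close>)
  moreover have "reach 1 s5 s6" unfolding s6_def
    by (rule reach_instr[where c = "[]"]) (use code1 pcs in \<open>auto simp: code_at_Cons numeral_eq_Suc\<close>)
  ultimately have "reach (1 + (1 + (1 + (1 + (1 + 1))))) s s6" by (intro reach_trans)
  then have pro: "reach 6 s s6" by (simp add: eval_nat_numeral)
  have rel0: "rel s0 s6"
  proof -
    have m0: "mem s 0 = n" using n by (simp add: s_def init_config_def input_words_def)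
    have Zb: "n * 3 < W" "Z < W" "3 < W" "2 < W" using big nM MW by (auto simp: Z_def)
    have "regs s6 0 = Z"
      using Zb m0 by (simp add: s6_def s5_def s4_def s3_def s2_def s1_def W_def[symmetric] Z_def)
    moreover have "regs s6 (vreg x) = 0" for x
      by (simp add: s6_def s5_def s4_def s3_def s2_def s1_def s_def init_config_def)
    moreover have ms: "mem s6 = mem s"
      by (simp add: s6_def s5_def s4_def s3_def s2_def s1_def)
    moreover have "mem s6 (addr k i) = 0" if "k \<noteq> 0" for k i
    proof -
      have "length ?x \<le> addr k i" using that rn lx unfolding addr_def by (simp add: Z_def)
      then show ?thesis unfolding ms by (simp add: s_def init_config_def)
    qed
    ultimately show ?thesis by (auto simp: rel_def s0_def addr_def)
  qed
  let ?L = "length program"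
  have lp: "?L = 6 + clen main_prog" by (simp add: program_def prologue_def)
  obtain u \<sigma> where u: "reach u s6 \<sigma>" "u \<le> ?L * (clk t - clk s0)" "rel t \<sigma>" "pc \<sigma> = 6 + clen main_prog"
    using ccom_correct[OF t(1) code(2) rel0 pcs(7), of ?L] lp by auto
  have tot: "reach (6 + u) s \<sigma>" by (rule reach_trans[OF pro u(1)])
  have halt: "halted program (run w program (6 + u) s)"
    using tot u(4) lp by (simp add: reach_def halted_def)
  have rt: "run_time w program s = 6 + u"
    unfolding run_time_def
  proof (rule Least_equality)
    fix y assume "halted program (run w program y s)"
    then show "6 + u \<le> y" using tot unfolding reach_def by (meson not_le)
  qed (rule halt)
  have fin: "final_config w program s = \<sigma>"
    using tot by (simp add: final_config_def rt reach_def)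
  \<comment> \<open>The output has at most \<open>n + 1\<close> cells and so lies below
    \<open>Z\<close>, where machine memory and array 0 agree.\<close>
  have "answer \<sigma> = result t"
  proof -
    have m: "mem \<sigma> i = aa t 0 i" if "i < Z" for i
    proof -
      have "mem \<sigma> (addr 0 i) = aa t 0 i" using u(3) that by (simp add: rel_def narr_def)
      then show ?thesis by (simp add: addr_def)
    qed
    have m0: "mem \<sigma> 0 = aa t 0 0" by (rule m) (simp add: Z_def)
    show ?thesis
    proof (cases "aa t 0 0 = 0")
      case True
      then show ?thesis by (simp add: answer_def result_def m0)
    next
      case False
      then have "ic_candidate A B P (map (aa t 0) [1..<aa t 0 0])"
        using t(2) by (simp add: result_def is_STR_IC_LCS_def)
      then have "length (map (aa t 0) [1..<aa t 0 0]) \<le> n"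
        using n by (auto simp: ic_candidate_def common_subseq_def dest: list_emb_length)
      then have "aa t 0 0 \<le> Z" by (simp add: Z_def)
      then have "map (mem \<sigma>) [1..<aa t 0 0] = map (aa t 0) [1..<aa t 0 0]" using m by auto
      then show ?thesis using False by (simp add: answer_def result_def m0)
    qed
  qed
  then have correct: "is_STR_IC_LCS A B P (answer (final_config w program s))" using t(2) fin by simp
  have time: "real (run_time w program s) \<le> 20000 * real ?L * time_bound n r l" if n0: "0 < n"
  proof -
    let ?T = "time_bound n r l"
    have "real (total_time k (n - l)) \<le> 2000 * (real n * real r / real k + real n * (real (n - l) + 1))"
      by (rule total_time_bound[OF t(3) n0])
    also have "\<dots> \<le> 2000 * (8 * (real n * real r / log 2 (max 2 (real r))) + 8 * (real n * (real (n - l) + 1)))"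
      using block_len_log[OF t(3)] by (intro mult_left_mono add_mono) auto
    also have "\<dots> = 16000 * ?T" using ln by (simp add: time_bound_def of_nat_diff algebra_simps)
    finally have T: "real (clk t) \<le> 16000 * ?T" using t(4) by linarith
    \<comment> \<open>With a bound of at least 1 the constant cost of the prologue is absorbed; this
      needs \<open>0 < n\<close>.\<close>
    have T1: "1 \<le> ?T"
    proof -
      have "0 \<le> real n * real r / log 2 (max 2 (real r))" by (auto intro!: divide_nonneg_nonneg simp: zero_le_log_cancel_iff)
      moreover have "1 * 1 \<le> real n * (real n - real l + 1)" using n0 ln by (intro mult_mono) auto
      ultimately show ?thesis unfolding time_bound_def by linarith
    qed
    have "real u \<le> real ?L * real (clk t)" using u(2) by (simp add: s0_def flip: of_nat_mult)
    also have "\<dots> \<le> real ?L * (16000 * ?T)" using T by (intro mult_left_mono) auto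
    finally have "real u \<le> 16000 * (real ?L * ?T)" by simp
    moreover have "6 * 1 \<le> real ?L * ?T" using T1 lp by (intro mult_mono) auto
    ultimately show ?thesis by (simp add: rt)
  qed
  have space: "real (run_space w program s) \<le> 10000 * space_bound n l"
  proof -
    have "run_space w program s \<le> limit"
      unfolding run_space_def rt
      by (rule Least_le) (use tot in \<open>auto simp: reach_def\<close>)
    also have "limit \<le> 10000 * ((l + 1) * (n - l + 1))"
      unfolding limit_def using S by (simp add: M_def Z_def narr_def)
    finally have "real (run_space w program s) \<le> real (10000 * ((l + 1) * (n - l + 1)))"
      by (simp only: of_nat_le_iff)
    also have "\<dots> = 10000 * space_bound n l"
      unfolding of_nat_mult of_nat_add of_nat_diff[OF ln] space_bound_def by simp
    finally show ?thesis .
  qed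
  show ?thesis using halt correct time space by (auto simp: terminates_def)
qed

(* One program serves all inputs and all word sizes w >= c log n, in particular w = Theta(log n);
   the constant c is needed because a word has to address quadratically many cells. The characters
   are arbitrary words. The time bound vanishes for n = 0, so time is bounded for n > 0 only. *)
theorem theorem2:
  "\<exists>(prog :: instr list) (c :: real) (C :: real). 1 \<le> c \<and>
     (\<forall>(n :: nat) (r :: nat) (w :: nat) (A :: nat list) (B :: nat list) (P :: nat list).
        length A = n \<and> length B = n \<and> length P = r \<and> r \<le> n \<and>
        c * log 2 (real n + 2) \<le> real w \<and>
        set A \<union> set B \<union> set P \<subseteq> {..<2 ^ w} \<longrightarrow>
        (let s = init_config (input_words A B P); l = lcs A B in
           terminates w prog s \<and>
           is_STR_IC_LCS A B P (answer (final_config w prog s)) \<and>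
           (n > 0 \<longrightarrow> real (run_time w prog s) \<le> C * time_bound n r l) \<and>
           real (run_space w prog s) \<le> C * space_bound n l))"
proof (rule exI[of _ program], rule exI[of _ 16], rule exI[of _ "20000 * real (length program)"],
    intro conjI allI impI)
  fix n r w :: nat and A B P :: "nat list"
  assume *: "length A = n \<and> length B = n \<and> length P = r \<and> r \<le> n \<and>
    16 * log 2 (real n + 2) \<le> real w \<and> set A \<union> set B \<union> set P \<subseteq> {..<2 ^ w}"
  let ?s = "init_config (input_words A B P)" and ?l = "lcs A B"
  have c: "terminates w program ?s \<and> is_STR_IC_LCS A B P (answer (final_config w program ?s)) \<and>
    (0 < n \<longrightarrow> real (run_time w program ?s) \<le> 20000 * real (length program) * time_bound n r ?l) \<and>
    real (run_space w program ?s) \<le> 10000 * space_bound n ?l"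
    by (rule program_correct) (use * word_size in auto)
  have "?l \<le> n" using * lcs_le[of A B] by simp
  then have sb: "0 \<le> space_bound n ?l" by (simp add: space_bound_def)
  have "1 \<le> real (length program)" by (simp add: program_def prologue_def)
  then have "10000 \<le> 20000 * real (length program)" by linarith
  then have "10000 * space_bound n ?l \<le> 20000 * real (length program) * space_bound n ?l"
    using sb by (rule mult_right_mono)
  then show "let s = ?s; l = ?l in
     terminates w program s \<and> is_STR_IC_LCS A B P (answer (final_config w program s)) \<and>
     (n > 0 \<longrightarrow> real (run_time w program s) \<le> 20000 * real (length program) * time_bound n r l) \<and>
     real (run_space w program s) \<le> 20000 * real (length program) * space_bound n l"
    using c by (auto simp: Let_def)
qed simp

end
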